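(* Let $X$ be a time-frequency shifts invariant Banach space on $\mathbb R^d$ with polynomial weight $v$ and constant $C>0$, so that $\|\pi_z u\|_X\le C\,v(z)\|u\|_X$ for all $u\in X$, $z\in\mathbb R^{2d}$. Let $L\in GL(2d)$ and $q\in L^1(\mathbb R^{2d})$. Assume that the Fourier transform $\hat q$ of $q$ satisfies $$\sigma_{L,v}(q):=\sum_{\kappa\in\mathbb Z^{2d}}v(\mathcal J L^{-T}\kappa)\,|\hat q(L^{-T}\kappa)|<+\infty .$$ Then for every $\tau\in[0,1]$ the operator $\mathrm{Op}_\tau(q_L)$, where $q_L(z)=\sum_{\kappa\in\mathbb Z^{2d}}q(z+L\kappa)$ is the $L$-periodization of $q$, is bounded on $X$ and $$\|\mathrm{Op}_\tau(q_L)\|_{\mathcal L(X)}\le\frac{C}{|\det L|}\,\sigma_{L,v}(q).$$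
   Context: $GL(2d)$ is the set of real invertible $2d\times 2d$ matrices, $L^{-T}=(L^{-1})^T$, and $\mathcal J=\begin{pmatrix}0&-I\\ I&0\end{pmatrix}$ with $d\times d$ blocks. Fourier transform: $\hat q(\theta)=\int_{\mathbb R^{2d}}q(z)e^{-2\pi i\langle\theta,z\rangle}dz$ (same normalization on $\mathbb R^d$). For $z=(x,\omega)\in\mathbb R^{2d}$, $T_xf(t)=f(t-x)$, $M_\omega f(t)=e^{2\pi i\omega\cdot t}f(t)$, $\pi_z f=M_\omega T_xf$ (extended to distributions). A polynomial weight is $v(z)=(1+|z|)^s$ for some $s\ge0$. A Banach space $X$ with $\mathcal S(\mathbb R^d)\hookrightarrow X\hookrightarrow\mathcal S'(\mathbb R^d)$ and $\mathcal S(\mathbb R^d)$ dense in $X$ is called time-frequency shifts invariant if for some polynomial weight $v$ and some constant $C>0$, $\|\pi_z u\|_X\le C v(z)\|u\|_X$ for all $u\in X$, $z\in\mathbb R^{2d}$. For $q\in L^1(\mathbb R^{2d})$ the series defining $q_L$ converges absolutely a.e. and in $\mathcal S'(\mathbb R^{2d})$. For a symbol $p\in\mathcal S'(\mathbb R^{2d})$ and $\tau\in[0,1]$, the pseudodifferential operator $\mathrm{Op}_\tau(p):\mathcal S(\mathbb R^d)\to\mathcal S'(\mathbb R^d)$ is $$\mathrm{Op}_\tau(p)u(x)=\int_{\mathbb R^d_\omega}\int_{\mathbb R^d_y}e^{2\pi i(x-y)\cdot\omega}p\big((1-\tau)x+\tau y,\omega\big)u(y)\,dy\,d\omega,$$ where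 the integral is understood in the distribution sense. "Bounded on $X$" means it extends from $\mathcal S(\mathbb R^d)$ to an element of $\mathcal L(X)$, the bounded linear operators on $X$. *)

theory Defs
  imports "HOL-Analysis.Analysis"
begin

section \<open>Schwartz functions and tempered distributions\<close>

definition partial_deriv :: "'k \<Rightarrow> (real^'k \<Rightarrow> complex) \<Rightarrow> (real^'k::finite \<Rightarrow> complex)" where
  "partial_deriv i f x = frechet_derivative f (at x) (axis i 1)"

text \<open>Multi-indices are lists of coordinate directions: the derivative along \<open>[i, j, \<dots>]\<close> is
  \<open>\<partial>\<^sub>i \<partial>\<^sub>j \<dots> f\<close>. All iterated partial derivatives being differentiable everywhere
  is the same as \<open>f\<close> being smooth.\<close>

definition iter_deriv :: "'k list \<Rightarrow> (real^'k \<Rightarrow> complex) \<Rightarrow> (real^'k::finite \<Rightarrow> complex)" where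
  "iter_deriv js f = foldr partial_deriv js f"

definition schwartz :: "(real^'k::finite \<Rightarrow> complex) set" where
  "schwartz = {f. \<forall>js.
      (\<forall>x. iter_deriv js f differentiable at x) \<and>
      (\<forall>m::nat. bounded (range (\<lambda>x. (1 + norm x) ^ m *\<^sub>R iter_deriv js f x)))}"

text \<open>The increasing sequence of norms \<open>schwartz_norm m\<close> generates the Frechet topology of the
  Schwartz space; a linear map from it to a normed space is continuous iff it is dominated by a
  multiple of one of them.\<close>

definition schwartz_norm :: "nat \<Rightarrow> (real^'k::finite \<Rightarrow> complex) \<Rightarrow> real" where
  "schwartz_norm m f =
     (\<Sum>js | length js \<le> m. SUP x. (1 + norm x) ^ m * cmod (iter_deriv js f x))"

text \<open>Distributions are functionals on all functions, normalised to vanish off the Schwartz space,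
  so that HOL equality is equality of distributions and the vector space operations are pointwise.
  The pairing is bilinear (no complex conjugation).\<close>

type_synonym 'k functional = "(real^'k \<Rightarrow> complex) \<Rightarrow> complex"

definition tempered :: "'k::finite functional set" where
  "tempered = {T.
      (\<forall>f. f \<notin> schwartz \<longrightarrow> T f = 0) \<and>
      (\<forall>f\<in>schwartz. \<forall>g\<in>schwartz. T (\<lambda>x. f x + g x) = T f + T g) \<and>
      (\<forall>c. \<forall>f\<in>schwartz. T (\<lambda>x. c * f x) = c * T f) \<and>
      (\<exists>m B. \<forall>f\<in>schwartz. cmod (T f) \<le> B * schwartz_norm m f)}"

text \<open>The distribution represented by a function.\<close>

definition distr_of :: "(real^'k \<Rightarrow> complex) \<Rightarrow> 'k::finite functional" where
  "distr_of g = (\<lambda>\<phi>. if \<phi> \<in> schwartz then LINT x|lebesgue. g x * \<phi> x else 0)"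


section \<open>Phase space\<close>

text \<open>\<open>\<real>\<^sup>2\<^sup>d\<close> is \<open>real^('n + 'n)\<close> with \<open>d = CARD('n)\<close>; a point \<open>z = (x, \<omega>)\<close> has \<open>x\<close> as its
  \<open>Inl\<close> components and \<open>\<omega>\<close> as its \<open>Inr\<close> components.\<close>

definition pos :: "real^('n + 'n) \<Rightarrow> real^'n::finite" where
  "pos z = (\<chi> i. z $ Inl i)"

definition freq :: "real^('n + 'n) \<Rightarrow> real^'n::finite" where
  "freq z = (\<chi> i. z $ Inr i)"

text \<open>The block matrix with rows \<open>(0, -I)\<close> and \<open>(I, 0)\<close>.\<close>

definition J_mat :: "real^('n + 'n)^('n::finite + 'n)" where
  "J_mat = (\<chi> r c. case (r, c) of
      (Inl i, Inr j) \<Rightarrow> if i = j then -1 else 0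
    | (Inr i, Inl j) \<Rightarrow> if i = j then 1 else 0
    | _ \<Rightarrow> 0)"

definition int_lattice :: "(real^'k::finite) set" where
  "int_lattice = {\<kappa>. \<forall>i. \<kappa> $ i \<in> \<int>}"

definition inv_transpose :: "real^'k^'k \<Rightarrow> real^'k^'k::finite" where
  "inv_transpose L = transpose (matrix_inv L)"

definition poly_weight :: "real \<Rightarrow> real^'k::finite \<Rightarrow> real" where
  "poly_weight s z = (1 + norm z) powr s"

definition fourier :: "(real^'k \<Rightarrow> complex) \<Rightarrow> real^'k::finite \<Rightarrow> complex" where
  "fourier q \<theta> = (LINT z|lebesgue. q z * cis (- 2 * pi * (\<theta> \<bullet> z)))"

text \<open>Unordered summation of complex numbers, i.e. absolute convergence; the value is \<open>0\<close> on the
  null set where the series does not converge absolutely.\<close>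

definition periodization :: "real^'k^'k \<Rightarrow> (real^'k \<Rightarrow> complex) \<Rightarrow> real^'k::finite \<Rightarrow> complex" where
  "periodization L q z = (\<Sum>\<^sub>\<infinity>\<kappa>\<in>int_lattice. q (z + L *v \<kappa>))"


section \<open>Time-frequency shifts of distributions\<close>

text \<open>Dual actions extending \<open>T\<^sub>x f(t) = f(t - x)\<close> and \<open>M\<^sub>\<omega> f(t) = exp(2 \<pi> i \<omega> \<cdot> t) f(t)\<close>:
  \<open>\<integral> f(t - x) \<phi>(t) dt = \<integral> f(t) \<phi>(t + x) dt\<close>, and \<open>M\<^sub>\<omega>\<close> is its own transpose.\<close>

definition translate :: "real^'n \<Rightarrow> 'n::finite functional \<Rightarrow> 'n functional" where
  "translate x T = (\<lambda>\<phi>. T (\<lambda>t. \<phi> (t + x)))"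

definition modulate :: "real^'n \<Rightarrow> 'n::finite functional \<Rightarrow> 'n functional" where
  "modulate \<omega> T = (\<lambda>\<phi>. T (\<lambda>t. cis (2 * pi * (\<omega> \<bullet> t)) * \<phi> t))"

definition tf_shift :: "real^('n + 'n) \<Rightarrow> 'n::finite functional \<Rightarrow> 'n functional" where
  "tf_shift z T = modulate (freq z) (translate (pos z) T)"


section \<open>Banach spaces of tempered distributions\<close>

locale complex_banach_space_on =
  fixes X :: "('a \<Rightarrow> complex) set" and N :: "('a \<Rightarrow> complex) \<Rightarrow> real"
  assumes zero: "(\<lambda>_. 0) \<in> X"
    and add: "\<lbrakk>u \<in> X; w \<in> X\<rbrakk> \<Longrightarrow> (\<lambda>a. u a + w a) \<in> X"
    and scale: "u \<in> X \<Longrightarrow> (\<lambda>a. c * u a) \<in> X"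
    and norm_ge_0: "u \<in> X \<Longrightarrow> 0 \<le> N u"
    and norm_eq_0: "u \<in> X \<Longrightarrow> N u = 0 \<longleftrightarrow> u = (\<lambda>_. 0)"
    and norm_add: "\<lbrakk>u \<in> X; w \<in> X\<rbrakk> \<Longrightarrow> N (\<lambda>a. u a + w a) \<le> N u + N w"
    and norm_scale: "u \<in> X \<Longrightarrow> N (\<lambda>a. c * u a) = cmod c * N u"
    and complete: "\<lbrakk>\<And>n. U n \<in> X;
        \<forall>e>0. \<exists>M. \<forall>m\<ge>M. \<forall>n\<ge>M. N (\<lambda>a. U m a - U n a) < e\<rbrakk>
      \<Longrightarrow> \<exists>u\<in>X. (\<lambda>n::nat. N (\<lambda>a. U n a - u a)) \<longlonglongrightarrow> 0"

text \<open>The dense continuous embedding of the Schwartz space is \<open>distr_of\<close>. The continuous embedding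
  into the tempered distributions is the inclusion, continuous for the weak-* topology (by the
  uniform boundedness principle this is the same as continuity for the strong dual topology).\<close>

locale tempered_banach_space = complex_banach_space_on X N
  for X :: "'n::finite functional set" and N :: "'n functional \<Rightarrow> real" +
  assumes schwartz_subset: "\<phi> \<in> schwartz \<Longrightarrow> distr_of \<phi> \<in> X"
    and schwartz_continuous:
      "\<exists>m B. \<forall>\<phi>\<in>schwartz. N (distr_of \<phi>) \<le> B * schwartz_norm m \<phi>"
    and schwartz_dense:
      "\<lbrakk>u \<in> X; e > 0\<rbrakk> \<Longrightarrow> \<exists>\<phi>\<in>schwartz. N (\<lambda>\<psi>. u \<psi> - distr_of \<phi> \<psi>) < e"
    and subset_tempered: "X \<subseteq> tempered"
    and tempered_continuous: "\<phi> \<in> schwartz \<Longrightarrow> \<exists>B. \<forall>u\<in>X. cmod (u \<phi>) \<le> B * N u"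

locale tf_invariant_space = tempered_banach_space X N
  for X :: "'n::finite functional set" and N :: "'n functional \<Rightarrow> real" +
  fixes s C :: real
  assumes s_ge_0: "s \<ge> 0"
    and C_pos: "C > 0"
    and shift_mem: "u \<in> X \<Longrightarrow> tf_shift z u \<in> X"
    and shift_bound: "u \<in> X \<Longrightarrow> N (tf_shift z u) \<le> C * poly_weight s z * N u"

definition bounded_linear_operator ::
  "('a \<Rightarrow> complex) set \<Rightarrow> (('a \<Rightarrow> complex) \<Rightarrow> real) \<Rightarrow> (('a \<Rightarrow> complex) \<Rightarrow> ('a \<Rightarrow> complex)) \<Rightarrow> bool"
where
  "bounded_linear_operator X N A \<longleftrightarrow>
     (\<forall>u\<in>X. A u \<in> X) \<and>
     (\<forall>u\<in>X. \<forall>w\<in>X. A (\<lambda>a. u a + w a) = (\<lambda>a. A u a + A w a)) \<and>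
     (\<forall>c. \<forall>u\<in>X. A (\<lambda>a. c * u a) = (\<lambda>a. c * A u a)) \<and>
     (\<exists>B. \<forall>u\<in>X. N (A u) \<le> B * N u)"

text \<open>As for \<^const>\<open>onorm\<close>, the quotient is \<open>0\<close> at \<open>u = 0\<close>.\<close>

definition operator_norm ::
  "('a \<Rightarrow> complex) set \<Rightarrow> (('a \<Rightarrow> complex) \<Rightarrow> real) \<Rightarrow> (('a \<Rightarrow> complex) \<Rightarrow> ('a \<Rightarrow> complex)) \<Rightarrow> real"
where
  "operator_norm X N A = (SUP u\<in>X. N (A u) / N u)"

definition bounded_extension ::
  "'n::finite functional set \<Rightarrow> ('n functional \<Rightarrow> real) \<Rightarrow> ((real^'n \<Rightarrow> complex) \<Rightarrow> 'n functional)
    \<Rightarrow> ('n functional \<Rightarrow> 'n functional) \<Rightarrow> bool"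
where
  "bounded_extension X N T A \<longleftrightarrow>
     bounded_linear_operator X N A \<and> (\<forall>u\<in>schwartz. A (distr_of u) = T u)"


section \<open>Pseudodifferential operators\<close>

text \<open>Pairing \<open>Op\<^sub>\<tau>(p)u\<close> with a test function \<open>\<phi>\<close> gives formally
  \<open>\<integral>\<integral>\<integral> exp(2 \<pi> i (x - y) \<cdot> \<omega>) p((1 - \<tau>) x + \<tau> y, \<omega>) u(y) \<phi>(x) dy d\<omega> dx\<close>.
  The substitution \<open>r = (1 - \<tau>) x + \<tau> y\<close>, \<open>t = x - y\<close> has unit Jacobian and inverse
  \<open>x = r + \<tau> t\<close>, \<open>y = r - (1 - \<tau>) t\<close>, so this is the pairing of \<open>p\<close> with the function
  \<open>(r, \<omega>) \<mapsto> \<integral> exp(2 \<pi> i t \<cdot> \<omega>) \<phi>(r + \<tau> t) u(r - (1 - \<tau>) t) dt\<close>, which is again Schwartz: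
  this is the meaning of the integral in the sense of distributions.\<close>

definition wigner :: "real \<Rightarrow> (real^'n \<Rightarrow> complex) \<Rightarrow> (real^'n \<Rightarrow> complex)
    \<Rightarrow> real^('n + 'n) \<Rightarrow> complex" where
  "wigner \<tau> u \<phi> z = (LINT t|lebesgue.
     cis (2 * pi * (t \<bullet> freq z)) * \<phi> (pos z + \<tau> *\<^sub>R t) * u (pos z - (1 - \<tau>) *\<^sub>R t))"

definition Op :: "real \<Rightarrow> ('n + 'n) functional \<Rightarrow> (real^'n \<Rightarrow> complex) \<Rightarrow> 'n::finite functional" where
  "Op \<tau> p u = (\<lambda>\<phi>. if \<phi> \<in> schwartz then p (wigner \<tau> u \<phi>) else 0)"

end

theory Submission
  imports Defs "HOL-Probability.Characteristic_Functions" "HOL-Probability.Sinc_Integral"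
begin

text \<open>The symbol \<open>q\<^sub>L\<close> is periodic with respect to the lattice \<open>L\<int>\<^sup>2\<^sup>d\<close>, so it should be a superposition of the
characters \<open>e\<^sub>\<zeta>(z) = exp (2\<pi>i \<zeta> \<cdot> z)\<close> of the dual lattice, \<open>\<zeta> = L\<^sup>-\<^sup>T\<kappa>\<close>, with the coefficients
\<open>(\<F>q)(\<zeta>) / |det L|\<close>. The operator with symbol \<open>e\<^sub>\<zeta>\<close> is the time-frequency shift by \<open>\<J>\<zeta>\<close> up to a factor
of modulus one. Hence \<open>Op\<^sub>\<tau>(q\<^sub>L)\<close> is the series of the shifts \<open>\<pi>\<^sub>\<J>\<^sub>\<zeta>\<close> with coefficients of modulus
\<open>|(\<F>q)(\<zeta>)| / |det L|\<close>, and \<open>\<parallel>\<pi>\<^sub>\<J>\<^sub>\<zeta>\<parallel> \<le> C v(\<J>\<zeta>)\<close> makes it absolutely convergent on \<open>X\<close> with exactly the claimed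
bound on its norm. The Schwartz space is dense, so no other bounded extension exists.\<close>

text \<open>Everything is tested against \<open>W = wigner \<tau> u \<phi>\<close>, and three facts carry the argument.

\<^item> \<open>W\<close> is a Schwartz function (\<open>wigner_schwartz\<close>): derivatives of \<open>W\<close> and its products with
  coordinates are combinations of Wigner transforms of other Schwartz functions, so it is enough
  to bound all of these transforms.

\<^item> The Fourier integral of \<open>W\<close> against \<open>e\<^sub>\<zeta>\<close> is the pairing of \<open>\<pi>\<^sub>\<J>\<^sub>\<zeta> u\<close> with \<open>\<phi>\<close>, up to the phase
  (\<open>integral_character_wigner\<close>): the frequency integral undoes the Fourier integral that defines
  \<open>W\<close>, which needs Fourier inversion; that is proved with a Gaussian summability factor.

\<^item> The pairing of \<open>q\<^sub>L\<close> with \<open>W\<close> equals \<open>\<Sum>\<^sub>\<zeta> ((\<F>q)(\<zeta>) / |det L|) \<integral> e\<^sub>\<zeta> W\<close> (\<open>integral_periodization\<close>).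
  After the change of variables \<open>z = L y\<close>, the periodization moves from \<open>q\<close> to \<open>W\<close> by Fubini. The
  periodization of \<open>W\<close> is continuous, hence a uniform limit of trigonometric polynomials
  (Stone--Weierstrass). The identity is clear for trigonometric polynomials, and both of its sides
  are continuous in the uniform norm because \<open>q\<close> is integrable and its Fourier coefficients are
  summable.\<close>

section \<open>Lebesgue measure in coordinates\<close>

lemma Basis_vec_eq_axis: "(Basis :: (real^'k::finite) set) = (\<lambda>i. axis i 1) ` UNIV"
  by (auto simp: Basis_vec_def)

lemma inj_axis_one: "inj (\<lambda>i. axis i (1::real) :: real^'k::finite)"
  by (auto simp: inj_on_def axis_eq_axis)

lemma prod_Basis_vec: "(\<Prod>b\<in>Basis. x \<bullet> b) = (\<Prod>i\<in>UNIV. (x :: real^'k::finite) $ i)"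
  unfolding Basis_vec_eq_axis by (subst prod.reindex[OF inj_axis_one]) (simp add: inner_axis)

lemma emeasure_lborel_box_vec:
  assumes "\<And>i. l $ i \<le> (u :: real^'k::finite) $ i"
  shows "emeasure lborel (box l u) = ennreal (\<Prod>i\<in>UNIV. u $ i - l $ i)"
proof -
  have "\<forall>b\<in>Basis. l \<bullet> b \<le> u \<bullet> b"
    using assms by (auto simp: Basis_vec_eq_axis inner_axis)
  thus ?thesis by (simp add: emeasure_lborel_box_eq prod_Basis_vec)
qed

lemma lborel_vec_eqI:
  fixes M :: "(real^'k::finite) measure"
  assumes "\<And>l u. (\<And>i. l $ i \<le> u $ i) \<Longrightarrow> emeasure M (box l u) = ennreal (\<Prod>i\<in>UNIV. u $ i - l $ i)"
    and "sets M = sets borel"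
  shows "lborel = M"
proof (rule lborel_eqI[OF _ assms(2)])
  fix l u :: "real^'k" assume lu: "\<And>b. b \<in> Basis \<Longrightarrow> l \<bullet> b \<le> u \<bullet> b"
  have "l $ i \<le> u $ i" for i
    using lu[of "axis i 1"] by (simp add: inner_axis)
  from assms(1)[OF this] show "emeasure M (box l u) = ennreal (\<Prod>b\<in>Basis. (u - l) \<bullet> b)"
    by (simp add: prod_Basis_vec)
qed

lemma vec_lambda_measurable [measurable]:
  "(\<lambda>f. \<chi> i. f i) \<in> (\<Pi>\<^sub>M i\<in>UNIV. lborel) \<rightarrow>\<^sub>M (borel :: (real^'k::finite) measure)"
proof -
  have "(\<lambda>f::'k \<Rightarrow> real. \<chi> i. f i) = (\<lambda>f. \<Sum>i\<in>UNIV. f i *\<^sub>R axis i 1)"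
    by (simp add: fun_eq_iff vec_eq_iff axis_def if_distrib[of "(*) _"] cong: if_cong)
  thus ?thesis by simp
qed

lemma vec_nth_measurable [measurable]: "(\<lambda>x::real^'k::finite. x $ i) \<in> borel_measurable borel"
  by (intro borel_measurable_continuous_onI continuous_intros)

lemma lborel_eq_distr_PiM:
  "(lborel :: (real^'k::finite) measure) = distr (\<Pi>\<^sub>M i\<in>UNIV. lborel) borel (\<lambda>f. \<chi> i. f i)"
proof (rule lborel_vec_eqI)
  interpret product_sigma_finite "\<lambda>_::'k. lborel :: real measure"
    by standard
  fix l u :: "real^'k" assume le: "\<And>i. l $ i \<le> u $ i"
  have "(\<lambda>f. \<chi> i. f i) -` box l u \<inter> space (\<Pi>\<^sub>M i\<in>UNIV. lborel) = (\<Pi>\<^sub>E i\<in>UNIV. {l $ i <..< u $ i})"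
    by (auto simp: mem_box_cart space_PiM PiE_def Pi_iff)
  hence "emeasure (distr (\<Pi>\<^sub>M i\<in>UNIV. lborel) borel (\<lambda>f. \<chi> i. f i)) (box l u)
      = emeasure (\<Pi>\<^sub>M i\<in>UNIV. lborel) (\<Pi>\<^sub>E i\<in>UNIV. {l $ i <..< u $ i})"
    by (subst emeasure_distr) auto
  also have "\<dots> = (\<Prod>i\<in>UNIV. ennreal (u $ i - l $ i))"
    by (subst emeasure_PiM) (auto simp: le)
  also have "\<dots> = ennreal (\<Prod>i\<in>UNIV. u $ i - l $ i)"
    by (subst prod_ennreal) (auto simp: le)
  finally show "emeasure (distr (\<Pi>\<^sub>M i\<in>UNIV. lborel) borel (\<lambda>f. \<chi> i. f i)) (box l u)
      = ennreal (\<Prod>i\<in>UNIV. u $ i - l $ i)" .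
qed simp

lemma nn_integral_lborel_vec_prod:
  fixes f :: "'k::finite \<Rightarrow> real \<Rightarrow> ennreal"
  assumes [measurable]: "\<And>i. f i \<in> borel_measurable borel"
  shows "(\<integral>\<^sup>+x. (\<Prod>i\<in>UNIV. f i (x $ i)) \<partial>(lborel :: (real^'k) measure)) = (\<Prod>i\<in>UNIV. \<integral>\<^sup>+x. f i x \<partial>lborel)"
proof -
  interpret product_sigma_finite "\<lambda>_::'k. lborel :: real measure"
    by standard
  show ?thesis
    by (subst lborel_eq_distr_PiM, subst nn_integral_distr)
       (auto simp: product_nn_integral_prod)
qed

lemma integral_lborel_vec_prod:
  fixes f :: "'k::finite \<Rightarrow> real \<Rightarrow> complex"
  assumes int: "\<And>i. integrable lborel (f i)"
  shows "integrable (lborel :: (real^'k) measure) (\<lambda>x. \<Prod>i\<in>UNIV. f i (x $ i))"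
    and "(\<integral>x. (\<Prod>i\<in>UNIV. f i (x $ i)) \<partial>(lborel :: (real^'k) measure)) = (\<Prod>i\<in>UNIV. \<integral>x. f i x \<partial>lborel)"
proof -
  have [measurable]: "\<And>i. f i \<in> borel_measurable borel"
    using int by (auto dest: borel_measurable_integrable)
  interpret product_sigma_finite "\<lambda>_::'k. lborel :: real measure"
    by standard
  show "integrable (lborel :: (real^'k) measure) (\<lambda>x. \<Prod>i\<in>UNIV. f i (x $ i))"
    by (subst lborel_eq_distr_PiM, subst integrable_distr_eq)
       (auto intro!: product_integrable_prod int)
  show "(\<integral>x. (\<Prod>i\<in>UNIV. f i (x $ i)) \<partial>(lborel :: (real^'k) measure)) = (\<Prod>i\<in>UNIV. \<integral>x. f i x \<partial>lborel)"
    by (subst lborel_eq_distr_PiM, subst integral_distr)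
       (auto simp: product_integral_prod int)
qed

section \<open>Linear changes of variables\<close>

lemma matrix_vector_measurable [measurable]:
  "((*v) (A :: real^'k^'m)) \<in> borel_measurable (borel :: (real^'k::finite) measure)"
  by (intro borel_measurable_continuous_onI linear_continuous_on)
     (rule matrix_vector_mul_bounded_linear)

text \<open>Both sides are multiplicative in \<open>A\<close>, so elementary matrices suffice: diagonal matrices are
covered by the affine change of variables, a transposition permutes the sides of boxes, and a shear
translates one coordinate while the others are held fixed.\<close>

lemma nn_integral_lborel_linear:
  fixes A :: "real^'k^'k::finite"
  shows "\<forall>f\<in>borel_measurable borel. det A \<noteq> 0 \<longrightarrow>
     (\<integral>\<^sup>+x. f x \<partial>lborel) = ennreal \<bar>det A\<bar> * (\<integral>\<^sup>+x. f (A *v x) \<partial>lborel)" (is "?P A")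
proof (induction A rule: induct_matrix_elementary_alt)
  case (1 A B)
  show ?case
  proof (intro ballI impI)
    fix f :: "real^'k \<Rightarrow> ennreal" assume f [measurable]: "f \<in> borel_measurable borel" and "det (A ** B) \<noteq> 0"
    hence nz: "det A \<noteq> 0" "det B \<noteq> 0"
      by (auto simp: det_mul)
    have "(\<integral>\<^sup>+x. f x \<partial>lborel) = ennreal \<bar>det A\<bar> * (\<integral>\<^sup>+x. f (A *v x) \<partial>lborel)"
      by (rule 1(1)[rule_format]) (use f nz in auto)
    also have "(\<integral>\<^sup>+x. f (A *v x) \<partial>lborel) = ennreal \<bar>det B\<bar> * (\<integral>\<^sup>+x. f (A *v (B *v x)) \<partial>lborel)"
      by (rule 1(2)[rule_format, of "\<lambda>x. f (A *v x)"]) (use f nz in auto)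
    finally show "(\<integral>\<^sup>+x. f x \<partial>lborel) = ennreal \<bar>det (A ** B)\<bar> * (\<integral>\<^sup>+x. f ((A ** B) *v x) \<partial>lborel)"
      by (simp add: det_mul abs_mult ennreal_mult mult.assoc matrix_vector_mul_assoc)
  qed
next
  case (2 A i)
  thus ?case by (simp add: det_zero_row)
next
  case (3 A)
  show ?case
  proof (intro ballI impI)
    fix f :: "real^'k \<Rightarrow> ennreal" assume f [measurable]: "f \<in> borel_measurable borel" and nz: "det A \<noteq> 0"
    have det: "det A = (\<Prod>i\<in>UNIV. A $ i $ i)"
      using 3 by (rule det_diagonal)
    note B = Basis_vec_eq_axis[where 'k='k]
    \<comment> \<open>The diagonal entries, indexed by basis vectors as in the affine change of variables.\<close>
    define c where "c = (\<lambda>b::real^'k. A $ (THE i. b = axis i 1) $ (THE i. b = axis i 1))"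
    have c: "c (axis i 1) = A $ i $ i" for i
      by (auto simp: c_def axis_eq_axis)
    have Av: "A *v x = 0 + (\<Sum>j\<in>Basis. (c j * (x \<bullet> j)) *\<^sub>R j)" for x
    proof -
      have "(\<Sum>j\<in>Basis. (c j * (x \<bullet> j)) *\<^sub>R j) = (\<Sum>i\<in>UNIV. (A $ i $ i * x $ i) *\<^sub>R axis i 1)"
        unfolding B by (subst sum.reindex) (simp_all add: inj_on_def axis_eq_axis c inner_axis)
      also have "\<dots> = (\<chi> i. A $ i $ i * x $ i)"
        by (simp add: vec_eq_iff axis_def if_distrib[of "(*) _"] cong: if_cong)
      also have "\<dots> = A *v x"
      proof -
        have "(\<Sum>j\<in>UNIV. A $ i $ j * x $ j) = (\<Sum>j\<in>{i}. A $ i $ j * x $ j)" for i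
          by (rule sum.mono_neutral_right) (use 3 in auto)
        thus ?thesis by (simp add: vec_eq_iff matrix_vector_mult_def)
      qed
      finally show ?thesis by simp
    qed
    hence eq: "(\<lambda>x. 0 + (\<Sum>j\<in>Basis. (c j * (x \<bullet> j)) *\<^sub>R j)) = (*v) A"
      by (intro ext) (rule Av[symmetric])
    have "\<And>j. j \<in> Basis \<Longrightarrow> c j \<noteq> 0"
      using nz by (auto simp: B c det)
    from lborel_affine_euclidean[of c 0, OF this]
    have *: "lborel = density (distr lborel borel ((*v) A)) (\<lambda>_. (\<Prod>j\<in>Basis. \<bar>c j\<bar>))"
      unfolding eq .
    have d: "(\<Prod>j\<in>Basis. \<bar>c j\<bar>) = \<bar>det A\<bar>"
      unfolding det abs_prod B by (subst prod.reindex) (auto simp: inj_on_def axis_eq_axis c)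
    have "(\<integral>\<^sup>+x. f x \<partial>lborel) = (\<integral>\<^sup>+x. f x \<partial>density (distr lborel borel ((*v) A)) (\<lambda>_. ennreal \<bar>det A\<bar>))"
      by (rule arg_cong[OF *[unfolded d]])
    also have "\<dots> = (\<integral>\<^sup>+x. ennreal \<bar>det A\<bar> * f x \<partial>distr lborel borel ((*v) A))"
      by (rule nn_integral_density) simp_all
    also have "\<dots> = (\<integral>\<^sup>+x. ennreal \<bar>det A\<bar> * f (A *v x) \<partial>lborel)"
      by (rule nn_integral_distr) simp_all
    also have "\<dots> = ennreal \<bar>det A\<bar> * (\<integral>\<^sup>+x. f (A *v x) \<partial>lborel)"
      by (rule nn_integral_cmult) simp
    finally show "(\<integral>\<^sup>+x. f x \<partial>lborel) = ennreal \<bar>det A\<bar> * (\<integral>\<^sup>+x. f (A *v x) \<partial>lborel)" .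
  qed
next
  case (4 m n)
  let ?p = "Transposition.transpose m n"
  let ?A = "(\<chi> i j. mat 1 $ i $ ?p j) :: real^'k^'k"
  have Av: "?A *v x = (\<chi> i. x $ ?p i)" for x
  proof -
    have "(\<Sum>j\<in>UNIV. (mat 1 :: real^'k^'k) $ i $ ?p j * x $ j) = (\<Sum>j\<in>{?p i}. (mat 1 :: real^'k^'k) $ i $ ?p j * x $ j)" for i
      by (rule sum.mono_neutral_right) (auto simp: mat_def)
    thus ?thesis by (simp add: vec_eq_iff matrix_vector_mult_def mat_def)
  qed
  have det: "\<bar>det ?A\<bar> = 1"
    using det_permute_columns[of ?p "mat 1 :: real^'k^'k"] by (simp add: permutes_swap_id abs_mult sign_def)
  have "(\<lambda>x::real^'k. \<chi> i. x $ ?p i) = (*v) ?A"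
    by (rule ext) (rule Av[symmetric])
  hence [measurable]: "(\<lambda>x::real^'k. \<chi> i. x $ ?p i) \<in> borel_measurable borel"
    by (simp only: matrix_vector_measurable)
  have *: "(lborel :: (real^'k) measure) = distr lborel borel (\<lambda>x. \<chi> i. x $ ?p i)"
  proof (rule lborel_vec_eqI)
    fix l u :: "real^'k" assume le: "\<And>i. l $ i \<le> u $ i"
    have "x \<in> (\<lambda>x. \<chi> i. x $ ?p i) -` box l u \<longleftrightarrow> x \<in> box (\<chi> i. l $ ?p i) (\<chi> i. u $ ?p i)" for x
      unfolding mem_box_cart vimage_def by simp (metis transpose_involutory)
    hence "(\<lambda>x. \<chi> i. x $ ?p i) -` box l u = box (\<chi> i. l $ ?p i) (\<chi> i. u $ ?p i)"
      by blast
    hence "emeasure (distr lborel borel (\<lambda>x. \<chi> i. x $ ?p i)) (box l u) = ennreal (\<Prod>i\<in>UNIV. u $ ?p i - l $ ?p i)"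
      by (subst emeasure_distr) (auto simp: emeasure_lborel_box_vec le)
    also have "(\<Prod>i\<in>UNIV. u $ ?p i - l $ ?p i) = (\<Prod>i\<in>UNIV. u $ i - l $ i)"
      by (rule prod.reindex_bij_betw[of ?p UNIV UNIV "\<lambda>i. u $ i - l $ i"]) auto
    finally show "emeasure (distr lborel borel (\<lambda>x. \<chi> i. x $ ?p i)) (box l u) = ennreal (\<Prod>i\<in>UNIV. u $ i - l $ i)" .
  qed simp
  show ?case
    unfolding det Av by (subst (1) *) (simp add: nn_integral_distr)
next
  case (5 m n)
  let ?A = "(\<chi> i j. of_bool (i = m \<and> j = n \<or> i = j)) :: real^'k^'k"
  have Av: "?A *v x = (\<chi> i. if i = m then x $ m + x $ n else x $ i)" for x
  proof -
    have "(\<Sum>j\<in>UNIV. of_bool (i = m \<and> j = n \<or> i = j) * x $ j) = (if i = m then x $ m + x $ n else x $ i)" for i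
    proof -
      have "(\<Sum>j\<in>UNIV. of_bool (i = m \<and> j = n \<or> i = j) * x $ j)
          = (\<Sum>j\<in>(if i = m then {m, n} else {i}). of_bool (i = m \<and> j = n \<or> i = j) * x $ j)"
        by (rule sum.mono_neutral_right) auto
      thus ?thesis using 5 by auto
    qed
    thus ?thesis by (simp add: vec_eq_iff matrix_vector_mult_def)
  qed
  have "?A = (\<chi> k. if k = m then row m (mat 1) + 1 *s row n (mat 1) else row k (mat 1))"
    using 5 by (auto simp: vec_eq_iff mat_def row_def)
  hence det: "det ?A = 1"
    using det_row_operation[OF 5, of "mat 1 :: real^'k^'k" 1] by simp
  interpret product_sigma_finite "\<lambda>_::'k. lborel :: real measure"
    by standard
  have [measurable]: "(\<lambda>x::real^'k. \<chi> i. if i = m then x $ m + x $ n else x $ i) \<in> borel_measurable borel"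
    unfolding Av[symmetric] by simp
  show ?case unfolding det Av
  proof (intro ballI impI)
    fix f :: "real^'k \<Rightarrow> ennreal" assume f [measurable]: "f \<in> borel_measurable borel"
    have UN: "(UNIV :: 'k set) = insert m (-{m})" by auto
    have m1: "(\<lambda>x. f (\<chi> i. x i)) \<in> borel_measurable (Pi\<^sub>M (insert m (-{m})) (\<lambda>i. lborel))"
      unfolding UN[symmetric] by measurable
    have m2: "(\<lambda>x. f (\<chi> i. if i = m then x m + x n else x i)) \<in> borel_measurable (Pi\<^sub>M (insert m (-{m})) (\<lambda>i. lborel))"
    proof -
      have "(\<lambda>x. f (\<chi> i. if i = m then x m + x n else x i)) = (\<lambda>y. f (\<chi> i. if i = m then y $ m + y $ n else y $ i)) \<circ> (\<lambda>x. \<chi> i. x i)"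
        by (simp add: fun_eq_iff cong: if_cong)
      also have "\<dots> \<in> borel_measurable (Pi\<^sub>M UNIV (\<lambda>i. lborel))" by measurable
      finally show ?thesis unfolding UN .
    qed
    have "(\<integral>\<^sup>+x. f (\<chi> i. if i = m then x $ m + x $ n else x $ i) \<partial>lborel)
        = (\<integral>\<^sup>+x. f (\<chi> i. if i = m then x m + x n else x i) \<partial>Pi\<^sub>M (insert m (-{m})) (\<lambda>i. lborel))"
      unfolding UN[symmetric] by (subst lborel_eq_distr_PiM, subst nn_integral_distr) (auto cong: if_cong)
    also have "\<dots> = (\<integral>\<^sup>+x. (\<integral>\<^sup>+y. f (\<chi> i. if i = m then y + x n else x i) \<partial>lborel) \<partial>Pi\<^sub>M (-{m}) (\<lambda>i. lborel))"
      using 5 by (subst product_nn_integral_insert[OF _ _ m2]) (auto cong: if_cong)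
    also have "\<dots> = (\<integral>\<^sup>+x. (\<integral>\<^sup>+y. f (\<chi> i. if i = m then y else x i) \<partial>lborel) \<partial>Pi\<^sub>M (-{m}) (\<lambda>i. lborel))"
    proof (rule nn_integral_cong)
      fix x :: "'k \<Rightarrow> real"
      have eq: "(\<lambda>y. \<chi> i. if i = m then y else x i) = (\<lambda>y. y *\<^sub>R axis m 1 + (\<chi> i. if i = m then 0 else x i))"
        by (auto simp: vec_eq_iff axis_def)
      have [measurable]: "(\<lambda>y. \<chi> i. if i = m then y else x i) \<in> borel_measurable borel"
        unfolding eq by (intro borel_measurable_continuous_onI continuous_intros)
      show "(\<integral>\<^sup>+y. f (\<chi> i. if i = m then y + x n else x i) \<partial>lborel) = (\<integral>\<^sup>+y. f (\<chi> i. if i = m then y else x i) \<partial>lborel)"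
        by (subst (2) nn_integral_real_affine[where c = 1 and t = "x n"]) (auto simp: add_ac cong: if_cong)
    qed
    also have "\<dots> = (\<integral>\<^sup>+x. f (\<chi> i. x i) \<partial>Pi\<^sub>M (insert m (-{m})) (\<lambda>i. lborel))"
      using 5 by (subst product_nn_integral_insert[OF _ _ m1]) (auto simp: fun_upd_def cong: if_cong)
    also have "\<dots> = (\<integral>\<^sup>+x. f x \<partial>lborel)"
      unfolding UN[symmetric] by (subst lborel_eq_distr_PiM, subst nn_integral_distr) auto
    finally show "(\<integral>\<^sup>+x. f x \<partial>lborel) = ennreal \<bar>1\<bar> * (\<integral>\<^sup>+x. f (\<chi> i. if i = m then x $ m + x $ n else x $ i) \<partial>lborel)"
      by simp
  qed
qed

lemma lborel_eq_density_linear: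
  fixes A :: "real^'k^'k::finite"
  assumes "det A \<noteq> 0"
  shows "lborel = density (distr lborel borel ((*v) A)) (\<lambda>_. ennreal \<bar>det A\<bar>)"
proof (rule measure_eqI)
  fix S :: "(real^'k) set" assume "S \<in> sets lborel"
  hence [measurable]: "S \<in> sets borel" by simp
  have "emeasure lborel S = (\<integral>\<^sup>+x. indicator S x \<partial>lborel)" by simp
  also have "\<dots> = ennreal \<bar>det A\<bar> * (\<integral>\<^sup>+x. indicator S (A *v x) \<partial>lborel)"
    by (rule nn_integral_lborel_linear[rule_format]) (use assms in auto)
  also have "\<dots> = emeasure (density (distr lborel borel ((*v) A)) (\<lambda>_. ennreal \<bar>det A\<bar>)) S"
    using nn_integral_distr[of "(*v) A" lborel borel "indicator S"]
    by (simp add: emeasure_density nn_integral_cmult)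
  finally show "emeasure lborel S = emeasure (density (distr lborel borel ((*v) A)) (\<lambda>_. ennreal \<bar>det A\<bar>)) S" .
qed simp

lemma integral_lborel_linear:
  fixes A :: "real^'k^'k::finite" and f :: "real^'k \<Rightarrow> complex"
  assumes "det A \<noteq> 0" and [measurable]: "f \<in> borel_measurable borel"
  shows "integrable lborel f \<longleftrightarrow> integrable lborel (\<lambda>x. f (A *v x))"
    and "(\<integral>x. f x \<partial>lborel) = \<bar>det A\<bar> * (\<integral>x. f (A *v x) \<partial>lborel)"
proof -
  show "integrable lborel f \<longleftrightarrow> integrable lborel (\<lambda>x. f (A *v x))"
  proof -
    have "integrable lborel (\<lambda>x. c *\<^sub>R g x) \<longleftrightarrow> integrable lborel g" if "c \<noteq> 0" for c and g :: "real^'k \<Rightarrow> complex"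
      using integrable_scaleR_right[of c lborel g] integrable_scaleR_right[of "1 / c" lborel "\<lambda>x. c *\<^sub>R g x"] that by auto
    thus ?thesis
      using assms(1) by (subst lborel_eq_density_linear[OF assms(1)])
        (simp add: integrable_density integrable_distr_eq)
  qed
  show "(\<integral>x. f x \<partial>lborel) = \<bar>det A\<bar> * (\<integral>x. f (A *v x) \<partial>lborel)"
    by (subst lborel_eq_density_linear[OF assms(1)]) (simp add: integral_density integral_distr scaleR_conv_of_real)
qed


lemma lborel_distr_plus_right: "distr lborel borel (\<lambda>x. x + a) = (lborel :: 'a::euclidean_space measure)"
proof -
  have "(\<lambda>x. x + a) = (+) a" by (rule ext) (rule add.commute)
  thus ?thesis using lborel_distr_plus[of a] by (simp only:)
qed

lemma integral_lborel_translate: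
  fixes f :: "'a::euclidean_space \<Rightarrow> 'b::{banach, second_countable_topology}"
  assumes [measurable]: "f \<in> borel_measurable borel"
  shows "integrable lborel (\<lambda>x. f (x + a)) \<longleftrightarrow> integrable lborel f"
    and "(\<integral>x. f (x + a) \<partial>lborel) = (\<integral>x. f x \<partial>lborel)"
proof -
  note eq = lborel_distr_plus_right[of a, symmetric]
  show "integrable lborel (\<lambda>x. f (x + a)) \<longleftrightarrow> integrable lborel f"
    by (subst (2) eq) (simp add: integrable_distr_eq)
  show "(\<integral>x. f (x + a) \<partial>lborel) = (\<integral>x. f x \<partial>lborel)"
    by (subst (2) eq) (simp add: integral_distr)
qed

lemma AE_lborel_translate:
  fixes a :: "'a::euclidean_space"
  assumes "AE x in lborel. P x"
  shows "AE x in lborel. P (x + a)"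
proof -
  from assms obtain S where S: "{x \<in> space lborel. \<not> P x} \<subseteq> S" "S \<in> sets lborel" "emeasure lborel S = 0"
    by (rule AE_E)
  have [measurable]: "S \<in> sets borel" using S by simp
  have "AE x in distr lborel borel (\<lambda>x. x + a). x \<notin> S"
    unfolding lborel_distr_plus_right by (rule AE_not_in) (use S in \<open>simp add: null_sets_def\<close>)
  hence "AE x in lborel. x + a \<notin> S"
    by (subst (asm) AE_distr_iff) auto
  thus ?thesis using S by (auto elim!: eventually_mono)
qed

section \<open>Phase space as a product\<close>

definition phase_point :: "real^'n \<Rightarrow> real^'n \<Rightarrow> real^('n + 'n::finite)" where
  "phase_point x w = (\<chi> i. case i of Inl a \<Rightarrow> x $ a | Inr b \<Rightarrow> w $ b)"

lemma pos_phase_point [simp]: "pos (phase_point x w) = x"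
  and freq_phase_point [simp]: "freq (phase_point x w) = w"
  by (auto simp: phase_point_def pos_def freq_def vec_eq_iff split: sum.splits)

lemma sum_phase: "(\<Sum>i\<in>UNIV. f i) = (\<Sum>i\<in>UNIV. f (Inl i)) + (\<Sum>i\<in>UNIV. f (Inr i))"
  for f :: "'n::finite + 'n \<Rightarrow> 'a::comm_monoid_add"
  by (subst UNIV_sum, subst sum.union_disjoint) (auto simp: sum.reindex)

lemma prod_phase: "(\<Prod>i\<in>UNIV. f i) = (\<Prod>i\<in>UNIV. f (Inl i)) * (\<Prod>i\<in>UNIV. f (Inr i))"
  for f :: "'n::finite + 'n \<Rightarrow> 'a::comm_monoid_mult"
  by (subst UNIV_sum, subst prod.union_disjoint) (auto simp: prod.reindex)

lemma inner_phase: "z \<bullet> w = pos z \<bullet> pos w + freq z \<bullet> freq w"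
  by (simp add: inner_vec_def sum_phase pos_def freq_def)

lemma norm_phase_le: "norm (pos z) \<le> norm z" "norm (freq z) \<le> norm z"
  by (auto simp: norm_eq_sqrt_inner inner_phase[of z z])

lemma bounded_linear_pos: "bounded_linear (pos :: real^('n + 'n) \<Rightarrow> real^'n::finite)"
  and bounded_linear_freq: "bounded_linear (freq :: real^('n + 'n) \<Rightarrow> real^'n::finite)"
  by (rule bounded_linear_intro[of _ 1]; auto simp: pos_def freq_def vec_eq_iff norm_phase_le[unfolded pos_def freq_def])+

lemma pos_measurable [measurable]: "pos \<in> borel_measurable borel"
  and freq_measurable [measurable]: "freq \<in> borel_measurable borel"
  using bounded_linear_pos bounded_linear_freq
  by (auto intro!: borel_measurable_continuous_onI linear_continuous_on)

lemma phase_point_measurable [measurable]: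
  "case_prod phase_point \<in> borel_measurable (lborel \<Otimes>\<^sub>M lborel)"
proof -
  have "continuous_on UNIV (case_prod phase_point :: ((real^'n) \<times> (real^'n)) \<Rightarrow> _)"
    unfolding phase_point_def case_prod_beta
  proof (rule continuous_on_vec_lambda)
    show "continuous_on UNIV (\<lambda>p :: (real^'n) \<times> (real^'n). case i of Inl a \<Rightarrow> fst p $ a | Inr b \<Rightarrow> snd p $ b)" for i
      by (cases i) (auto intro!: continuous_intros)
  qed
  hence "case_prod phase_point \<in> borel_measurable (borel :: ((real^'n) \<times> (real^'n)) measure)"
    by (rule borel_measurable_continuous_onI)
  thus ?thesis unfolding lborel_prod by simp
qed

lemma lborel_eq_distr_phase_point:
  "(lborel :: (real^('n + 'n::finite)) measure) = distr (lborel \<Otimes>\<^sub>M lborel) borel (case_prod phase_point)"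
proof (rule lborel_vec_eqI)
  fix l u :: "real^('n + 'n)" assume le: "\<And>i. l $ i \<le> u $ i"
  have "case_prod phase_point -` box l u = box (pos l) (pos u) \<times> box (freq l) (freq u)"
    by (auto simp: mem_box_cart phase_point_def pos_def freq_def split: sum.splits)
  hence "emeasure (distr (lborel \<Otimes>\<^sub>M lborel) borel (case_prod phase_point)) (box l u)
       = emeasure (lborel \<Otimes>\<^sub>M lborel) (box (pos l) (pos u) \<times> box (freq l) (freq u))"
    by (subst emeasure_distr) (auto simp: space_pair_measure)
  also have "\<dots> = ennreal (\<Prod>i\<in>UNIV. pos u $ i - pos l $ i) * ennreal (\<Prod>i\<in>UNIV. freq u $ i - freq l $ i)"
    by (subst lborel.emeasure_pair_measure_Times) (auto simp: emeasure_lborel_box_vec le pos_def freq_def)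
  also have "\<dots> = ennreal (\<Prod>i\<in>UNIV. u $ i - l $ i)"
    by (simp add: prod_phase ennreal_mult prod_nonneg le pos_def freq_def)
  finally show "emeasure (distr (lborel \<Otimes>\<^sub>M lborel) borel (case_prod phase_point)) (box l u) = ennreal (\<Prod>i\<in>UNIV. u $ i - l $ i)" .
qed simp

lemma integral_phase_space:
  fixes f :: "real^('n + 'n::finite) \<Rightarrow> complex"
  assumes f: "integrable lborel f"
  shows "(\<integral>z. f z \<partial>lborel) = (\<integral>x. (\<integral>w. f (phase_point x w) \<partial>lborel) \<partial>lborel)"
proof -
  have [measurable]: "f \<in> borel_measurable borel"
    using f by (auto dest: borel_measurable_integrable)
  have int: "integrable (lborel \<Otimes>\<^sub>M lborel) (\<lambda>(x, w). f (phase_point x w))"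
    using f by (subst (asm) lborel_eq_distr_phase_point, subst (asm) integrable_distr_eq)
       (auto simp: case_prod_beta')
  have "(\<integral>z. f z \<partial>lborel) = (\<integral>p. f (case_prod phase_point p) \<partial>(lborel \<Otimes>\<^sub>M lborel))"
    by (subst lborel_eq_distr_phase_point, subst integral_distr) auto
  also have "\<dots> = (\<integral>x. (\<integral>w. f (phase_point x w) \<partial>lborel) \<partial>lborel)"
    using lborel_pair.integral_fst[OF int] by (simp add: case_prod_beta')
  finally show ?thesis .
qed

section \<open>Polynomial decay\<close>

text \<open>Since \<open>1 + x\<^sub>i\<^sup>2 \<le> (1 + \<parallel>x\<parallel>)\<^sup>2\<close> for each of the \<open>k\<close> coordinates, the exponent \<open>2k\<close> allows comparison
with the integrable product \<open>\<Prod>\<^sub>i 1 / (1 + x\<^sub>i\<^sup>2)\<close>.\<close>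

lemma integrable_inverse_power_norm:
  assumes "M \<ge> 2 * CARD('k)"
  shows "integrable lborel (\<lambda>x::real^'k::finite. 1 / (1 + norm x) ^ M)"
proof -
  have "integrable lborel (\<lambda>x::real. complex_of_real (inverse (1 + x\<^sup>2)))"
    using integrable_inverse_1_plus_square by (intro integrable_of_real) (simp add: set_integrable_def)
  from integral_lborel_vec_prod(1)[of "\<lambda>_. \<lambda>x. complex_of_real (inverse (1 + x\<^sup>2))", OF this]
  have int: "integrable lborel (\<lambda>x::real^'k. \<Prod>i\<in>UNIV. complex_of_real (inverse (1 + (x $ i)\<^sup>2)))" .
  show ?thesis
  proof (rule Bochner_Integration.integrable_bound[OF int])
    show "AE x::real^'k in lborel. norm (1 / (1 + norm x) ^ M) \<le> norm (\<Prod>i\<in>UNIV. complex_of_real (inverse (1 + (x $ i)\<^sup>2)))"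
    proof (intro AE_I2)
      fix x :: "real^'k"
      have le: "1 + (x $ i)\<^sup>2 \<le> (1 + norm x)\<^sup>2" for i
        using power_mono[OF component_le_norm_cart[of x i], of 2] norm_ge_zero[of x]
        by (simp add: power2_sum del: norm_ge_zero)
      have "(\<Prod>i\<in>UNIV. 1 + (x $ i)\<^sup>2) \<le> (\<Prod>i\<in>(UNIV::'k set). (1 + norm x)\<^sup>2)"
        by (intro prod_mono conjI le) auto
      also have "\<dots> = (1 + norm x) ^ (2 * CARD('k))"
        by (simp add: power_mult)
      also have "\<dots> \<le> (1 + norm x) ^ M"
        by (intro power_increasing assms) auto
      finally have *: "(\<Prod>i\<in>UNIV. 1 + (x $ i)\<^sup>2) \<le> (1 + norm x) ^ M" .
      have pos: "0 < (\<Prod>i\<in>UNIV. 1 + (x $ i)\<^sup>2)"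
        by (intro prod_pos) (auto intro: add_pos_nonneg)
      have "norm (\<Prod>i\<in>UNIV. complex_of_real (inverse (1 + (x $ i)\<^sup>2))) = inverse (\<Prod>i\<in>UNIV. 1 + (x $ i)\<^sup>2)"
        unfolding prod_norm[symmetric] norm_of_real prod_inversef[symmetric] o_def by (intro prod.cong) auto
      also have "\<dots> \<ge> inverse ((1 + norm x) ^ M)"
        using * pos by (rule le_imp_inverse_le)
      finally show "norm (1 / (1 + norm x) ^ M) \<le> norm (\<Prod>i\<in>UNIV. complex_of_real (inverse (1 + (x $ i)\<^sup>2)))"
        by (simp add: inverse_eq_divide)
    qed
  qed measurable
qed

lemma one_plus_norm_power_pos: "0 < (1 + norm x) ^ M"
  by (intro zero_less_power add_pos_nonneg) auto

lemma integrable_divide_power_norm: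
  "integrable lborel (\<lambda>x::real^'k::finite. B / (1 + norm x) ^ (2 * CARD('k)))"
  using integrable_mult_right[OF integrable_inverse_power_norm[OF order_refl, where 'k='k], of B] by simp

section \<open>Schwartz functions\<close>

lemma has_derivative_partial_deriv:
  assumes "f differentiable at (x :: real^'k::finite)"
  shows "(f has_derivative (\<lambda>h. \<Sum>j\<in>UNIV. complex_of_real (h $ j) * partial_deriv j f x)) (at x)"
proof -
  let ?D = "frechet_derivative f (at x)"
  have D: "(f has_derivative ?D) (at x)"
    using assms by (simp add: frechet_derivative_works)
  hence lin: "linear ?D" by (rule has_derivative_linear)
  have "?D h = (\<Sum>j\<in>UNIV. complex_of_real (h $ j) * partial_deriv j f x)" for h
  proof -
    have "?D h = ?D (\<Sum>j\<in>UNIV. (h $ j) *\<^sub>R axis j 1)"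
      using basis_expansion[of h] by (simp add: scalar_mult_eq_scaleR)
    also have "\<dots> = (\<Sum>j\<in>UNIV. (h $ j) *\<^sub>R ?D (axis j 1))"
      using lin by (simp add: linear_sum linear_cmul)
    finally show ?thesis by (simp add: partial_deriv_def scaleR_conv_of_real)
  qed
  hence "?D = (\<lambda>h. \<Sum>j\<in>UNIV. complex_of_real (h $ j) * partial_deriv j f x)" by blast
  with D show ?thesis by simp
qed

lemma partial_deriv_eqI:
  assumes "(f has_derivative D) (at x)"
  shows "partial_deriv j f x = D (axis j 1)"
  using frechet_derivative_at[OF assms] by (simp add: partial_deriv_def)

lemma iter_deriv_simps [simp]:
  "iter_deriv [] f = f" "iter_deriv (j # js) f = partial_deriv j (iter_deriv js f)"
  "iter_deriv (js @ ks) f = iter_deriv js (iter_deriv ks f)"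
  by (simp_all add: iter_deriv_def)

lemma schwartz_differentiable:
  assumes "f \<in> schwartz"
  shows "f differentiable at x"
proof -
  have "\<forall>x. iter_deriv [] f differentiable at x"
    using assms unfolding schwartz_def by blast
  thus ?thesis by simp
qed

lemma schwartz_partial_deriv:
  assumes "f \<in> schwartz"
  shows "partial_deriv j f \<in> schwartz"
  unfolding schwartz_def
proof (intro CollectI allI)
  fix js
  have "(\<forall>x. iter_deriv (js @ [j]) f differentiable at x) \<and>
      (\<forall>m::nat. bounded (range (\<lambda>x. (1 + norm x) ^ m *\<^sub>R iter_deriv (js @ [j]) f x)))"
    using assms unfolding schwartz_def by blast
  thus "(\<forall>x. iter_deriv js (partial_deriv j f) differentiable at x) \<and>
      (\<forall>m::nat. bounded (range (\<lambda>x. (1 + norm x) ^ m *\<^sub>R iter_deriv js (partial_deriv j f) x)))"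
    by simp
qed

lemma schwartz_decay:
  assumes "f \<in> schwartz"
  shows "\<exists>B\<ge>0. \<forall>x. (1 + norm x) ^ m * cmod (f x) \<le> B"
proof -
  have "bounded (range (\<lambda>x. (1 + norm x) ^ m *\<^sub>R iter_deriv [] f x))"
    using assms unfolding schwartz_def by blast
  then obtain B where B: "\<forall>x. norm ((1 + norm x) ^ m *\<^sub>R f x) \<le> B"
    unfolding bounded_iff by auto
  hence "0 \<le> B" using norm_ge_zero order_trans by blast
  with B show ?thesis by auto
qed

lemma schwartz_decay_divide:
  assumes "f \<in> schwartz"
  shows "\<exists>B\<ge>0. \<forall>x. cmod (f x) \<le> B / (1 + norm x) ^ m"
proof -
  obtain B where "B \<ge> 0" and B: "\<And>x. (1 + norm x) ^ m * cmod (f x) \<le> B"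
    using schwartz_decay[OF assms] by blast
  have "cmod (f x) \<le> B / (1 + norm x) ^ m" for x
  proof -
    have "(1 + norm x) ^ m > 0" by (rule one_plus_norm_power_pos)
    thus ?thesis using B[of x] by (simp add: pos_le_divide_eq mult.commute)
  qed
  thus ?thesis using \<open>B \<ge> 0\<close> by blast
qed

text \<open>The Schwartz space is the largest class of rapidly decreasing differentiable functions that is
closed under partial derivatives. Membership is proved below by exhibiting such a class, which
avoids formulas for iterated derivatives.\<close>

lemma schwartz_coinduct_decay:
  assumes "P f"
    and diff: "\<And>f x. P f \<Longrightarrow> f differentiable at x"
    and deriv: "\<And>f j. P f \<Longrightarrow> P (partial_deriv j f)"
    and decay: "\<And>f m. P f \<Longrightarrow> \<exists>B. \<forall>x. (1 + norm x) ^ m * cmod (f x) \<le> B"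
  shows "f \<in> schwartz"
proof -
  have P: "P (iter_deriv js f)" for js
    by (induction js) (auto intro: assms)
  have "bounded (range (\<lambda>x. (1 + norm x) ^ m *\<^sub>R iter_deriv js f x))" for m js
    using decay[OF P[of js], of m] by (auto simp: bounded_iff)
  with diff[OF P] show ?thesis by (auto simp: schwartz_def)
qed

lemma schwartz_combination:
  assumes "f \<in> schwartz" "g \<in> schwartz"
  shows "(\<lambda>x. a * f x + b * g x) \<in> schwartz"
proof (rule schwartz_coinduct_decay[where P = "\<lambda>h. \<exists>f\<in>schwartz. \<exists>g\<in>schwartz. h = (\<lambda>x. a * f x + b * g x)"], goal_cases)
  case 1
  show ?case by (intro bexI[of _ f] bexI[of _ g] refl assms)
next
  case (2 h x)
  then obtain f g where fg: "f \<in> schwartz" "g \<in> schwartz" and h: "h = (\<lambda>x. a * f x + b * g x)" by blast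
  show ?case unfolding h
    by (rule differentiable_add; rule differentiable_mult[OF differentiable_const schwartz_differentiable]; fact)
next
  case (3 h j)
  then obtain f g where fg: "f \<in> schwartz" "g \<in> schwartz" and h: "h = (\<lambda>x. a * f x + b * g x)" by blast
  have "partial_deriv j h = (\<lambda>x. a * partial_deriv j f x + b * partial_deriv j g x)"
  proof
    fix x
    have "partial_deriv j h x = (\<lambda>h. a * frechet_derivative f (at x) h + b * frechet_derivative g (at x) h) (axis j 1)"
      unfolding h by (rule partial_deriv_eqI)
        (intro has_derivative_add has_derivative_mult_right; use fg in \<open>simp add: schwartz_differentiable flip: frechet_derivative_works\<close>)
    thus "partial_deriv j h x = a * partial_deriv j f x + b * partial_deriv j g x"
      by (simp add: partial_deriv_def)
  qed
  thus ?case
    by (intro bexI[of _ "partial_deriv j f"] bexI[of _ "partial_deriv j g"] schwartz_partial_deriv fg)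
next
  case (4 h m)
  then obtain f g where fg: "f \<in> schwartz" "g \<in> schwartz" and h: "h = (\<lambda>x. a * f x + b * g x)" by blast
  obtain B1 B2 where B: "\<And>x. (1 + norm x) ^ m * cmod (f x) \<le> B1" "\<And>x. (1 + norm x) ^ m * cmod (g x) \<le> B2"
    using fg schwartz_decay by meson
  have "(1 + norm x) ^ m * cmod (h x) \<le> cmod a * B1 + cmod b * B2" for x
  proof -
    have "(1 + norm x) ^ m * cmod (h x) \<le> (1 + norm x) ^ m * (cmod (a * f x) + cmod (b * g x))"
      unfolding h by (intro mult_left_mono norm_triangle_ineq) auto
    also have "\<dots> = cmod a * ((1 + norm x) ^ m * cmod (f x)) + cmod b * ((1 + norm x) ^ m * cmod (g x))"
      by (simp add: norm_mult algebra_simps)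
    also have "\<dots> \<le> cmod a * B1 + cmod b * B2"
      by (intro add_mono mult_left_mono B norm_ge_zero)
    finally show ?thesis .
  qed
  thus ?case by (intro exI allI)
qed

lemma schwartz_add: "f \<in> schwartz \<Longrightarrow> g \<in> schwartz \<Longrightarrow> (\<lambda>x. f x + g x) \<in> schwartz"
  using schwartz_combination[of f g 1 1] by simp

lemma schwartz_scale: "f \<in> schwartz \<Longrightarrow> (\<lambda>x. c * f x) \<in> schwartz"
  using schwartz_combination[of f f c 0] by simp

lemma schwartz_diff:
  assumes "f \<in> schwartz" "g \<in> schwartz"
  shows "(\<lambda>x. f x - g x) \<in> schwartz"
  using schwartz_add[OF assms(1) schwartz_scale[OF assms(2), of "-1"]] by simp

text \<open>Products with a coordinate do not form a class closed under partial derivatives, because the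
product rule adds an undifferentiated term; the sums \<open>x\<^sub>i f + g\<close> do.\<close>

lemma schwartz_coord_mult:
  assumes "f \<in> schwartz"
  shows "(\<lambda>x. complex_of_real (x $ i) * f x) \<in> schwartz"
proof (rule schwartz_coinduct_decay[where P = "\<lambda>h. \<exists>f\<in>schwartz. \<exists>g\<in>schwartz. h = (\<lambda>x. complex_of_real (x $ i) * f x + g x)"], goal_cases)
  case 1
  show ?case
    by (intro bexI[of _ f] bexI[of _ "\<lambda>x. 0 * f x"] schwartz_scale assms) simp
next
  case (2 h x)
  then obtain f g where fg: "f \<in> schwartz" "g \<in> schwartz" and h: "h = (\<lambda>x. complex_of_real (x $ i) * f x + g x)" by blast
  have "(\<lambda>x. complex_of_real (x $ i)) differentiable at x"
    by (intro bounded_linear_imp_differentiable bounded_linear_compose[OF bounded_linear_of_real] bounded_linear_vec_nth)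
  thus ?case unfolding h
    by (rule differentiable_add[OF differentiable_mult]) (rule schwartz_differentiable fg)+
next
  case (3 h j)
  then obtain f g where fg: "f \<in> schwartz" "g \<in> schwartz" and h: "h = (\<lambda>x. complex_of_real (x $ i) * f x + g x)" by blast
  have "partial_deriv j h = (\<lambda>x. complex_of_real (x $ i) * partial_deriv j f x + (of_bool (i = j) * f x + partial_deriv j g x))"
  proof
    fix x
    have D: "((\<lambda>x. complex_of_real (x $ i)) has_derivative (\<lambda>x. complex_of_real (x $ i))) (at x)"
      by (intro bounded_linear_imp_has_derivative bounded_linear_compose[OF bounded_linear_of_real] bounded_linear_vec_nth)
    have "partial_deriv j h x = (\<lambda>k. (complex_of_real (x $ i) * frechet_derivative f (at x) k + complex_of_real (k $ i) * f x) + frechet_derivative g (at x) k) (axis j 1)"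
      unfolding h by (rule partial_deriv_eqI)
        (intro has_derivative_add has_derivative_mult D; use fg in \<open>simp add: schwartz_differentiable flip: frechet_derivative_works\<close>)
    thus "partial_deriv j h x = complex_of_real (x $ i) * partial_deriv j f x + (of_bool (i = j) * f x + partial_deriv j g x)"
      by (simp add: partial_deriv_def axis_def)
  qed
  moreover have "(\<lambda>x. of_bool (i = j) * f x + partial_deriv j g x) \<in> schwartz"
    using fg by (intro schwartz_add schwartz_scale schwartz_partial_deriv)
  ultimately show ?case
    by (intro bexI[of _ "partial_deriv j f"] bexI[of _ "\<lambda>x. of_bool (i = j) * f x + partial_deriv j g x"]
        schwartz_partial_deriv fg)
next
  case (4 h m)
  then obtain f g where fg: "f \<in> schwartz" "g \<in> schwartz" and h: "h = (\<lambda>x. complex_of_real (x $ i) * f x + g x)" by blast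
  obtain B1 B2 where B: "\<And>x. (1 + norm x) ^ Suc m * cmod (f x) \<le> B1" "\<And>x. (1 + norm x) ^ m * cmod (g x) \<le> B2"
    using fg schwartz_decay by meson
  have "(1 + norm x) ^ m * cmod (h x) \<le> B1 + B2" for x
  proof -
    have "cmod (h x) \<le> cmod (complex_of_real (x $ i) * f x) + cmod (g x)"
      unfolding h by (rule norm_triangle_ineq)
    also have "cmod (complex_of_real (x $ i) * f x) \<le> (1 + norm x) * cmod (f x)"
      unfolding norm_mult norm_of_real using component_le_norm_cart[of x i] by (intro mult_right_mono) auto
    finally have "(1 + norm x) ^ m * cmod (h x) \<le> (1 + norm x) ^ m * ((1 + norm x) * cmod (f x) + cmod (g x))"
      by (intro mult_left_mono) auto
    thus ?thesis using B[of x] by (simp add: algebra_simps)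
  qed
  thus ?case by (intro exI allI)
qed

text \<open>In a class that is closed under multiplication by coordinates, boundedness already gives rapid
decay, because \<open>\<parallel>x\<parallel> \<le> \<Sum>\<^sub>j |x\<^sub>j|\<close>.\<close>

lemma schwartz_coinduct:
  fixes P :: "(real^'k::finite \<Rightarrow> complex) \<Rightarrow> bool"
  assumes "P f"
    and diff: "\<And>f x. P f \<Longrightarrow> f differentiable at x"
    and deriv: "\<And>f j. P f \<Longrightarrow> P (partial_deriv j f)"
    and mult: "\<And>f j. P f \<Longrightarrow> P (\<lambda>x. complex_of_real (x $ j) * f x)"
    and bounded: "\<And>f. P f \<Longrightarrow> \<exists>B. \<forall>x. cmod (f x) \<le> B"
  shows "f \<in> schwartz"
proof (rule schwartz_coinduct_decay[of P])
  show "\<exists>B. \<forall>x. (1 + norm x) ^ m * cmod (f x) \<le> B" if "P f" for f m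
    using that
  proof (induction m arbitrary: f)
    case 0
    thus ?case using bounded by simp
  next
    case (Suc m)
    have "\<forall>j. \<exists>B. \<forall>x. (1 + norm x) ^ m * cmod (complex_of_real (x $ j) * f x) \<le> B"
      using Suc.IH[OF mult[OF Suc.prems]] by blast
    then obtain B where B: "\<And>j x. (1 + norm x) ^ m * cmod (complex_of_real (x $ j) * f x) \<le> B j"
      by metis
    obtain B0 where B0: "\<And>x. (1 + norm x) ^ m * cmod (f x) \<le> B0"
      using Suc.IH[OF Suc.prems] by blast
    have "(1 + norm x) ^ Suc m * cmod (f x) \<le> B0 + (\<Sum>j\<in>UNIV. B j)" for x
    proof -
      have "(1 + norm x) ^ Suc m * cmod (f x) = (1 + norm x) ^ m * cmod (f x) + norm x * ((1 + norm x) ^ m * cmod (f x))"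
        by (simp add: algebra_simps)
      also have "norm x * ((1 + norm x) ^ m * cmod (f x)) \<le> (\<Sum>j\<in>UNIV. \<bar>x $ j\<bar>) * ((1 + norm x) ^ m * cmod (f x))"
        by (intro mult_right_mono norm_le_l1_cart) auto
      also have "\<dots> = (\<Sum>j\<in>UNIV. (1 + norm x) ^ m * cmod (complex_of_real (x $ j) * f x))"
        unfolding sum_distrib_right by (intro sum.cong) (auto simp: norm_mult mult_ac)
      also have "\<dots> \<le> (\<Sum>j\<in>UNIV. B j)" by (intro sum_mono B)
      finally show ?thesis using B0[of x] by simp
    qed
    thus ?case by blast
  qed
qed (use assms in auto)

lemma has_derivative_cis_compose:
  fixes g :: "'a::real_normed_vector \<Rightarrow> real"
  assumes "(g has_derivative g') (at x)"
  shows "((\<lambda>x. cis (2 * pi * g x)) has_derivative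
     (\<lambda>h. (2 * pi * \<i> * complex_of_real (g' h)) * cis (2 * pi * g x))) (at x)"
proof -
  let ?g = "\<lambda>x. (2 * pi * \<i>) * complex_of_real (g x)"
  have "(?g has_derivative (\<lambda>h. (2 * pi * \<i>) * complex_of_real (g' h))) (at x)"
    by (intro has_derivative_mult_right has_derivative_of_real assms)
  moreover have "(exp has_derivative (*) (exp (?g x))) (at (?g x))"
    using DERIV_exp[of "?g x"] by (simp only: has_field_derivative_def)
  ultimately have "((\<lambda>x. exp (?g x)) has_derivative (\<lambda>h. exp (?g x) * ((2 * pi * \<i>) * complex_of_real (g' h)))) (at x)"
    by (rule has_derivative_compose)
  moreover have "cis (2 * pi * g x) = exp (?g x)" for x
    by (simp add: cis_conv_exp mult_ac)
  ultimately show ?thesis by (simp add: mult.commute)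
qed

lemma has_derivative_cis_inner:
  "((\<lambda>t. cis (2 * pi * (w \<bullet> t))) has_derivative
     (\<lambda>h. (2 * pi * \<i> * complex_of_real (w \<bullet> h)) * cis (2 * pi * (w \<bullet> t)))) (at t)"
  by (intro has_derivative_cis_compose has_derivative_inner_right has_derivative_ident)

text \<open>The transpose of the time-frequency shift by \<open>(a, w)\<close>: the shift of a distribution is evaluated
by applying the distribution to this function.\<close>

definition shift_test :: "real^'n \<Rightarrow> real^'n \<Rightarrow> (real^'n \<Rightarrow> complex) \<Rightarrow> real^'n::finite \<Rightarrow> complex" where
  "shift_test w a f = (\<lambda>t. cis (2 * pi * (w \<bullet> (t + a))) * f (t + a))"

lemma has_derivative_shift_test:
  assumes "f \<in> schwartz"
  shows "(shift_test w a f has_derivative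
     (\<lambda>h. cis (2 * pi * (w \<bullet> (t + a))) * frechet_derivative f (at (t + a)) h
        + (2 * pi * \<i> * complex_of_real (w \<bullet> h)) * cis (2 * pi * (w \<bullet> (t + a))) * f (t + a))) (at t)"
proof -
  have f: "(f has_derivative frechet_derivative f (at (t + a))) (at (t + a))"
    using schwartz_differentiable[OF assms] by (simp add: frechet_derivative_works)
  have shift: "((\<lambda>t. t + a) has_derivative (\<lambda>h. h)) (at t)"
    by (auto intro!: derivative_eq_intros)
  show ?thesis
    using has_derivative_compose[OF shift has_derivative_mult[OF has_derivative_cis_inner f]]
    by (simp add: shift_test_def)
qed

lemma schwartz_shift_test:
  assumes "f \<in> schwartz"
  shows "shift_test w a f \<in> schwartz"
proof (rule schwartz_coinduct[where P = "\<lambda>h. \<exists>f\<in>schwartz. h = shift_test w a f"], goal_cases)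
  case 1
  thus ?case using assms by blast
next
  case (2 h t)
  then obtain f where f: "f \<in> schwartz" and h: "h = shift_test w a f" by blast
  show ?case unfolding h by (rule differentiableI[OF has_derivative_shift_test[OF f]])
next
  case (3 h j)
  then obtain f where f: "f \<in> schwartz" and h: "h = shift_test w a f" by blast
  have "partial_deriv j h = shift_test w a (\<lambda>x. 2 * pi * \<i> * complex_of_real (w $ j) * f x + partial_deriv j f x)"
    unfolding h by (rule ext, subst partial_deriv_eqI[OF has_derivative_shift_test[OF f]])
      (simp add: shift_test_def partial_deriv_def inner_axis algebra_simps)
  moreover have "(\<lambda>x. 2 * pi * \<i> * complex_of_real (w $ j) * f x + partial_deriv j f x) \<in> schwartz"
    by (intro schwartz_add schwartz_scale schwartz_partial_deriv f)
  ultimately show ?case by (rule bexI)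
next
  case (4 h j)
  then obtain f where f: "f \<in> schwartz" and h: "h = shift_test w a f" by blast
  have "(\<lambda>x. complex_of_real (x $ j) * h x) = shift_test w a (\<lambda>x. complex_of_real (x $ j) * f x - complex_of_real (a $ j) * f x)"
    by (auto simp: h shift_test_def algebra_simps)
  moreover have "(\<lambda>x. complex_of_real (x $ j) * f x - complex_of_real (a $ j) * f x) \<in> schwartz"
    by (intro schwartz_diff schwartz_coord_mult schwartz_scale f)
  ultimately show ?case by (rule bexI)
next
  case (5 h)
  then obtain f where f: "f \<in> schwartz" and h: "h = shift_test w a f" by blast
  obtain B where "\<And>x. cmod (f x) \<le> B"
    using schwartz_decay[OF f, of 0] by auto
  hence "\<forall>x. cmod (h x) \<le> B"
    by (simp add: h shift_test_def norm_mult)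
  thus ?case ..
qed

lemma schwartz_measurable:
  assumes "f \<in> schwartz"
  shows "f \<in> borel_measurable borel"
  by (intro borel_measurable_continuous_onI continuous_at_imp_continuous_on ballI
      differentiable_imp_continuous_within schwartz_differentiable assms)

section \<open>Differentiation under the integral sign\<close>

text \<open>The dominating function controls the difference quotients through the mean value inequality, so
dominated convergence applies to them along every sequence of parameters.\<close>

lemma has_derivative_integral:
  fixes f :: "'a::euclidean_space \<Rightarrow> 'b \<Rightarrow> complex"
  assumes int: "\<And>z. integrable M (f z)"
    and deriv: "\<And>z t. dist z0 z < 1 \<Longrightarrow> ((\<lambda>z. f z t) has_derivative D z t) (at z)"
    and meas: "\<And>h. (\<lambda>t. D z0 t h) \<in> borel_measurable M"
    and bound: "\<And>z t h. dist z0 z < 1 \<Longrightarrow> cmod (D z t h) \<le> K t * norm h"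
    and K: "integrable M K"
  shows "((\<lambda>z. \<integral>t. f z t \<partial>M) has_derivative (\<lambda>h. \<integral>t. D z0 t h \<partial>M)) (at z0)"
proof -
  have D0: "bounded_linear (D z0 t)" for t
    by (rule has_derivative_bounded_linear[OF deriv]) simp
  have intD: "integrable M (\<lambda>t. D z0 t h)" for h
  proof (rule Bochner_Integration.integrable_bound[OF integrable_mult_left[OF K, of "norm h"] meas], rule AE_I2)
    fix t
    have "cmod (D z0 t h) \<le> K t * norm h" by (rule bound) simp
    also have "\<dots> \<le> norm (K t * norm h)" by simp
    finally show "cmod (D z0 t h) \<le> norm (K t * norm h)" .
  qed
  have lin: "linear (\<lambda>h. \<integral>t. D z0 t h \<partial>M)"
  proof (rule linearI)
    fix a b
    have "(\<integral>t. D z0 t (a + b) \<partial>M) = (\<integral>t. D z0 t a + D z0 t b \<partial>M)"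
      by (intro Bochner_Integration.integral_cong refl linear_add bounded_linear.linear D0)
    thus "(\<integral>t. D z0 t (a + b) \<partial>M) = (\<integral>t. D z0 t a \<partial>M) + (\<integral>t. D z0 t b \<partial>M)"
      using intD by simp
  next
    fix c a
    have "(\<integral>t. D z0 t (c *\<^sub>R a) \<partial>M) = (\<integral>t. c *\<^sub>R D z0 t a \<partial>M)"
      by (intro Bochner_Integration.integral_cong refl linear_cmul bounded_linear.linear D0)
    thus "(\<integral>t. D z0 t (c *\<^sub>R a) \<partial>M) = c *\<^sub>R (\<integral>t. D z0 t a \<partial>M)"
      by simp
  qed
  have lip: "cmod (f z t - f z0 t) \<le> K t * norm (z - z0)" if "dist z0 z < 1" for z t
  proof (rule differentiable_bound[of "ball z0 1" "\<lambda>z. f z t" "\<lambda>z. D z t"])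
    show "((\<lambda>z. f z t) has_derivative D z t) (at z within ball z0 1)" if "z \<in> ball z0 1" for z
      by (rule has_derivative_at_withinI[OF deriv]) (use that in simp)
    show "onorm (D z t) \<le> K t" if "z \<in> ball z0 1" for z
      by (rule onorm_le[OF bound]) (use that in simp)
  qed (use that in auto)
  define q where "q = (\<lambda>z t. (f z t - f z0 t - D z0 t (z - z0)) /\<^sub>R norm (z - z0))"
  have intq: "integrable M (q z)" for z
    unfolding q_def by (intro integrable_scaleR_right Bochner_Integration.integrable_diff int intD)
  have lim: "((\<lambda>z. \<integral>t. q z t \<partial>M) \<longlongrightarrow> 0) (at z0)"
    unfolding tendsto_at_iff_sequentially
  proof (intro allI impI)
    fix X assume X: "\<forall>i. X i \<in> UNIV - {z0}" "X \<longlonglongrightarrow> z0"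
    obtain N where N: "\<And>n. n \<ge> N \<Longrightarrow> dist (X n) z0 < 1"
      using X(2)[unfolded lim_sequentially, rule_format, of 1] by auto
    have "(\<lambda>n. \<integral>t. q (X (n + N)) t \<partial>M) \<longlonglongrightarrow> (\<integral>t. 0 \<partial>M)"
    proof (rule integral_dominated_convergence[where w = "\<lambda>t. 2 * K t"])
      show "AE t in M. (\<lambda>n. q (X (n + N)) t) \<longlonglongrightarrow> 0"
      proof (intro AE_I2)
        fix t
        have "((\<lambda>z. q z t) \<longlongrightarrow> 0) (at z0)"
          using deriv[of z0 t] unfolding has_derivative_at_within q_def by simp
        hence "((\<lambda>z. q z t) \<circ> X) \<longlonglongrightarrow> 0"
          using X unfolding tendsto_at_iff_sequentially by simp
        thus "(\<lambda>n. q (X (n + N)) t) \<longlonglongrightarrow> 0"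
          unfolding o_def by (rule LIMSEQ_ignore_initial_segment)
      qed
      show "AE t in M. cmod (q (X (n + N)) t) \<le> 2 * K t" for n
      proof (intro AE_I2)
        fix t
        define z where "z = X (n + N)"
        have z: "dist z0 z < 1" "z \<noteq> z0" using N[of "n + N"] X by (auto simp: z_def dist_commute)
        have "cmod (f z t - f z0 t - D z0 t (z - z0)) \<le> K t * norm (z - z0) + K t * norm (z - z0)"
          using norm_triangle_ineq4[of "f z t - f z0 t" "D z0 t (z - z0)"] lip[OF z(1), of t] bound[of z0 t "z - z0"]
          by simp
        thus "cmod (q (X (n + N)) t) \<le> 2 * K t"
          using z unfolding q_def z_def[symmetric] norm_scaleR
          by (simp add: inverse_eq_divide pos_divide_le_eq mult_ac)
      qed
    qed (simp_all add: intq K borel_measurable_integrable[OF intq])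
    hence "(\<lambda>n. \<integral>t. q (X (n + N)) t \<partial>M) \<longlonglongrightarrow> 0" by simp
    from LIMSEQ_offset[OF this]
    show "((\<lambda>z. \<integral>t. q z t \<partial>M) \<circ> X) \<longlonglongrightarrow> 0" unfolding o_def .
  qed
  have "(\<integral>t. q z t \<partial>M) = ((\<integral>t. f z t \<partial>M) - (\<integral>t. f z0 t \<partial>M) - (\<integral>t. D z0 t (z - z0) \<partial>M)) /\<^sub>R norm (z - z0)" for z
    unfolding q_def using int intD by simp
  with lim lin show ?thesis
    unfolding has_derivative_at_within by (simp add: linear_conv_bounded_linear)
qed

section \<open>Wigner transforms of Schwartz functions\<close>

definition wigner_integrand :: "real \<Rightarrow> (real^'n \<Rightarrow> complex) \<Rightarrow> (real^'n \<Rightarrow> complex)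
    \<Rightarrow> real^('n + 'n) \<Rightarrow> real^'n::finite \<Rightarrow> complex" where
  "wigner_integrand \<tau> u \<phi> z t =
     cis (2 * pi * (t \<bullet> freq z)) * \<phi> (pos z + \<tau> *\<^sub>R t) * u (pos z - (1 - \<tau>) *\<^sub>R t)"

lemma wigner_integrand_measurable [measurable]:
  assumes "u \<in> schwartz" "\<phi> \<in> schwartz"
  shows "wigner_integrand \<tau> u \<phi> z \<in> borel_measurable borel"
proof -
  have [measurable]: "u \<in> borel_measurable borel" "\<phi> \<in> borel_measurable borel"
    using assms by (auto intro: schwartz_measurable)
  have [measurable]: "cis \<in> borel_measurable borel"
    by (intro borel_measurable_continuous_onI continuous_intros)
  show ?thesis unfolding wigner_integrand_def by measurable
qed

lemma wigner_eq_lborel: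
  assumes "u \<in> schwartz" "\<phi> \<in> schwartz"
  shows "wigner \<tau> u \<phi> z = (\<integral>t. wigner_integrand \<tau> u \<phi> z t \<partial>lborel)"
  unfolding wigner_def wigner_integrand_def[symmetric]
  by (rule integral_completion) (use wigner_integrand_measurable[OF assms] in simp)

text \<open>The arguments \<open>x\<close> of \<open>\<phi>\<close> and \<open>y\<close> of \<open>u\<close> satisfy \<open>t = x - y\<close>, hence \<open>1 + \<parallel>t\<parallel> \<le> (1 + \<parallel>x\<parallel>)(1 + \<parallel>y\<parallel>)\<close>: the
decay of \<open>u\<close> and \<open>\<phi>\<close> becomes decay in \<open>t\<close> that is uniform in the phase-space point.\<close>

lemma wigner_integrand_bound:
  assumes "u \<in> schwartz" "\<phi> \<in> schwartz"
  shows "\<exists>B\<ge>0. \<forall>z t. cmod (wigner_integrand \<tau> u \<phi> z t) \<le> B / (1 + norm t) ^ m"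
proof -
  obtain B1 where B1: "B1 \<ge> 0" "\<And>x. (1 + norm x) ^ m * cmod (\<phi> x) \<le> B1"
    using schwartz_decay[OF assms(2)] by blast
  obtain B2 where B2: "B2 \<ge> 0" "\<And>x. (1 + norm x) ^ m * cmod (u x) \<le> B2"
    using schwartz_decay[OF assms(1)] by blast
  have "cmod (wigner_integrand \<tau> u \<phi> z t) \<le> B1 * B2 / (1 + norm t) ^ m" for z t
  proof -
    define x y where "x = pos z + \<tau> *\<^sub>R t" and "y = pos z - (1 - \<tau>) *\<^sub>R t"
    have "t = x - y" by (simp add: x_def y_def algebra_simps)
    hence "norm t \<le> norm x + norm y" by (simp add: norm_triangle_ineq4)
    also have "\<dots> \<le> norm x + norm y + norm x * norm y" by simp
    finally have "1 + norm t \<le> (1 + norm x) * (1 + norm y)" by (simp add: algebra_simps)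
    hence "(1 + norm t) ^ m \<le> (1 + norm x) ^ m * (1 + norm y) ^ m"
      unfolding power_mult_distrib[symmetric] by (intro power_mono) auto
    hence "(1 + norm t) ^ m * cmod (wigner_integrand \<tau> u \<phi> z t)
        \<le> ((1 + norm x) ^ m * (1 + norm y) ^ m) * (cmod (\<phi> x) * cmod (u y))"
      unfolding wigner_integrand_def x_def[symmetric] y_def[symmetric] norm_mult norm_cis
      by (intro mult_mono) auto
    also have "\<dots> = ((1 + norm x) ^ m * cmod (\<phi> x)) * ((1 + norm y) ^ m * cmod (u y))"
      by (simp add: mult_ac)
    also have "\<dots> \<le> B1 * B2"
      by (intro mult_mono B1 B2) auto
    finally show ?thesis
      by (subst pos_le_divide_eq) (simp_all add: mult.commute one_plus_norm_power_pos)
  qed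
  thus ?thesis using B1(1) B2(1) by (intro exI[of _ "B1 * B2"]) auto
qed

lemma wigner_integrand_integrable:
  assumes "u \<in> schwartz" "\<phi> \<in> schwartz"
  shows "integrable lborel (wigner_integrand \<tau> u \<phi> (z :: real^('n + 'n::finite)))"
proof -
  obtain B where B: "B \<ge> 0" "\<And>z t. cmod (wigner_integrand \<tau> u \<phi> z t) \<le> B / (1 + norm t) ^ (2 * CARD('n))"
    using wigner_integrand_bound[OF assms] by blast
  have "integrable lborel (\<lambda>t::real^'n. B * (1 / (1 + norm t) ^ (2 * CARD('n))))"
    by (intro integrable_mult_right integrable_inverse_power_norm) simp
  thus ?thesis
    by (rule Bochner_Integration.integrable_bound)
       (use assms B in \<open>auto intro!: AE_I2 wigner_integrand_measurable intro: order_trans[OF B(2)]\<close>)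
qed

lemma has_derivative_schwartz_compose:
  fixes g :: "'a::real_normed_vector \<Rightarrow> real^'k::finite"
  assumes "f \<in> schwartz" "(g has_derivative g') (at s)"
  shows "((\<lambda>s. f (g s)) has_derivative
     (\<lambda>h. \<Sum>j\<in>UNIV. complex_of_real (g' h $ j) * partial_deriv j f (g s))) (at s)"
  using has_derivative_compose[OF assms(2) has_derivative_partial_deriv[OF schwartz_differentiable[OF assms(1)]]] .

text \<open>Point and integration variable may both move: with a fixed integration variable this yields the
derivatives of the Wigner transform, with a fixed point it yields the integration by parts.\<close>

lemma has_derivative_wigner_integrand:
  fixes z :: "'a::real_normed_vector \<Rightarrow> real^('n + 'n::finite)"
  assumes u: "u \<in> schwartz" and \<phi>: "\<phi> \<in> schwartz"
    and z: "(z has_derivative z') (at s)" and t: "(t has_derivative t') (at s)"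
  shows "((\<lambda>s. wigner_integrand \<tau> u \<phi> (z s) (t s)) has_derivative
     (\<lambda>h. 2 * pi * \<i> * complex_of_real (t s \<bullet> freq (z' h) + t' h \<bullet> freq (z s)) * wigner_integrand \<tau> u \<phi> (z s) (t s)
       + (\<Sum>j\<in>UNIV. complex_of_real ((pos (z' h) + \<tau> *\<^sub>R t' h) $ j) * wigner_integrand \<tau> u (partial_deriv j \<phi>) (z s) (t s))
       + (\<Sum>j\<in>UNIV. complex_of_real ((pos (z' h) - (1 - \<tau>) *\<^sub>R t' h) $ j) * wigner_integrand \<tau> (partial_deriv j u) \<phi> (z s) (t s))))
     (at s)"
proof -
  have pz: "((\<lambda>s. pos (z s)) has_derivative (\<lambda>h. pos (z' h))) (at s)"
    by (rule bounded_linear.has_derivative[OF bounded_linear_pos z])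
  have fz: "((\<lambda>s. freq (z s)) has_derivative (\<lambda>h. freq (z' h))) (at s)"
    by (rule bounded_linear.has_derivative[OF bounded_linear_freq z])
  have c: "((\<lambda>s. cis (2 * pi * (t s \<bullet> freq (z s)))) has_derivative
     (\<lambda>h. (2 * pi * \<i> * complex_of_real (t s \<bullet> freq (z' h) + t' h \<bullet> freq (z s))) * cis (2 * pi * (t s \<bullet> freq (z s))))) (at s)"
    by (intro has_derivative_cis_compose has_derivative_inner t fz)
  have x: "((\<lambda>s. pos (z s) + \<tau> *\<^sub>R t s) has_derivative (\<lambda>h. pos (z' h) + \<tau> *\<^sub>R t' h)) (at s)"
    by (intro has_derivative_add pz has_derivative_scaleR_right t)
  have y: "((\<lambda>s. pos (z s) - (1 - \<tau>) *\<^sub>R t s) has_derivative (\<lambda>h. pos (z' h) - (1 - \<tau>) *\<^sub>R t' h)) (at s)"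
    by (intro has_derivative_diff pz has_derivative_scaleR_right t)
  have product_rule: "(c * P) * (\<Sum>j\<in>UNIV. b j * U' j) + (c * (\<Sum>j\<in>UNIV. a j * P' j) + (k * c) * P) * U
      = k * (c * P * U) + (\<Sum>j\<in>UNIV. a j * (c * P' j * U)) + (\<Sum>j\<in>UNIV. b j * (c * P * U' j))"
    for c P U k :: complex and a b P' U' :: "'n \<Rightarrow> complex"
    by (simp add: sum_distrib_left sum_distrib_right algebra_simps)
  show ?thesis
    unfolding wigner_integrand_def
    by (rule has_derivative_eq_rhs,
        rule has_derivative_mult[OF has_derivative_mult[OF c has_derivative_schwartz_compose[OF \<phi> x]]
          has_derivative_schwartz_compose[OF u y]])
       (rule ext, rule product_rule)
qed

text \<open>With \<open>x\<close> and \<open>y\<close> the arguments of \<open>\<phi>\<close> and \<open>u\<close>, these are \<open>x - y = t\<close> and \<open>(1 - \<tau>) x + \<tau> y = r\<close>, where \<open>r\<close>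
is the position of \<open>z\<close>. Factors \<open>t\<^sub>j\<close> and \<open>r\<^sub>j\<close> can thus be absorbed into the two functions.\<close>

lemma wigner_integrand_linear:
  "wigner_integrand \<tau> u (\<lambda>x. complex_of_real (x $ j) * \<phi> x) z t - wigner_integrand \<tau> (\<lambda>x. complex_of_real (x $ j) * u x) \<phi> z t
     = complex_of_real (t $ j) * wigner_integrand \<tau> u \<phi> z t"
  "complex_of_real (1 - \<tau>) * wigner_integrand \<tau> u (\<lambda>x. complex_of_real (x $ j) * \<phi> x) z t
     + complex_of_real \<tau> * wigner_integrand \<tau> (\<lambda>x. complex_of_real (x $ j) * u x) \<phi> z t
     = complex_of_real (pos z $ j) * wigner_integrand \<tau> u \<phi> z t"
  unfolding wigner_integrand_def by (simp_all add: algebra_simps)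

lemma wigner_integrand_combination_bound:
  assumes "u \<in> schwartz" "\<phi> \<in> schwartz" "u' \<in> schwartz" "\<phi>' \<in> schwartz"
  shows "\<exists>B\<ge>0. \<forall>z t. cmod (a * wigner_integrand \<tau> u \<phi> z t + b * wigner_integrand \<tau> u' \<phi>' z t) \<le> B / (1 + norm t) ^ m"
proof -
  obtain B where B: "B \<ge> 0" "\<And>z t. cmod (wigner_integrand \<tau> u \<phi> z t) \<le> B / (1 + norm t) ^ m"
    using wigner_integrand_bound[OF assms(1,2)] by blast
  obtain B' where B': "B' \<ge> 0" "\<And>z t. cmod (wigner_integrand \<tau> u' \<phi>' z t) \<le> B' / (1 + norm t) ^ m"
    using wigner_integrand_bound[OF assms(3,4)] by blast
  have "cmod (a * wigner_integrand \<tau> u \<phi> z t + b * wigner_integrand \<tau> u' \<phi>' z t)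
      \<le> (cmod a * B + cmod b * B') / (1 + norm t) ^ m" for z t
  proof -
    have "cmod (a * wigner_integrand \<tau> u \<phi> z t + b * wigner_integrand \<tau> u' \<phi>' z t)
      \<le> cmod a * (B / (1 + norm t) ^ m) + cmod b * (B' / (1 + norm t) ^ m)"
      by (rule norm_triangle_le) (simp only: norm_mult, intro add_mono mult_left_mono B B' norm_ge_zero)
    thus ?thesis by (simp add: add_divide_distrib)
  qed
  thus ?thesis using B(1) B'(1) by (intro exI[of _ "cmod a * B + cmod b * B'"]) auto
qed

text \<open>A frequency derivative produces the factor \<open>2\<pi>i t\<^sub>j\<close>, which is absorbed into the two functions; a
position derivative falls on one of them. Every partial derivative is therefore a combination of
Wigner transforms. The coefficients \<open>1\<close> are kept so that all terms have the shape required by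
\<open>wigner_integrand_combination_bound\<close>.\<close>

lemma has_derivative_wigner:
  fixes z :: "real^('n + 'n::finite)"
  assumes u: "u \<in> schwartz" and \<phi>: "\<phi> \<in> schwartz"
  shows "(wigner \<tau> u \<phi> has_derivative
     (\<lambda>h. (\<Sum>j\<in>UNIV. complex_of_real (freq h $ j) *
             (2 * pi * \<i> * wigner \<tau> u (\<lambda>x. complex_of_real (x $ j) * \<phi> x) z
              + - (2 * pi * \<i>) * wigner \<tau> (\<lambda>x. complex_of_real (x $ j) * u x) \<phi> z))
        + (\<Sum>j\<in>UNIV. complex_of_real (pos h $ j) *
             (1 * wigner \<tau> u (partial_deriv j \<phi>) z + 1 * wigner \<tau> (partial_deriv j u) \<phi> z)))) (at z)"
proof -
  let ?I = "wigner_integrand \<tau>" and ?X = "\<lambda>j f x. complex_of_real (x $ j) * f x"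
  note S = u \<phi> schwartz_coord_mult schwartz_partial_deriv
  define G1 where "G1 = (\<lambda>j z t. 2 * pi * \<i> * ?I u (?X j \<phi>) z t + - (2 * pi * \<i>) * ?I (?X j u) \<phi> z t)"
  define G2 where "G2 = (\<lambda>j z t. 1 * ?I u (partial_deriv j \<phi>) z t + 1 * ?I (partial_deriv j u) \<phi> z t)"
  define D where "D = (\<lambda>z t h. (\<Sum>j\<in>UNIV. complex_of_real (freq h $ j) * G1 j z t)
        + (\<Sum>j\<in>UNIV. complex_of_real (pos h $ j) * G2 j z t))"
  have G1: "G1 j z t = 2 * pi * \<i> * (complex_of_real (t $ j) * ?I u \<phi> z t)" for j z t
    unfolding wigner_integrand_linear(1)[symmetric] G1_def by (simp add: algebra_simps)
  have deriv: "((\<lambda>z. ?I u \<phi> z t) has_derivative D z t) (at z)" for z t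
  proof (rule has_derivative_eq_rhs)
    show "((\<lambda>z. ?I u \<phi> z t) has_derivative
     (\<lambda>h. 2 * pi * \<i> * complex_of_real (t \<bullet> freq h + 0 \<bullet> freq z) * ?I u \<phi> z t
       + (\<Sum>j\<in>UNIV. complex_of_real ((pos h + \<tau> *\<^sub>R 0) $ j) * ?I u (partial_deriv j \<phi>) z t)
       + (\<Sum>j\<in>UNIV. complex_of_real ((pos h - (1 - \<tau>) *\<^sub>R 0) $ j) * ?I (partial_deriv j u) \<phi> z t))) (at z)"
      by (rule has_derivative_wigner_integrand[OF u \<phi> has_derivative_ident has_derivative_const])
  qed (rule ext, simp add: D_def G1 G2_def inner_vec_def sum_distrib_left sum_distrib_right
      sum.distrib distrib_left mult_ac)
  have int: "integrable lborel (?I p q z)" if "p \<in> schwartz" "q \<in> schwartz" for p q z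
    by (rule wigner_integrand_integrable[OF that])
  have intG: "integrable lborel (G1 j z)" "integrable lborel (G2 j z)" for j z
    unfolding G1_def G2_def by (intro Bochner_Integration.integrable_add integrable_mult_right int S)+
  let ?w = "\<lambda>t::real^'n. (1 + norm t) ^ (2 * CARD('n))"
  have "\<forall>j. \<exists>B\<ge>0. \<forall>z t. cmod (G1 j z t) \<le> B / ?w t"
    unfolding G1_def by (intro allI wigner_integrand_combination_bound S)
  then obtain B1 where B1: "\<And>j. B1 j \<ge> 0" "\<And>j z t. cmod (G1 j z t) \<le> B1 j / ?w t" by metis
  have "\<forall>j. \<exists>B\<ge>0. \<forall>z t. cmod (G2 j z t) \<le> B / ?w t"
    unfolding G2_def by (intro allI wigner_integrand_combination_bound S)
  then obtain B2 where B2: "\<And>j. B2 j \<ge> 0" "\<And>j z t. cmod (G2 j z t) \<le> B2 j / ?w t" by metis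
  define B where "B = sum B1 UNIV + sum B2 UNIV"
  have B: "cmod (D z t h) \<le> B / ?w t * norm h" for z t h
  proof -
    have h: "\<bar>freq h $ j\<bar> \<le> norm h" "\<bar>pos h $ j\<bar> \<le> norm h" for j
      using component_le_norm_cart[of "freq h" j] component_le_norm_cart[of "pos h" j] norm_phase_le[of h] by linarith+
    have "cmod (D z t h) \<le> (\<Sum>j\<in>UNIV. cmod (complex_of_real (freq h $ j) * G1 j z t))
        + (\<Sum>j\<in>UNIV. cmod (complex_of_real (pos h $ j) * G2 j z t))"
      unfolding D_def by (intro norm_triangle_le add_mono norm_sum)
    also have "\<dots> \<le> (\<Sum>j\<in>UNIV. norm h * (B1 j / ?w t)) + (\<Sum>j\<in>UNIV. norm h * (B2 j / ?w t))"
      unfolding norm_mult norm_of_real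
      by (intro add_mono sum_mono mult_mono h B1 B2 norm_ge_zero)
    also have "\<dots> = B / ?w t * norm h"
      unfolding B_def sum_distrib_left[symmetric] sum_divide_distrib[symmetric]
      by (simp add: add_divide_distrib distrib_left mult.commute)
    finally show ?thesis .
  qed
  have K: "integrable lborel (\<lambda>t::real^'n. B / ?w t)"
    by (rule integrable_divide_power_norm)
  have "((\<lambda>z. \<integral>t. ?I u \<phi> z t \<partial>lborel) has_derivative (\<lambda>h. \<integral>t. D z t h \<partial>lborel)) (at z)"
  proof (rule has_derivative_integral[OF int[OF u \<phi>] deriv _ B K])
    show "(\<lambda>t. D z t h) \<in> borel_measurable lborel" for h
      unfolding D_def using borel_measurable_integrable[OF intG(1)] borel_measurable_integrable[OF intG(2)]
      by (intro borel_measurable_add borel_measurable_sum borel_measurable_times borel_measurable_const)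
  qed
  moreover have "(\<integral>t. D z t h \<partial>lborel) = (\<Sum>j\<in>UNIV. complex_of_real (freq h $ j) *
             (2 * pi * \<i> * wigner \<tau> u (?X j \<phi>) z + - (2 * pi * \<i>) * wigner \<tau> (?X j u) \<phi> z))
        + (\<Sum>j\<in>UNIV. complex_of_real (pos h $ j) *
             (1 * wigner \<tau> u (partial_deriv j \<phi>) z + 1 * wigner \<tau> (partial_deriv j u) \<phi> z))" for h
  proof -
    have "(\<integral>t. G1 j z t \<partial>lborel) = 2 * pi * \<i> * wigner \<tau> u (?X j \<phi>) z + - (2 * pi * \<i>) * wigner \<tau> (?X j u) \<phi> z" for j
      unfolding G1_def by (subst Bochner_Integration.integral_add)
        (simp_all only: integral_mult_right_zero wigner_eq_lborel S integrable_mult_right int)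
    moreover have "(\<integral>t. G2 j z t \<partial>lborel) = 1 * wigner \<tau> u (partial_deriv j \<phi>) z + 1 * wigner \<tau> (partial_deriv j u) \<phi> z" for j
      unfolding G2_def by (subst Bochner_Integration.integral_add)
        (simp_all only: integral_mult_right_zero wigner_eq_lborel S integrable_mult_right int)
    ultimately show ?thesis
      unfolding D_def using intG
      by (subst Bochner_Integration.integral_add) (simp_all add: integral_sum)
  qed
  moreover have "wigner \<tau> u \<phi> = (\<lambda>z. \<integral>t. ?I u \<phi> z t \<partial>lborel)"
    by (rule ext) (rule wigner_eq_lborel[OF u \<phi>])
  ultimately show ?thesis by (simp only:)
qed

text \<open>The integral does not change when the integration variable is translated by \<open>s e\<^sub>j\<close>; the identity
is the derivative of this constant function of \<open>s\<close> at \<open>0\<close>.\<close>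

lemma wigner_integration_by_parts:
  fixes z :: "real^('n + 'n::finite)"
  assumes u: "u \<in> schwartz" and \<phi>: "\<phi> \<in> schwartz"
  shows "2 * pi * \<i> * complex_of_real (freq z $ j) * wigner \<tau> u \<phi> z
     + (complex_of_real \<tau> * wigner \<tau> u (partial_deriv j \<phi>) z
        + complex_of_real (\<tau> - 1) * wigner \<tau> (partial_deriv j u) \<phi> z) = 0"
proof -
  let ?I = "wigner_integrand \<tau>"
  let ?w = "\<lambda>t::real^'n. (1 + norm t) ^ (2 * CARD('n))"
  let ?e = "axis j 1 :: real^'n"
  note S = u \<phi> schwartz_partial_deriv
  define G where "G = (\<lambda>t. 2 * pi * \<i> * complex_of_real (freq z $ j) * ?I u \<phi> z t
     + (complex_of_real \<tau> * ?I u (partial_deriv j \<phi>) z t + complex_of_real (\<tau> - 1) * ?I (partial_deriv j u) \<phi> z t))"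
  define D where "D = (\<lambda>s t h. complex_of_real h * G (t + s *\<^sub>R ?e))"
  have [measurable]: "?I u \<phi> z \<in> borel_measurable borel" "?I u (partial_deriv j \<phi>) z \<in> borel_measurable borel"
     "?I (partial_deriv j u) \<phi> z \<in> borel_measurable borel"
    by (intro wigner_integrand_measurable S)+
  have G_meas [measurable]: "G \<in> borel_measurable borel"
    unfolding G_def by measurable
  have int: "integrable lborel (?I p q z)" if "p \<in> schwartz" "q \<in> schwartz" for p q
    by (rule wigner_integrand_integrable[OF that])
  have deriv: "((\<lambda>s. ?I u \<phi> z (t + s *\<^sub>R ?e)) has_derivative D s t) (at s)" for s t
  proof (rule has_derivative_eq_rhs)
    have t: "((\<lambda>s. t + s *\<^sub>R ?e) has_derivative (\<lambda>h. h *\<^sub>R ?e)) (at s)"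
      by (rule has_derivative_eq_rhs, rule has_derivative_add[OF has_derivative_const
            has_derivative_scaleR_left[OF has_derivative_ident]]) simp
    let ?T = "t + s *\<^sub>R ?e"
    show "((\<lambda>s. ?I u \<phi> z (t + s *\<^sub>R ?e)) has_derivative
     (\<lambda>h. 2 * pi * \<i> * complex_of_real (?T \<bullet> freq 0 + (h *\<^sub>R ?e) \<bullet> freq z) * ?I u \<phi> z ?T
       + (\<Sum>k\<in>UNIV. complex_of_real ((pos 0 + \<tau> *\<^sub>R (h *\<^sub>R ?e)) $ k) * ?I u (partial_deriv k \<phi>) z ?T)
       + (\<Sum>k\<in>UNIV. complex_of_real ((pos 0 - (1 - \<tau>) *\<^sub>R (h *\<^sub>R ?e)) $ k) * ?I (partial_deriv k u) \<phi> z ?T))) (at s)"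
      by (rule has_derivative_wigner_integrand[OF u \<phi> has_derivative_const t])
    have zero: "pos (0 :: real^('n + 'n)) = 0" "freq (0 :: real^('n + 'n)) = 0"
      by (simp_all add: pos_def freq_def vec_eq_iff)
    have delta: "(\<Sum>k\<in>UNIV. complex_of_real ((c *\<^sub>R (h *\<^sub>R ?e)) $ k) * F k) = complex_of_real (c * h) * F j" for c h F
    proof -
      have "(\<Sum>k\<in>UNIV. complex_of_real ((c *\<^sub>R (h *\<^sub>R ?e)) $ k) * F k)
          = (\<Sum>k\<in>{j}. complex_of_real ((c *\<^sub>R (h *\<^sub>R ?e)) $ k) * F k)"
        by (rule sum.mono_neutral_right) (auto simp: axis_def)
      thus ?thesis by simp
    qed
    have minus: "pos 0 - (1 - \<tau>) *\<^sub>R (h *\<^sub>R ?e) = (\<tau> - 1) *\<^sub>R (h *\<^sub>R ?e)" for h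
      unfolding zero by (simp add: algebra_simps)
    show "(\<lambda>h. 2 * pi * \<i> * complex_of_real (?T \<bullet> freq 0 + (h *\<^sub>R ?e) \<bullet> freq z) * ?I u \<phi> z ?T
       + (\<Sum>k\<in>UNIV. complex_of_real ((pos 0 + \<tau> *\<^sub>R (h *\<^sub>R ?e)) $ k) * ?I u (partial_deriv k \<phi>) z ?T)
       + (\<Sum>k\<in>UNIV. complex_of_real ((pos 0 - (1 - \<tau>) *\<^sub>R (h *\<^sub>R ?e)) $ k) * ?I (partial_deriv k u) \<phi> z ?T)) = D s t"
      unfolding minus unfolding zero add_0_left delta
      by (rule ext) (simp add: D_def G_def inner_axis' algebra_simps)
  qed
  obtain B1 where B1: "B1 \<ge> 0" "\<And>t. cmod (?I u \<phi> z t) \<le> B1 / ?w t"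
    using wigner_integrand_bound[OF u \<phi>] by blast
  have "\<exists>B\<ge>0. \<forall>z t. cmod (complex_of_real \<tau> * ?I u (partial_deriv j \<phi>) z t + complex_of_real (\<tau> - 1) * ?I (partial_deriv j u) \<phi> z t) \<le> B / ?w t"
    by (intro wigner_integrand_combination_bound S)
  then obtain B2 where B2: "B2 \<ge> 0"
      "\<And>t. cmod (complex_of_real \<tau> * ?I u (partial_deriv j \<phi>) z t + complex_of_real (\<tau> - 1) * ?I (partial_deriv j u) \<phi> z t) \<le> B2 / ?w t"
    by blast
  define B where "B = cmod (2 * pi * \<i> * complex_of_real (freq z $ j)) * B1 + B2"
  have B0: "B \<ge> 0" unfolding B_def by (intro add_nonneg_nonneg mult_nonneg_nonneg B1 B2 norm_ge_zero)
  have G: "cmod (G t) \<le> B / ?w t" for t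
  proof -
    have "cmod (G t) \<le> cmod (2 * pi * \<i> * complex_of_real (freq z $ j)) * (B1 / ?w t) + B2 / ?w t"
      unfolding G_def by (rule norm_triangle_le, rule add_mono, subst norm_mult, rule mult_left_mono[OF B1(2)])
        (rule norm_ge_zero B2)+
    thus ?thesis by (simp add: B_def add_divide_distrib)
  qed
  have bound: "cmod (D s t h) \<le> (2 ^ (2 * CARD('n)) * B / ?w t) * norm h" if "dist 0 s < 1" for s t h
  proof -
    have "norm (t + s *\<^sub>R ?e - s *\<^sub>R ?e) \<le> norm (t + s *\<^sub>R ?e) + norm (s *\<^sub>R ?e)"
      by (rule norm_triangle_ineq4)
    moreover have "norm (s *\<^sub>R ?e) \<le> 1" using that by simp
    ultimately have "norm t \<le> norm (t + s *\<^sub>R ?e) + 1" by simp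
    hence "1 + norm t \<le> 2 * (1 + norm (t + s *\<^sub>R ?e))"
      using norm_ge_zero[of "t + s *\<^sub>R ?e"] by argo
    hence "?w t \<le> 2 ^ (2 * CARD('n)) * ?w (t + s *\<^sub>R ?e)"
      unfolding power_mult_distrib[symmetric] by (intro power_mono) auto
    hence "B * ?w t \<le> B * (2 ^ (2 * CARD('n)) * ?w (t + s *\<^sub>R ?e))"
      using B0 by (rule mult_left_mono)
    moreover have pos: "?w x > 0" for x by (rule one_plus_norm_power_pos)
    ultimately have "B / ?w (t + s *\<^sub>R ?e) \<le> 2 ^ (2 * CARD('n)) * B / ?w t"
      using pos[of t] pos[of "t + s *\<^sub>R ?e"] by (simp add: divide_simps mult_ac)
    with G[of "t + s *\<^sub>R ?e"] have "cmod (G (t + s *\<^sub>R ?e)) \<le> 2 ^ (2 * CARD('n)) * B / ?w t" by linarith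
    from mult_left_mono[OF this abs_ge_zero[of h]]
    show ?thesis unfolding D_def norm_mult norm_of_real by (simp add: mult_ac)
  qed
  have K: "integrable lborel (\<lambda>t::real^'n. 2 ^ (2 * CARD('n)) * B / ?w t)"
    by (rule integrable_divide_power_norm)
  have "((\<lambda>s. \<integral>t. ?I u \<phi> z (t + s *\<^sub>R ?e) \<partial>lborel) has_derivative (\<lambda>h. \<integral>t. D 0 t h \<partial>lborel)) (at 0)"
  proof (rule has_derivative_integral[OF _ deriv _ bound K])
    show "integrable lborel (\<lambda>t. ?I u \<phi> z (t + s *\<^sub>R ?e))" for s
      by (subst integral_lborel_translate(1)) (simp_all add: int S)
    show "(\<lambda>t. D 0 t h) \<in> borel_measurable lborel" for h
      unfolding D_def by simp
  qed
  moreover have "(\<lambda>s. \<integral>t. ?I u \<phi> z (t + s *\<^sub>R ?e) \<partial>lborel) = (\<lambda>s. \<integral>t. ?I u \<phi> z t \<partial>lborel)"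
    by (rule ext, rule integral_lborel_translate(2)) simp
  ultimately have "((\<lambda>s::real. \<integral>t. ?I u \<phi> z t \<partial>lborel) has_derivative (\<lambda>h. \<integral>t. D 0 t h \<partial>lborel)) (at 0)"
    by (simp only:)
  from has_derivative_unique[OF this has_derivative_const]
  have "(\<integral>t. D 0 t 1 \<partial>lborel) = 0" by (rule fun_cong)
  moreover have "D 0 t 1 = G t" for t by (simp add: D_def)
  ultimately have "(\<integral>t. G t \<partial>lborel) = 0" by simp
  also have "(\<integral>t. G t \<partial>lborel) = 2 * pi * \<i> * complex_of_real (freq z $ j) * wigner \<tau> u \<phi> z
     + (complex_of_real \<tau> * wigner \<tau> u (partial_deriv j \<phi>) z
        + complex_of_real (\<tau> - 1) * wigner \<tau> (partial_deriv j u) \<phi> z)"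
    unfolding G_def
    by (subst Bochner_Integration.integral_add, (intro Bochner_Integration.integrable_add integrable_mult_right int S)+,
        subst Bochner_Integration.integral_add, (intro integrable_mult_right int S)+)
       (simp_all only: integral_mult_right_zero wigner_eq_lborel S)
  finally show ?thesis .
qed

text \<open>The linear span of the Wigner transforms is the class to which the coinduction principle for
Schwartz functions is applied.\<close>

inductive wigner_span :: "real \<Rightarrow> (real^('n + 'n::finite) \<Rightarrow> complex) \<Rightarrow> bool" for \<tau> where
  wigner: "\<lbrakk>u \<in> schwartz; \<phi> \<in> schwartz\<rbrakk> \<Longrightarrow> wigner_span \<tau> (wigner \<tau> u \<phi>)"
| combination: "\<lbrakk>wigner_span \<tau> f; wigner_span \<tau> g\<rbrakk> \<Longrightarrow> wigner_span \<tau> (\<lambda>z. a * f z + b * g z)"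

lemma wigner_span_differentiable:
  assumes "wigner_span \<tau> f"
  shows "f differentiable at z"
  using assms
proof induction
  case (wigner u \<phi>)
  show ?case by (rule differentiableI[OF has_derivative_wigner[OF wigner]])
next
  case (combination f g a b)
  show ?case
    by (rule differentiable_add; rule differentiable_mult[OF differentiable_const]; rule combination.IH)
qed

lemma phase_axis [simp]:
  "pos (axis (Inl j) c) = axis j c" "freq (axis (Inl j) c) = 0"
  "pos (axis (Inr j) c) = 0" "freq (axis (Inr j) c) = axis j c"
  by (auto simp: pos_def freq_def axis_def vec_eq_iff)

lemma sum_axis_mult: "(\<Sum>k\<in>UNIV. complex_of_real (axis j 1 $ k) * F k) = F j"
proof -
  have "(\<Sum>k\<in>UNIV. complex_of_real (axis j 1 $ k) * F k) = (\<Sum>k\<in>{j}. complex_of_real (axis j 1 $ k) * F k)"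
    by (rule sum.mono_neutral_right) (auto simp: axis_def)
  thus ?thesis by simp
qed

lemma wigner_span_partial_deriv:
  fixes f :: "real^('n + 'n::finite) \<Rightarrow> complex"
  assumes "wigner_span \<tau> f"
  shows "wigner_span \<tau> (partial_deriv i f)"
  using assms
proof induction
  case (wigner u \<phi>)
  note S = wigner schwartz_coord_mult schwartz_partial_deriv
  show ?case
  proof (cases i)
    case (Inl j)
    have "partial_deriv i (wigner \<tau> u \<phi>) = (\<lambda>z. 1 * wigner \<tau> u (partial_deriv j \<phi>) z + 1 * wigner \<tau> (partial_deriv j u) \<phi> z)"
      by (rule ext, subst partial_deriv_eqI[OF has_derivative_wigner[OF wigner]]) (simp add: Inl sum_axis_mult)
    thus ?thesis by (simp only:) (intro wigner_span.intros S)
  next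
    case (Inr j)
    have "partial_deriv i (wigner \<tau> u \<phi>) =
      (\<lambda>z. 2 * pi * \<i> * wigner \<tau> u (\<lambda>x. complex_of_real (x $ j) * \<phi> x) z + - (2 * pi * \<i>) * wigner \<tau> (\<lambda>x. complex_of_real (x $ j) * u x) \<phi> z)"
      by (rule ext, subst partial_deriv_eqI[OF has_derivative_wigner[OF wigner]]) (simp add: Inr sum_axis_mult)
    thus ?thesis by (simp only:) (intro wigner_span.intros S)
  qed
next
  case (combination f g a b)
  have D: "(h has_derivative frechet_derivative h (at z)) (at z)" if "wigner_span \<tau> h" for h z
    using wigner_span_differentiable[OF that] by (simp add: frechet_derivative_works)
  have "((\<lambda>z. a * f z + b * g z) has_derivative (\<lambda>h. a * frechet_derivative f (at z) h + b * frechet_derivative g (at z) h)) (at z)" for z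
    by (intro has_derivative_add has_derivative_mult_right D combination.hyps)
  hence "partial_deriv i (\<lambda>z. a * f z + b * g z) = (\<lambda>z. a * partial_deriv i f z + b * partial_deriv i g z)"
    by (intro ext) (subst partial_deriv_eqI, assumption, simp add: partial_deriv_def)
  thus ?case by (simp only:) (rule wigner_span.combination[OF combination.IH])
qed

text \<open>Multiplication by a coordinate leads back to combinations of Wigner transforms: for positions by
absorbing the factor, for frequencies by integration by parts.\<close>

lemma wigner_coord_mult:
  assumes "u \<in> schwartz" "\<phi> \<in> schwartz"
  shows "complex_of_real (pos z $ j) * wigner \<tau> u \<phi> z
      = complex_of_real (1 - \<tau>) * wigner \<tau> u (\<lambda>x. complex_of_real (x $ j) * \<phi> x) z
        + complex_of_real \<tau> * wigner \<tau> (\<lambda>x. complex_of_real (x $ j) * u x) \<phi> z" (is ?pos)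
    and "complex_of_real (freq z $ j) * wigner \<tau> u \<phi> z
      = complex_of_real \<tau> * \<i> / (2 * pi) * wigner \<tau> u (partial_deriv j \<phi>) z
        + complex_of_real (\<tau> - 1) * \<i> / (2 * pi) * wigner \<tau> (partial_deriv j u) \<phi> z" (is ?freq)
proof -
  note S = assms schwartz_coord_mult schwartz_partial_deriv
  have int: "integrable lborel (wigner_integrand \<tau> p q z)" if "p \<in> schwartz" "q \<in> schwartz" for p q
    by (rule wigner_integrand_integrable[OF that])
  have "complex_of_real (pos z $ j) * wigner \<tau> u \<phi> z = (\<integral>t. complex_of_real (pos z $ j) * wigner_integrand \<tau> u \<phi> z t \<partial>lborel)"
    by (simp add: wigner_eq_lborel S)
  also have "\<dots> = complex_of_real (1 - \<tau>) * wigner \<tau> u (\<lambda>x. complex_of_real (x $ j) * \<phi> x) z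
        + complex_of_real \<tau> * wigner \<tau> (\<lambda>x. complex_of_real (x $ j) * u x) \<phi> z"
    unfolding wigner_integrand_linear(2)[symmetric]
    by (subst Bochner_Integration.integral_add, (intro integrable_mult_right int S)+)
       (simp_all only: integral_mult_right_zero wigner_eq_lborel S)
  finally show ?pos .
  have solve: "x = \<tau>' * \<i> / (2 * pi) * a + \<sigma>' * \<i> / (2 * pi) * b" if "2 * pi * \<i> * x + (\<tau>' * a + \<sigma>' * b) = 0" for x a b \<tau>' \<sigma>' :: complex
  proof -
    have "\<tau>' * a + \<sigma>' * b = - (2 * pi * \<i> * x)"
      using that by (simp add: eq_neg_iff_add_eq_0 add.commute)
    hence "\<i> * (\<tau>' * a + \<sigma>' * b) = 2 * pi * x" by simp
    thus ?thesis by (simp add: field_simps)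
  qed
  show ?freq
    by (rule solve) (use wigner_integration_by_parts[OF assms, of z j \<tau>] in \<open>simp add: mult_ac\<close>)
qed

lemma wigner_span_coord_mult:
  fixes f :: "real^('n + 'n::finite) \<Rightarrow> complex"
  assumes "wigner_span \<tau> f"
  shows "wigner_span \<tau> (\<lambda>z. complex_of_real (z $ i) * f z)"
  using assms
proof induction
  case (wigner u \<phi>)
  note S = wigner schwartz_coord_mult schwartz_partial_deriv
  show ?case
  proof (cases i)
    case (Inl j)
    have "z $ i = pos z $ j" for z :: "real^('n + 'n)" by (simp add: Inl pos_def)
    thus ?thesis
      by (simp only: wigner_coord_mult(1)[OF wigner]) (intro wigner_span.intros S)
  next
    case (Inr j)
    have "z $ i = freq z $ j" for z :: "real^('n + 'n)" by (simp add: Inr freq_def)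
    thus ?thesis
      by (simp only: wigner_coord_mult(2)[OF wigner]) (intro wigner_span.intros S)
  qed
next
  case (combination f g a b)
  have "(\<lambda>z. complex_of_real (z $ i) * (a * f z + b * g z))
      = (\<lambda>z. a * (complex_of_real (z $ i) * f z) + b * (complex_of_real (z $ i) * g z))"
    by (simp add: algebra_simps)
  thus ?case by (simp only:) (rule wigner_span.combination[OF combination.IH])
qed

lemma wigner_span_bounded:
  fixes f :: "real^('n + 'n::finite) \<Rightarrow> complex"
  assumes "wigner_span \<tau> f"
  shows "\<exists>B. \<forall>z. cmod (f z) \<le> B"
  using assms
proof induction
  case (wigner u \<phi>)
  let ?w = "\<lambda>t::real^'n. (1 + norm t) ^ (2 * CARD('n))"
  obtain B where B: "\<And>z t. cmod (wigner_integrand \<tau> u \<phi> z t) \<le> B / ?w t"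
    using wigner_integrand_bound[OF wigner] by blast
  have K: "integrable lborel (\<lambda>t::real^'n. B / ?w t)"
    by (rule integrable_divide_power_norm)
  have "cmod (wigner \<tau> u \<phi> z) \<le> (\<integral>t. B / ?w t \<partial>lborel)" for z
    unfolding wigner_eq_lborel[OF wigner] by (rule Bochner_Integration.integral_norm_bound_integral[OF wigner_integrand_integrable[OF wigner] K B])
  thus ?case by (intro exI allI)
next
  case (combination f g a b)
  then obtain A B where AB: "\<And>z. cmod (f z) \<le> A" "\<And>z. cmod (g z) \<le> B" by auto
  have "cmod (a * f z + b * g z) \<le> cmod a * A + cmod b * B" for z
    by (rule norm_triangle_le) (simp only: norm_mult, intro add_mono mult_left_mono AB norm_ge_zero)
  thus ?case by (intro exI allI)
qed

lemma wigner_schwartz: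
  assumes "u \<in> schwartz" "\<phi> \<in> schwartz"
  shows "wigner \<tau> u \<phi> \<in> schwartz"
  by (rule schwartz_coinduct[of "wigner_span \<tau>"])
     (rule wigner_span.wigner[OF assms] wigner_span_differentiable wigner_span_partial_deriv
           wigner_span_coord_mult wigner_span_bounded; assumption)+

section \<open>Gaussians and Fourier inversion\<close>

lemma cis_measurable [measurable]: "cis \<in> borel_measurable borel"
  by (intro borel_measurable_continuous_onI continuous_intros)

text \<open>This is the characteristic function of the standard normal distribution.\<close>

lemma gaussian_fourier_real:
  shows "integrable lborel (\<lambda>x::real. cis (\<xi> * x) * complex_of_real (exp (- x\<^sup>2 / 2)))"
    and "(\<integral>x. cis (\<xi> * x) * complex_of_real (exp (- x\<^sup>2 / 2)) \<partial>lborel) = complex_of_real (sqrt (2 * pi) * exp (- \<xi>\<^sup>2 / 2))"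
proof -
  have dens: "std_normal_density x = exp (- x\<^sup>2 / 2) / sqrt (2 * pi)" for x
    by (simp add: std_normal_density_def)
  have eq: "cis (\<xi> * x) * complex_of_real (exp (- x\<^sup>2 / 2)) = complex_of_real (sqrt (2 * pi)) * (std_normal_density x *\<^sub>R cis (\<xi> * x))" for x
    by (simp add: dens scaleR_conv_of_real)
  have int: "integrable lborel (\<lambda>x. std_normal_density x *\<^sub>R cis (\<xi> * x))"
    by (rule Bochner_Integration.integrable_bound[OF integrable_normal_density[of 1 0]]) (auto intro!: AE_I2)
  show "integrable lborel (\<lambda>x::real. cis (\<xi> * x) * complex_of_real (exp (- x\<^sup>2 / 2)))"
    unfolding eq by (intro integrable_mult_right int)
  have "complex_of_real (exp (- \<xi>\<^sup>2 / 2)) = char std_normal_distribution \<xi>"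
    by (simp add: char_std_normal_distribution)
  also have "\<dots> = (\<integral>x. std_normal_density x *\<^sub>R cis (\<xi> * x) \<partial>lborel)"
    unfolding char_def by (subst integral_density) (auto simp: cis_conv_exp)
  finally show "(\<integral>x. cis (\<xi> * x) * complex_of_real (exp (- x\<^sup>2 / 2)) \<partial>lborel) = complex_of_real (sqrt (2 * pi) * exp (- \<xi>\<^sup>2 / 2))"
    unfolding eq integral_mult_right_zero by simp
qed

definition gaussian :: "real^'k::finite \<Rightarrow> complex" where
  "gaussian x = complex_of_real (exp (- (norm x)\<^sup>2 / 2))"

lemma gaussian_measurable [measurable]: "gaussian \<in> borel_measurable borel"
  unfolding gaussian_def by measurable

lemma gaussian_fourier:
  fixes \<xi> :: "real^'k::finite"
  shows "integrable lborel (\<lambda>x. cis (\<xi> \<bullet> x) * gaussian x)"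
    and "(\<integral>x. cis (\<xi> \<bullet> x) * gaussian x \<partial>lborel) = complex_of_real (sqrt (2 * pi) ^ CARD('k)) * gaussian \<xi>"
proof -
  have gprod: "gaussian x = (\<Prod>i\<in>UNIV. complex_of_real (exp (- (x $ i)\<^sup>2 / 2)))" for x :: "real^'k"
  proof -
    have "- (norm x)\<^sup>2 / 2 = (\<Sum>i\<in>UNIV. - (x $ i)\<^sup>2 / 2)"
      by (simp add: norm_vec_def L2_set_def sum_nonneg sum_negf sum_divide_distrib)
    thus ?thesis by (simp add: gaussian_def exp_sum)
  qed
  have cprod: "cis (\<xi> \<bullet> x) = (\<Prod>i\<in>UNIV. cis (\<xi> $ i * x $ i))" for x
    by (simp add: cis_conv_exp inner_vec_def sum_distrib_left exp_sum[symmetric])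
  have eq: "cis (\<xi> \<bullet> x) * gaussian x = (\<Prod>i\<in>UNIV. cis (\<xi> $ i * x $ i) * complex_of_real (exp (- (x $ i)\<^sup>2 / 2)))" for x
    by (simp only: gprod cprod prod.distrib)
  note * = integral_lborel_vec_prod[of "\<lambda>i x. cis (\<xi> $ i * x) * complex_of_real (exp (- x\<^sup>2 / 2))", OF gaussian_fourier_real(1)]
  show "integrable lborel (\<lambda>x. cis (\<xi> \<bullet> x) * gaussian x)"
    unfolding eq by (rule *(1))
  have "(\<integral>x. cis (\<xi> \<bullet> x) * gaussian x \<partial>lborel) = (\<Prod>i\<in>UNIV. complex_of_real (sqrt (2 * pi) * exp (- (\<xi> $ i)\<^sup>2 / 2)))"
    unfolding eq *(2) gaussian_fourier_real(2) ..
  thus "(\<integral>x. cis (\<xi> \<bullet> x) * gaussian x \<partial>lborel) = complex_of_real (sqrt (2 * pi) ^ CARD('k)) * gaussian \<xi>"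
    by (simp add: gprod prod.distrib)
qed

lemma integral_lborel_scale:
  fixes f :: "real^'k::finite \<Rightarrow> complex"
  assumes "c > 0" and [measurable]: "f \<in> borel_measurable borel"
  shows "integrable lborel f \<longleftrightarrow> integrable lborel (\<lambda>x. f (c *\<^sub>R x))"
    and "(\<integral>x. f x \<partial>lborel) = complex_of_real (c ^ CARD('k)) * (\<integral>x. f (c *\<^sub>R x) \<partial>lborel)"
proof -
  have det: "det (mat c :: real^'k^'k) = c ^ CARD('k)"
    by (subst det_diagonal) (auto simp: mat_def)
  have mv: "mat c *v x = c *\<^sub>R x" for x :: "real^'k"
  proof -
    have "(\<Sum>j\<in>UNIV. (if i = j then c else 0) * x $ j) = (\<Sum>j\<in>{i}. (if i = j then c else 0) * x $ j)" for i
      by (rule sum.mono_neutral_right) auto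
    thus ?thesis by (simp add: vec_eq_iff matrix_vector_mult_def mat_def)
  qed
  have nz: "det (mat c :: real^'k^'k) \<noteq> 0" using assms by (simp add: det)
  show "integrable lborel f \<longleftrightarrow> integrable lborel (\<lambda>x. f (c *\<^sub>R x))"
    using integral_lborel_linear(1)[OF nz assms(2)] by (simp add: mv)
  show "(\<integral>x. f x \<partial>lborel) = complex_of_real (c ^ CARD('k)) * (\<integral>x. f (c *\<^sub>R x) \<partial>lborel)"
    using integral_lborel_linear(2)[OF nz assms(2)] assms(1) by (simp add: mv det)
qed

text \<open>Let \<open>h\<close> be the Fourier integral of \<open>g\<close> and \<open>\<gamma>\<close> the Gaussian. By Fubini and the Fourier transform of
\<open>\<gamma>\<close>, the integral of \<open>h(\<omega>) \<gamma>(\<epsilon>\<omega>)\<close> is a constant times that of \<open>g(\<epsilon>s) \<gamma>(2\<pi>s)\<close>. As \<open>\<epsilon> \<rightarrow> 0\<close>, dominated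
convergence gives \<open>\<integral> h\<close> on one side and a multiple of \<open>g(0)\<close> on the other; evaluating
\<open>\<integral> \<gamma>(2\<pi>s) ds\<close> shows that the multiple is \<open>1\<close>.\<close>

lemma fourier_inversion_at_zero:
  fixes g :: "real^'k::finite \<Rightarrow> complex"
  assumes cont: "continuous_on UNIV g" and bounded: "\<And>x. cmod (g x) \<le> B"
    and int: "integrable lborel g"
    and inth: "integrable lborel (\<lambda>\<omega>. \<integral>t. cis (2 * pi * (t \<bullet> \<omega>)) * g t \<partial>lborel)"
  shows "(\<integral>\<omega>. (\<integral>t. cis (2 * pi * (t \<bullet> \<omega>)) * g t \<partial>lborel) \<partial>lborel) = g 0"
proof -
  have [measurable]: "g \<in> borel_measurable borel"
    using cont by (rule borel_measurable_continuous_onI)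
  define h where "h = (\<lambda>\<omega>. \<integral>t. cis (2 * pi * (t \<bullet> \<omega>)) * g t \<partial>lborel)"
  have inth': "integrable lborel h" using inth by (simp add: h_def)
  have [measurable]: "h \<in> borel_measurable borel"
    using inth' by (auto dest: borel_measurable_integrable)
  define c where "c = complex_of_real (sqrt (2 * pi) ^ CARD('k))"
  have gauss_int: "integrable lborel (gaussian :: real^'k \<Rightarrow> complex)"
    using gaussian_fourier(1)[of "0::real^'k"] by simp
  have gauss_scale_int: "integrable lborel (\<lambda>x::real^'k. gaussian (e *\<^sub>R x))" if "e > 0" for e
    using integral_lborel_scale(1)[OF that, of "gaussian :: real^'k \<Rightarrow> complex"] gauss_int by simp
  have gauss_le: "cmod (gaussian x) \<le> 1" for x :: "real^'k"
    by (simp add: gaussian_def)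
  \<comment> \<open>The factor \<open>\<gamma>(\<epsilon>\<omega>)\<close> makes the double integral absolutely convergent.\<close>
  have regularized: "(\<integral>\<omega>. h \<omega> * gaussian (e *\<^sub>R \<omega>) \<partial>lborel) = c * (\<integral>s. g (e *\<^sub>R s) * gaussian ((2 * pi) *\<^sub>R s) \<partial>lborel)"
    if e: "e > 0" for e
  proof -
    define F where "F = (\<lambda>\<omega> t. cis (2 * pi * (t \<bullet> \<omega>)) * g t * gaussian (e *\<^sub>R \<omega>))"
    have F_int: "integrable (lborel \<Otimes>\<^sub>M lborel) (case_prod F)"
    proof (rule lborel_pair.Fubini_integrable)
      show "case_prod F \<in> borel_measurable (lborel \<Otimes>\<^sub>M lborel)"
        unfolding F_def by measurable
      have "(\<integral>t. norm (F \<omega> t) \<partial>lborel) = (\<integral>t. norm (g t) \<partial>lborel) * norm (gaussian (e *\<^sub>R \<omega>))" for \<omega>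
        unfolding F_def by (simp add: norm_mult)
      thus "integrable lborel (\<lambda>x. \<integral>y. norm (case_prod F (x, y)) \<partial>lborel)"
        using gauss_scale_int[OF e] by simp
      have "integrable lborel (\<lambda>t. F \<omega> t)" for \<omega>
      proof -
        have "integrable lborel (\<lambda>t. cis (2 * pi * (t \<bullet> \<omega>)) * g t)"
          by (rule Bochner_Integration.integrable_bound[OF int]) (auto simp: norm_mult)
        thus ?thesis unfolding F_def by simp
      qed
      thus "AE x in lborel. integrable lborel (\<lambda>y. case_prod F (x, y))" by simp
    qed
    have inner: "(\<integral>\<omega>. F \<omega> t \<partial>lborel) = g t * (c * complex_of_real ((1 / e) ^ CARD('k)) * gaussian ((2 * pi / e) *\<^sub>R t))" for t
    proof -
      have "(\<integral>\<omega>. F \<omega> t \<partial>lborel) = g t * (\<integral>\<omega>. cis (2 * pi * (t \<bullet> \<omega>)) * gaussian (e *\<^sub>R \<omega>) \<partial>lborel)"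
        unfolding F_def by (subst integral_mult_right_zero[symmetric]) (simp add: mult_ac)
      also have "(\<integral>\<omega>. cis (2 * pi * (t \<bullet> \<omega>)) * gaussian (e *\<^sub>R \<omega>) \<partial>lborel)
          = complex_of_real ((1 / e) ^ CARD('k)) * (\<integral>\<omega>. cis (2 * pi * (t \<bullet> ((1 / e) *\<^sub>R \<omega>))) * gaussian (e *\<^sub>R ((1 / e) *\<^sub>R \<omega>)) \<partial>lborel)"
        by (rule integral_lborel_scale(2)) (use e in simp_all)
      also have "(\<integral>\<omega>. cis (2 * pi * (t \<bullet> ((1 / e) *\<^sub>R \<omega>))) * gaussian (e *\<^sub>R ((1 / e) *\<^sub>R \<omega>)) \<partial>lborel)
          = (\<integral>\<omega>. cis (((2 * pi / e) *\<^sub>R t) \<bullet> \<omega>) * gaussian \<omega> \<partial>lborel)"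
        using e by (simp add: field_simps)
      also have "\<dots> = c * gaussian ((2 * pi / e) *\<^sub>R t)"
        unfolding gaussian_fourier(2) c_def ..
      finally show ?thesis by (simp add: mult_ac)
    qed
    have "(\<integral>\<omega>. h \<omega> * gaussian (e *\<^sub>R \<omega>) \<partial>lborel) = (\<integral>\<omega>. (\<integral>t. F \<omega> t \<partial>lborel) \<partial>lborel)"
      unfolding F_def h_def by simp
    also have "\<dots> = (\<integral>t. (\<integral>\<omega>. F \<omega> t \<partial>lborel) \<partial>lborel)"
      using lborel_pair.Fubini_integral[OF F_int] by simp
    also have "\<dots> = complex_of_real (e ^ CARD('k)) * (\<integral>s. g (e *\<^sub>R s) * (c * complex_of_real ((1 / e) ^ CARD('k)) * gaussian ((2 * pi / e) *\<^sub>R (e *\<^sub>R s))) \<partial>lborel)"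
      unfolding inner by (rule integral_lborel_scale(2)[OF e]) measurable
    also have "\<dots> = complex_of_real (e ^ CARD('k)) * (\<integral>s. (c * complex_of_real ((1 / e) ^ CARD('k))) * (g (e *\<^sub>R s) * gaussian ((2 * pi) *\<^sub>R s)) \<partial>lborel)"
      using e by (simp add: mult_ac)
    also have "\<dots> = (complex_of_real (e ^ CARD('k)) * complex_of_real ((1 / e) ^ CARD('k))) * (c * (\<integral>s. g (e *\<^sub>R s) * gaussian ((2 * pi) *\<^sub>R s) \<partial>lborel))"
      by (subst integral_mult_right_zero) (simp add: mult_ac)
    also have "complex_of_real (e ^ CARD('k)) * complex_of_real ((1 / e) ^ CARD('k)) = 1"
      using e by (simp flip: of_real_mult power_mult_distrib)
    finally show ?thesis by simp
  qed
  define e where "e = (\<lambda>n. 1 / real (Suc n))"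
  have e0: "e \<longlonglongrightarrow> 0" unfolding e_def by (rule LIMSEQ_Suc[OF lim_1_over_n])
  have e_pos: "e n > 0" for n by (simp add: e_def)
  have gauss_cont: "continuous_on UNIV (gaussian :: real^'k \<Rightarrow> complex)"
    unfolding gaussian_def by (intro continuous_intros) simp
  have tendsto_scaled: "(\<lambda>n. f (e n *\<^sub>R x)) \<longlonglongrightarrow> f 0" if "continuous_on UNIV f" for f :: "real^'k \<Rightarrow> complex" and x
  proof -
    have "(\<lambda>n. e n *\<^sub>R x) \<longlonglongrightarrow> 0" using tendsto_scaleR[OF e0 tendsto_const[of x]] by simp
    thus ?thesis using continuous_on_tendsto_compose[OF that] by auto
  qed
  have "(\<lambda>n. \<integral>\<omega>. h \<omega> * gaussian (e n *\<^sub>R \<omega>) \<partial>lborel) \<longlonglongrightarrow> (\<integral>\<omega>. h \<omega> * gaussian (0::real^'k) \<partial>lborel)"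
  proof (rule integral_dominated_convergence[where w = "\<lambda>\<omega>. cmod (h \<omega>)"])
    show "AE x in lborel. (\<lambda>n. h x * gaussian (e n *\<^sub>R x)) \<longlonglongrightarrow> h x * gaussian (0::real^'k)"
      by (intro AE_I2 tendsto_mult tendsto_const tendsto_scaled[OF gauss_cont])
    show "AE x in lborel. cmod (h x * gaussian (e n *\<^sub>R x)) \<le> cmod (h x)" for n
      using mult_left_mono[OF gauss_le norm_ge_zero] by (intro AE_I2) (simp add: norm_mult)
  qed (use inth' in simp_all)
  hence lim1: "(\<lambda>n. c * (\<integral>s. g (e n *\<^sub>R s) * gaussian ((2 * pi) *\<^sub>R s) \<partial>lborel)) \<longlonglongrightarrow> (\<integral>\<omega>. h \<omega> \<partial>lborel)"
    unfolding regularized[OF e_pos] by (simp add: gaussian_def)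
  have "(\<lambda>n. \<integral>s. g (e n *\<^sub>R s) * gaussian ((2 * pi) *\<^sub>R s) \<partial>lborel) \<longlonglongrightarrow> (\<integral>s. g 0 * gaussian ((2 * pi) *\<^sub>R s) \<partial>(lborel :: (real^'k) measure))"
  proof (rule integral_dominated_convergence[where w = "\<lambda>s. B * cmod (gaussian ((2 * pi) *\<^sub>R s))"])
    show "AE x in lborel. (\<lambda>n. g (e n *\<^sub>R x) * gaussian ((2 * pi) *\<^sub>R x)) \<longlonglongrightarrow> g 0 * gaussian ((2 * pi) *\<^sub>R x)"
      by (intro AE_I2 tendsto_mult tendsto_const tendsto_scaled[OF cont])
    show "AE x in lborel. cmod (g (e n *\<^sub>R x) * gaussian ((2 * pi) *\<^sub>R x)) \<le> B * cmod (gaussian ((2 * pi) *\<^sub>R x))" for n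
      unfolding norm_mult by (intro AE_I2 mult_right_mono bounded norm_ge_zero)
    show "integrable lborel (\<lambda>s::real^'k. B * cmod (gaussian ((2 * pi) *\<^sub>R s)))"
      by (intro integrable_mult_right integrable_norm gauss_scale_int) simp
  qed simp_all
  from tendsto_mult_left[OF this, of c]
  have lim2: "(\<lambda>n. c * (\<integral>s. g (e n *\<^sub>R s) * gaussian ((2 * pi) *\<^sub>R s) \<partial>lborel)) \<longlonglongrightarrow> c * (g 0 * (\<integral>s. gaussian ((2 * pi) *\<^sub>R (s::real^'k)) \<partial>lborel))"
    by simp
  have cG: "c = complex_of_real ((2 * pi) ^ CARD('k)) * (\<integral>s. gaussian ((2 * pi) *\<^sub>R (s::real^'k)) \<partial>lborel)"
    using gaussian_fourier(2)[of "0::real^'k"] integral_lborel_scale(2)[of "2 * pi" "gaussian :: real^'k \<Rightarrow> complex"]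
    by (simp add: c_def gaussian_def)
  have cc: "complex_of_real ((2 * pi) ^ CARD('k)) = c * c"
    unfolding c_def of_real_mult[symmetric] power_mult_distrib[symmetric] by simp
  have "c \<noteq> 0" by (simp add: c_def)
  moreover have "c * (c * (\<integral>s. gaussian ((2 * pi) *\<^sub>R (s::real^'k)) \<partial>lborel)) = c * 1"
    using cG unfolding cc by (simp only: mult.assoc mult_1_right)
  ultimately have "c * (\<integral>s. gaussian ((2 * pi) *\<^sub>R (s::real^'k)) \<partial>lborel) = 1"
    by (simp only: mult_cancel_left simp_thms)
  hence "c * (g 0 * (\<integral>s. gaussian ((2 * pi) *\<^sub>R (s::real^'k)) \<partial>lborel)) = g 0"
    by (simp add: mult_ac)
  with LIMSEQ_unique[OF lim1 lim2] show ?thesis by (simp add: h_def)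
qed

text \<open>Translating \<open>g\<close> by \<open>b\<close> multiplies its Fourier integral by \<open>exp (2\<pi>i b \<cdot> \<omega>)\<close>.\<close>

lemma fourier_inversion:
  fixes g :: "real^'k::finite \<Rightarrow> complex"
  assumes cont: "continuous_on UNIV g" and bounded: "\<And>x. cmod (g x) \<le> B"
    and int: "integrable lborel g"
    and inth: "integrable lborel (\<lambda>\<omega>. \<integral>t. cis (2 * pi * (t \<bullet> \<omega>)) * g t \<partial>lborel)"
  shows "(\<integral>\<omega>. cis (2 * pi * (b \<bullet> \<omega>)) * (\<integral>t. cis (2 * pi * (t \<bullet> \<omega>)) * g t \<partial>lborel) \<partial>lborel) = g (- b)"
proof -
  have [measurable]: "g \<in> borel_measurable borel"
    using cont by (rule borel_measurable_continuous_onI)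
  have eq: "cis (2 * pi * (b \<bullet> \<omega>)) * (\<integral>t. cis (2 * pi * (t \<bullet> \<omega>)) * g t \<partial>lborel)
      = (\<integral>t. cis (2 * pi * (t \<bullet> \<omega>)) * g (t - b) \<partial>lborel)" for \<omega>
  proof -
    have "(\<integral>t. cis (2 * pi * (t \<bullet> \<omega>)) * g (t - b) \<partial>lborel) = (\<integral>t. cis (2 * pi * ((t + b) \<bullet> \<omega>)) * g (t + b - b) \<partial>lborel)"
      by (rule integral_lborel_translate(2)[symmetric]) simp
    also have "\<dots> = (\<integral>t. cis (2 * pi * (b \<bullet> \<omega>)) * (cis (2 * pi * (t \<bullet> \<omega>)) * g t) \<partial>lborel)"
    proof -
      have "cis (2 * pi * ((t + b) \<bullet> \<omega>)) = cis (2 * pi * (b \<bullet> \<omega>)) * cis (2 * pi * (t \<bullet> \<omega>))" for t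
        by (simp add: cis_mult inner_add_left algebra_simps)
      thus ?thesis by (simp add: mult.assoc)
    qed
    finally show ?thesis by simp
  qed
  have "integrable lborel (\<lambda>\<omega>. cis (2 * pi * (b \<bullet> \<omega>)) * (\<integral>t. cis (2 * pi * (t \<bullet> \<omega>)) * g t \<partial>lborel))"
    by (rule Bochner_Integration.integrable_bound[OF inth])
       (use borel_measurable_integrable[OF inth] in \<open>auto simp: norm_mult\<close>)
  hence *: "integrable lborel (\<lambda>\<omega>. \<integral>t. cis (2 * pi * (t \<bullet> \<omega>)) * g (t - b) \<partial>lborel)"
    unfolding eq .
  have "integrable lborel (\<lambda>t. g (t - b))"
    using integral_lborel_translate(1)[of g "- b"] int by simp
  moreover have "continuous_on UNIV (\<lambda>t. g (t - b))"
    by (rule continuous_on_compose2[OF cont]) (auto intro!: continuous_intros)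
  ultimately show ?thesis
    unfolding eq using fourier_inversion_at_zero[of "\<lambda>t. g (t - b)" B] bounded * by simp
qed

section \<open>Fourier integrals of Wigner transforms\<close>

lemma tf_shift_eq_shift_test: "tf_shift z T = (\<lambda>\<phi>. T (shift_test (freq z) (pos z) \<phi>))"
  by (simp add: tf_shift_def modulate_def translate_def shift_test_def)

lemma schwartz_integrable:
  assumes "f \<in> schwartz"
  shows "integrable lborel (f :: real^'k::finite \<Rightarrow> complex)"
proof -
  obtain B where B: "B \<ge> 0" "\<And>x. cmod (f x) \<le> B / (1 + norm x) ^ (2 * CARD('k))"
    using schwartz_decay_divide[OF assms] by blast
  have "integrable lborel (\<lambda>t::real^'k. B / (1 + norm t) ^ (2 * CARD('k)))"
    by (rule integrable_divide_power_norm)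
  thus ?thesis
    by (rule Bochner_Integration.integrable_bound)
       (use schwartz_measurable[OF assms] B in \<open>auto intro!: AE_I2\<close>)
qed

lemma schwartz_continuous_on: "f \<in> schwartz \<Longrightarrow> continuous_on A f"
  by (intro continuous_at_imp_continuous_on ballI differentiable_imp_continuous_within schwartz_differentiable)

lemma distr_of_schwartz:
  assumes "u \<in> schwartz" "\<phi> \<in> schwartz"
  shows "distr_of u \<phi> = (\<integral>x. u x * \<phi> x \<partial>lborel)"
  using assms schwartz_measurable[of u] schwartz_measurable[of \<phi>]
  by (simp add: distr_of_def integral_completion)

text \<open>Put \<open>\<zeta> = (a, b)\<close>. For a fixed position \<open>r\<close>, the Wigner transform is the Fourier integral of
\<open>t \<mapsto> \<phi>(r + \<tau>t) u(r - (1 - \<tau>)t)\<close> in the frequency variable, so by inversion the frequency integral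
evaluates this function at \<open>t = -b\<close>. The remaining integral of \<open>exp (2\<pi>i a \<cdot> r) \<phi>(r - \<tau>b) u(r + (1 - \<tau>)b)\<close>
becomes the pairing of \<open>\<phi>\<close> with the shift of \<open>u\<close> by \<open>(-b, a) = \<J>\<zeta>\<close> after the substitution
\<open>r = x + \<tau>b\<close>, which also splits off the phase.\<close>

lemma integral_character_wigner:
  fixes \<zeta> :: "real^('n + 'n::finite)"
  assumes u: "u \<in> schwartz" and \<phi>: "\<phi> \<in> schwartz"
  shows "(\<integral>z. cis (2 * pi * (\<zeta> \<bullet> z)) * wigner \<tau> u \<phi> z \<partial>lborel)
     = cis (2 * pi * (\<tau> * (pos \<zeta> \<bullet> freq \<zeta>))) * tf_shift (J_mat *v \<zeta>) (distr_of u) \<phi>"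
proof -
  define a b where "a = pos \<zeta>" and "b = freq \<zeta>"
  note W = wigner_schwartz[OF u \<phi>, of \<tau>]
  note [measurable] = schwartz_measurable[OF u] schwartz_measurable[OF \<phi>] schwartz_measurable[OF W]
  have int: "integrable lborel (\<lambda>z. cis (2 * pi * (\<zeta> \<bullet> z)) * wigner \<tau> u \<phi> z)"
    by (rule Bochner_Integration.integrable_bound[OF schwartz_integrable[OF W]]) (auto simp: norm_mult)
  define g where "g = (\<lambda>r t. \<phi> (r + \<tau> *\<^sub>R t) * u (r - (1 - \<tau>) *\<^sub>R t))"
  have g_eq: "cis (2 * pi * (t \<bullet> w)) * g r t = wigner_integrand \<tau> u \<phi> (phase_point r w) t" for r w t
    by (simp add: g_def wigner_integrand_def mult.assoc)
  have Wg: "wigner \<tau> u \<phi> (phase_point r w) = (\<integral>t. cis (2 * pi * (t \<bullet> w)) * g r t \<partial>lborel)" for r w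
    unfolding g_eq by (rule wigner_eq_lborel[OF u \<phi>])
  have g_meas [measurable]: "g r \<in> borel_measurable borel" for r
    unfolding g_def by measurable
  have "\<exists>B\<ge>0. \<forall>z t. cmod (wigner_integrand \<tau> u \<phi> z t) \<le> B / (1 + norm t) ^ 0"
    by (rule wigner_integrand_bound[OF u \<phi>])
  then obtain B where B: "\<And>z t. cmod (wigner_integrand \<tau> u \<phi> z t) \<le> B" by auto
  have inner: "(\<integral>w. cis (2 * pi * (b \<bullet> w)) * wigner \<tau> u \<phi> (phase_point r w) \<partial>lborel) = g r (- b)" for r
    unfolding Wg
  proof (rule fourier_inversion)
    show "continuous_on UNIV (g r)"
      unfolding g_def
      by (intro continuous_on_mult continuous_on_compose2[OF schwartz_continuous_on[OF \<phi>, of UNIV]]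
          continuous_on_compose2[OF schwartz_continuous_on[OF u, of UNIV]] continuous_intros) auto
    have norm_g: "cmod (g r t) = cmod (wigner_integrand \<tau> u \<phi> (phase_point r 0) t)" for t
      by (simp flip: g_eq add: norm_mult)
    show "cmod (g r t) \<le> B" for t
      using B[of "phase_point r 0" t] by (simp add: norm_g)
    show "integrable lborel (g r)"
      by (rule Bochner_Integration.integrable_bound[OF wigner_integrand_integrable[OF u \<phi>, of \<tau> "phase_point r 0"]])
         (auto simp: norm_g)
    show "integrable lborel (\<lambda>\<omega>. \<integral>t. cis (2 * pi * (t \<bullet> \<omega>)) * g r t \<partial>lborel)"
      unfolding Wg[symmetric]
    proof -
      obtain C where C: "C \<ge> 0" "\<And>z. cmod (wigner \<tau> u \<phi> z) \<le> C / (1 + norm z) ^ (2 * CARD('n))"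
        using schwartz_decay_divide[OF W] by blast
      have K: "integrable lborel (\<lambda>t::real^'n. C / (1 + norm t) ^ (2 * CARD('n)))"
        by (rule integrable_divide_power_norm)
      have "(\<lambda>p. wigner \<tau> u \<phi> (case_prod phase_point p)) \<in> borel_measurable (lborel \<Otimes>\<^sub>M lborel)"
        by measurable
      from measurable_compose[OF measurable_Pair1'[of r] this]
      have meas: "(\<lambda>w. wigner \<tau> u \<phi> (phase_point r w)) \<in> borel_measurable lborel" by simp
      have "cmod (wigner \<tau> u \<phi> (phase_point r w)) \<le> C / (1 + norm w) ^ (2 * CARD('n))" for w
      proof -
        have "norm w \<le> norm (phase_point r w)"
          using norm_phase_le(2)[of "phase_point r w"] by simp
        hence "C / (1 + norm (phase_point r w)) ^ (2 * CARD('n)) \<le> C / (1 + norm w) ^ (2 * CARD('n))"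
          by (intro divide_left_mono power_mono C mult_pos_pos one_plus_norm_power_pos) auto
        with C(2)[of "phase_point r w"] show ?thesis by linarith
      qed
      thus "integrable lborel (\<lambda>w. wigner \<tau> u \<phi> (phase_point r w))"
        using C(1) by (intro Bochner_Integration.integrable_bound[OF K meas] AE_I2) simp
    qed
  qed
  have "(\<integral>z. cis (2 * pi * (\<zeta> \<bullet> z)) * wigner \<tau> u \<phi> z \<partial>lborel)
      = (\<integral>r. (\<integral>w. cis (2 * pi * (\<zeta> \<bullet> phase_point r w)) * wigner \<tau> u \<phi> (phase_point r w) \<partial>lborel) \<partial>lborel)"
    by (rule integral_phase_space[OF int])
  also have "\<dots> = (\<integral>r. cis (2 * pi * (a \<bullet> r)) * (\<integral>w. cis (2 * pi * (b \<bullet> w)) * wigner \<tau> u \<phi> (phase_point r w) \<partial>lborel) \<partial>lborel)"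
  proof -
    have "cis (2 * pi * (\<zeta> \<bullet> phase_point r w)) = cis (2 * pi * (a \<bullet> r)) * cis (2 * pi * (b \<bullet> w))" for r w
      by (simp add: inner_phase[of \<zeta>] a_def b_def cis_mult distrib_left)
    thus ?thesis by (simp add: mult.assoc)
  qed
  also have "\<dots> = (\<integral>r. cis (2 * pi * (a \<bullet> r)) * g r (- b) \<partial>lborel)"
    unfolding inner ..
  also have "\<dots> = (\<integral>x. cis (2 * pi * (a \<bullet> (x + \<tau> *\<^sub>R b))) * g (x + \<tau> *\<^sub>R b) (- b) \<partial>lborel)"
    by (rule integral_lborel_translate(2)[symmetric]) (simp add: g_def)
  also have "\<dots> = (\<integral>x. cis (2 * pi * (\<tau> * (a \<bullet> b))) * (u (x + b) * shift_test a (- b) \<phi> (x + b)) \<partial>lborel)"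
  proof -
    have "cis (2 * pi * (a \<bullet> (x + \<tau> *\<^sub>R b))) = cis (2 * pi * (\<tau> * (a \<bullet> b))) * cis (2 * pi * (a \<bullet> x))" for x
      by (simp add: cis_mult inner_add_right algebra_simps)
    moreover have "g (x + \<tau> *\<^sub>R b) (- b) = \<phi> x * u (x + b)" for x
      by (simp add: g_def algebra_simps)
    ultimately show ?thesis by (simp add: shift_test_def mult_ac)
  qed
  also have "\<dots> = cis (2 * pi * (\<tau> * (a \<bullet> b))) * (\<integral>x. u (x + b) * shift_test a (- b) \<phi> (x + b) \<partial>lborel)"
    by simp
  also have "(\<integral>x. u (x + b) * shift_test a (- b) \<phi> (x + b) \<partial>lborel) = (\<integral>x. u x * shift_test a (- b) \<phi> x \<partial>lborel)"
    by (rule integral_lborel_translate(2)[of "\<lambda>x. u x * shift_test a (- b) \<phi> x"]) (simp add: shift_test_def)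
  also have "\<dots> = distr_of u (shift_test a (- b) \<phi>)"
    by (rule distr_of_schwartz[symmetric, OF u schwartz_shift_test[OF \<phi>]])
  also have "shift_test a (- b) \<phi> = shift_test (freq (J_mat *v \<zeta>)) (pos (J_mat *v \<zeta>)) \<phi>"
  proof -
    have "pos (J_mat *v \<zeta>) = - b"
      by (simp add: vec_eq_iff pos_def freq_def b_def matrix_vector_mult_def J_mat_def sum_phase if_distrib[of "\<lambda>x. x * _"] cong: if_cong)
    moreover have "freq (J_mat *v \<zeta>) = a"
      by (simp add: vec_eq_iff pos_def freq_def a_def matrix_vector_mult_def J_mat_def sum_phase if_distrib[of "\<lambda>x. x * _"] cong: if_cong)
    ultimately show ?thesis by simp
  qed
  finally show ?thesis
    unfolding tf_shift_eq_shift_test a_def b_def .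
qed

section \<open>Sums over the integer lattice\<close>

lemma countable_int_lattice [simp]: "countable (int_lattice :: (real^'k::finite) set)"
proof -
  have "int_lattice \<subseteq> range (\<lambda>f :: 'k \<Rightarrow> int. \<chi> i. real_of_int (f i))"
  proof
    fix x :: "real^'k" assume "x \<in> int_lattice"
    hence "x = (\<chi> i. real_of_int (\<lfloor>x $ i\<rfloor>))" by (auto simp: int_lattice_def vec_eq_iff)
    thus "x \<in> range (\<lambda>f :: 'k \<Rightarrow> int. \<chi> i. real_of_int (f i))"
      by (rule range_eqI[where x = "\<lambda>i. \<lfloor>x $ i\<rfloor>"])
  qed
  thus ?thesis by (rule countable_subset) simp
qed

lemma int_lattice_add: "\<kappa> \<in> int_lattice \<Longrightarrow> \<mu> \<in> int_lattice \<Longrightarrow> \<kappa> + \<mu> \<in> int_lattice"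
  and int_lattice_minus: "\<kappa> \<in> int_lattice \<Longrightarrow> - \<kappa> \<in> int_lattice"
  and int_lattice_diff: "\<kappa> \<in> int_lattice \<Longrightarrow> \<mu> \<in> int_lattice \<Longrightarrow> \<kappa> - \<mu> \<in> int_lattice"
  and int_lattice_zero: "0 \<in> int_lattice"
  and int_lattice_axis: "axis i 1 \<in> int_lattice"
  by (auto simp: int_lattice_def axis_def)

lemma int_lattice_inner: "\<kappa> \<in> int_lattice \<Longrightarrow> \<mu> \<in> int_lattice \<Longrightarrow> \<kappa> \<bullet> \<mu> \<in> \<int>"
  by (auto simp: int_lattice_def inner_vec_def intro: Ints_sum Ints_mult)

text \<open>Unordered sums of complex numbers are Bochner integrals, including the value \<open>0\<close> where there is no
absolute convergence. This makes measurability, Fubini and dominated convergence available for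
lattice sums.\<close>

lemma infsum_eq_count_space:
  fixes f :: "'a \<Rightarrow> complex"
  shows "infsum f A = (\<integral>x. f x \<partial>count_space A)"
    and "f summable_on A \<longleftrightarrow> integrable (count_space A) f"
proof -
  show *: "f summable_on A \<longleftrightarrow> integrable (count_space A) f"
    unfolding summable_on_iff_abs_summable_on_complex abs_summable_equivalent Infinite_Set_Sum.abs_summable_on_def ..
  show "infsum f A = (\<integral>x. f x \<partial>count_space A)"
  proof (cases "f summable_on A")
    case True
    hence "infsetsum f A = infsum f A"
      using infsetsum_infsum[of f A] unfolding summable_on_iff_abs_summable_on_complex abs_summable_equivalent by simp
    thus ?thesis unfolding infsetsum_def by simp
  next
    case False
    thus ?thesis using * by (simp add: infsum_not_exists not_integrable_integral_eq)
  qed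
qed

definition lattice_sum :: "(real^'k::finite \<Rightarrow> complex) \<Rightarrow> real^'k \<Rightarrow> complex" where
  "lattice_sum f x = (\<Sum>\<^sub>\<infinity>\<kappa>\<in>int_lattice. f (x + \<kappa>))"

lemma lattice_sum_altdef:
  "lattice_sum f x = (\<integral>\<kappa>. f (x - \<kappa>) \<partial>count_space int_lattice)"
proof -
  have "bij_betw uminus (int_lattice :: (real^'a) set) int_lattice"
    by (rule bij_betwI[of _ _ _ uminus]) (auto intro: int_lattice_minus)
  from infsum_reindex_bij_betw[OF this, of "\<lambda>\<kappa>. f (x + \<kappa>)"]
  show ?thesis by (simp add: lattice_sum_def flip: infsum_eq_count_space(1))
qed

lemma lattice_sum_periodic:
  assumes "\<mu> \<in> int_lattice"
  shows "lattice_sum f (x + \<mu>) = lattice_sum f x"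
proof -
  have "bij_betw (\<lambda>\<kappa>. \<mu> + \<kappa>) (int_lattice :: (real^'a) set) int_lattice"
    by (rule bij_betwI[of _ _ _ "\<lambda>\<kappa>. \<kappa> - \<mu>"]) (use assms in \<open>auto intro: int_lattice_add int_lattice_diff\<close>)
  from infsum_reindex_bij_betw[OF this, of "\<lambda>\<kappa>. f (x + \<kappa>)"]
  show ?thesis by (simp add: lattice_sum_def add.assoc)
qed

lemma lattice_pair_measurable:
  fixes f :: "real^'k::finite \<Rightarrow> real^'k \<Rightarrow> 'b::topological_space"
  assumes "\<And>\<kappa>. f \<kappa> \<in> borel_measurable borel"
  shows "(\<lambda>(\<kappa>, y). f \<kappa> y) \<in> borel_measurable (count_space int_lattice \<Otimes>\<^sub>M lborel)"
  by (rule measurable_pair_measure_countable1) (use assms in simp_all)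

text \<open>Both sides are the double integral of \<open>Q(y) V(y - \<kappa>)\<close> over points and lattice vectors, once
after the translation \<open>y = x + \<kappa>\<close>. The bound \<open>B\<close> makes this function integrable.\<close>

lemma integral_lattice_sum_swap:
  fixes Q V :: "real^'k::finite \<Rightarrow> complex"
  assumes Q: "integrable lborel Q" and [measurable]: "V \<in> borel_measurable borel"
    and B: "\<And>x. (\<integral>\<^sup>+\<kappa>. ennreal (cmod (V (x - \<kappa>))) \<partial>count_space int_lattice) \<le> ennreal B"
  shows "(\<integral>x. V x * lattice_sum Q x \<partial>lborel) = (\<integral>x. Q x * lattice_sum V x \<partial>lborel)"
proof -
  let ?Z = "count_space (int_lattice :: (real^'k) set)"
  interpret Z: sigma_finite_measure ?Z
    by (rule sigma_finite_measure_count_space_countable) simp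
  interpret P: pair_sigma_finite ?Z lborel ..
  have [measurable]: "Q \<in> borel_measurable borel" using Q by (auto dest: borel_measurable_integrable)
  define G where "G = (\<lambda>\<kappa> y. Q y * V (y - \<kappa>))"
  define F where "F = (\<lambda>\<kappa> y. V y * Q (y + \<kappa>))"
  have FG: "F \<kappa> = (\<lambda>y. G \<kappa> (y + \<kappa>))" for \<kappa> by (simp add: F_def G_def mult.commute)
  have [measurable]: "case_prod G \<in> borel_measurable (?Z \<Otimes>\<^sub>M lborel)" "case_prod F \<in> borel_measurable (?Z \<Otimes>\<^sub>M lborel)"
    unfolding G_def F_def by (rule lattice_pair_measurable; simp)+
  have normG: "(\<integral>\<^sup>+p. ennreal (norm (case_prod G p)) \<partial>(?Z \<Otimes>\<^sub>M lborel)) < \<infinity>"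
  proof -
    have "(\<integral>\<^sup>+p. ennreal (norm (case_prod G p)) \<partial>(?Z \<Otimes>\<^sub>M lborel)) = (\<integral>\<^sup>+y. (\<integral>\<^sup>+\<kappa>. ennreal (norm (G \<kappa> y)) \<partial>?Z) \<partial>lborel)"
      by (subst P.nn_integral_snd[symmetric]) auto
    also have "\<dots> = (\<integral>\<^sup>+y. ennreal (norm (Q y)) * (\<integral>\<^sup>+\<kappa>. ennreal (norm (V (y - \<kappa>))) \<partial>?Z) \<partial>lborel)"
      unfolding G_def norm_mult by (subst nn_integral_cmult[symmetric]) (auto simp: ennreal_mult)
    also have "\<dots> \<le> (\<integral>\<^sup>+y. ennreal (norm (Q y)) * ennreal B \<partial>lborel)"
      by (intro nn_integral_mono mult_left_mono B) auto
    also have "\<dots> = (\<integral>\<^sup>+y. ennreal (norm (Q y)) \<partial>lborel) * ennreal B"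
      by (rule nn_integral_multc) simp
    also have "\<dots> < \<infinity>"
      using Q by (simp add: integrable_iff_bounded ennreal_mult_less_top)
    finally show ?thesis .
  qed
  have intG: "integrable (?Z \<Otimes>\<^sub>M lborel) (case_prod G)"
    unfolding integrable_iff_bounded using normG by simp
  have "(\<integral>\<^sup>+p. ennreal (norm (case_prod F p)) \<partial>(?Z \<Otimes>\<^sub>M lborel)) = (\<integral>\<^sup>+\<kappa>. (\<integral>\<^sup>+y. ennreal (norm (F \<kappa> y)) \<partial>lborel) \<partial>?Z)"
    by (subst lborel.nn_integral_fst[symmetric]) auto
  also have "\<dots> = (\<integral>\<^sup>+\<kappa>. (\<integral>\<^sup>+y. ennreal (norm (G \<kappa> y)) \<partial>lborel) \<partial>?Z)"
  proof (rule nn_integral_cong)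
    fix \<kappa>
    have [measurable]: "G \<kappa> \<in> borel_measurable borel" unfolding G_def by simp
    show "(\<integral>\<^sup>+y. ennreal (norm (F \<kappa> y)) \<partial>lborel) = (\<integral>\<^sup>+y. ennreal (norm (G \<kappa> y)) \<partial>lborel)"
      unfolding FG by (subst (2) lborel_distr_plus_right[of \<kappa>, symmetric], subst nn_integral_distr) auto
  qed
  also have "\<dots> = (\<integral>\<^sup>+p. ennreal (norm (case_prod G p)) \<partial>(?Z \<Otimes>\<^sub>M lborel))"
    by (subst lborel.nn_integral_fst[symmetric]) auto
  finally have intF: "integrable (?Z \<Otimes>\<^sub>M lborel) (case_prod F)"
    unfolding integrable_iff_bounded using normG by simp
  have "(\<integral>x. V x * lattice_sum Q x \<partial>lborel) = (\<integral>x. (\<integral>\<kappa>. F \<kappa> x \<partial>?Z) \<partial>lborel)"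
    unfolding F_def lattice_sum_def infsum_eq_count_space(1) by simp
  also have "\<dots> = (\<integral>\<kappa>. (\<integral>x. F \<kappa> x \<partial>lborel) \<partial>?Z)"
    by (rule P.Fubini_integral[OF intF])
  also have "\<dots> = (\<integral>\<kappa>. (\<integral>x. G \<kappa> x \<partial>lborel) \<partial>?Z)"
    unfolding FG by (subst integral_lborel_translate(2)) (auto simp: G_def)
  also have "\<dots> = (\<integral>x. (\<integral>\<kappa>. G \<kappa> x \<partial>?Z) \<partial>lborel)"
    by (rule P.Fubini_integral[OF intG, symmetric])
  also have "\<dots> = (\<integral>x. Q x * lattice_sum V x \<partial>lborel)"
    unfolding G_def lattice_sum_altdef by simp
  finally show ?thesis .
qed

text \<open>Half-open, so that its lattice translates form a partition and not just a cover.\<close>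

definition unit_cell :: "(real^'k::finite) set" where
  "unit_cell = {x. \<forall>i. 0 \<le> x $ i \<and> x $ i < 1}"

lemma indicator_unit_cell: "indicator unit_cell x = (\<Prod>i\<in>UNIV. indicator {0..<1} (x $ i) :: ennreal)"
proof (cases "x \<in> unit_cell")
  case True
  thus ?thesis by (auto simp: unit_cell_def)
next
  case False
  then obtain i where "x $ i \<notin> {0..<1}" by (auto simp: unit_cell_def)
  hence "(\<Prod>i\<in>UNIV. indicator {0..<1} (x $ i) :: ennreal) = 0"
    by (intro prod_zero bexI[of _ i]) (simp_all add: indicator_def)
  thus ?thesis using False by simp
qed

lemma unit_cell_measurable [measurable]: "unit_cell \<in> sets borel"
  unfolding unit_cell_def by measurable

lemma emeasure_unit_cell: "emeasure lborel (unit_cell :: (real^'k::finite) set) = 1"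
proof -
  have "emeasure lborel (unit_cell :: (real^'k) set) = (\<integral>\<^sup>+x. indicator unit_cell x \<partial>(lborel :: (real^'k) measure))"
    by simp
  also have "\<dots> = (\<Prod>i\<in>(UNIV :: 'k set). \<integral>\<^sup>+x. indicator {0..<1} x \<partial>(lborel :: real measure))"
    unfolding indicator_unit_cell
    by (rule nn_integral_lborel_vec_prod[of "\<lambda>_ :: 'k. indicator {0..<1}"]) simp
  also have "\<dots> = 1" by simp
  finally show ?thesis .
qed

lemma unit_cell_tiles:
  fixes x :: "real^'k::finite"
  shows "\<exists>\<kappa>\<in>int_lattice. \<forall>\<mu>\<in>int_lattice. x - \<mu> \<in> unit_cell \<longleftrightarrow> \<mu> = \<kappa>"
proof (intro bexI ballI)
  let ?k = "(\<chi> i. real_of_int \<lfloor>x $ i\<rfloor>) :: real^'k"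
  show "?k \<in> int_lattice" by (simp add: int_lattice_def)
  fix \<mu> :: "real^'k" assume mu: "\<mu> \<in> int_lattice"
  have "0 \<le> x $ i - \<mu> $ i \<and> x $ i - \<mu> $ i < 1 \<longleftrightarrow> \<mu> $ i = real_of_int \<lfloor>x $ i\<rfloor>" for i
  proof -
    obtain m where "\<mu> $ i = real_of_int m" using mu by (auto simp: int_lattice_def elim: Ints_cases)
    thus ?thesis by simp linarith
  qed
  thus "x - \<mu> \<in> unit_cell \<longleftrightarrow> \<mu> = ?k" by (simp add: unit_cell_def vec_eq_iff)
qed

lemma nn_integral_unit_cell_tiles:
  fixes x :: "real^'k::finite"
  shows "(\<integral>\<^sup>+\<kappa>. indicator unit_cell (x - \<kappa>) \<partial>count_space int_lattice) = 1"
proof -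
  obtain \<kappa>0 where k: "\<kappa>0 \<in> int_lattice" "\<And>\<mu>. \<mu> \<in> int_lattice \<Longrightarrow> x - \<mu> \<in> unit_cell \<longleftrightarrow> \<mu> = \<kappa>0"
    using unit_cell_tiles[of x] by blast
  have "(\<integral>\<^sup>+\<kappa>. indicator unit_cell (x - \<kappa>) \<partial>count_space int_lattice) = (\<integral>\<^sup>+\<kappa>. indicator {\<kappa>0} \<kappa> \<partial>count_space int_lattice)"
    by (rule nn_integral_cong) (simp add: k(2) indicator_def)
  also have "\<dots> = 1" using k(1) by simp
  finally show ?thesis .
qed

lemma lattice_sum_unit_cell:
  assumes "\<And>x \<kappa>. \<kappa> \<in> int_lattice \<Longrightarrow> g (x + \<kappa>) = g x"
  shows "lattice_sum (\<lambda>x. indicator unit_cell x * g x) x = g x"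
proof -
  obtain \<kappa>0 where k: "\<kappa>0 \<in> int_lattice" "\<And>\<mu>. \<mu> \<in> int_lattice \<Longrightarrow> x - \<mu> \<in> unit_cell \<longleftrightarrow> \<mu> = \<kappa>0"
    using unit_cell_tiles[of x] by blast
  have "lattice_sum (\<lambda>x. indicator unit_cell x * g x) x = (\<Sum>\<^sub>\<infinity>\<kappa>\<in>int_lattice. indicator unit_cell (x - \<kappa>) * g (x - \<kappa>))"
    unfolding lattice_sum_altdef infsum_eq_count_space(1) ..
  also have "\<dots> = (\<Sum>\<^sub>\<infinity>\<kappa>\<in>{\<kappa>0}. indicator unit_cell (x - \<kappa>) * g (x - \<kappa>))"
    by (rule infsum_cong_neutral) (use k in auto)
  also have "\<dots> = g (x - \<kappa>0)" using k by simp
  also have "\<dots> = g x" using assms[OF int_lattice_minus[OF k(1)], of x] by simp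
  finally show ?thesis .
qed

text \<open>A periodic function is the lattice sum of its restriction to the unit cell; the lattice sum then
moves to the other factor.\<close>

lemma integral_periodic_unfold:
  fixes g V :: "real^'k::finite \<Rightarrow> complex"
  assumes [measurable]: "V \<in> borel_measurable borel" "g \<in> borel_measurable borel"
    and B: "\<And>x. (\<integral>\<^sup>+\<kappa>. ennreal (cmod (V (x - \<kappa>))) \<partial>count_space int_lattice) \<le> ennreal B"
    and periodic: "\<And>x \<kappa>. \<kappa> \<in> int_lattice \<Longrightarrow> g (x + \<kappa>) = g x"
    and bounded: "\<And>x. cmod (g x) \<le> C"
  shows "(\<integral>x. V x * g x \<partial>lborel) = (\<integral>x. indicator unit_cell x * g x * lattice_sum V x \<partial>lborel)"
proof -
  have int: "integrable lborel (\<lambda>x. indicator unit_cell x * g x)"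
  proof (rule Bochner_Integration.integrable_bound)
    show "integrable lborel (\<lambda>x::real^'k. C * indicator unit_cell x)"
      by (intro integrable_mult_right integrable_real_indicator) (simp_all add: emeasure_unit_cell)
    show "AE x in lborel. cmod (indicator unit_cell x * g x) \<le> norm (C * indicator unit_cell x)"
      using bounded order_trans[OF bounded abs_ge_self] by (intro AE_I2) (simp add: norm_mult indicator_def)
  qed simp
  note integral_lattice_sum_swap[OF int assms(1) B]
  moreover have "lattice_sum (\<lambda>x. indicator unit_cell x * g x) x = g x" for x
    by (rule lattice_sum_unit_cell) (rule periodic)
  ultimately show ?thesis by simp
qed

lemma inverse_power_norm_shift:
  fixes x h :: "'a::real_normed_vector"
  shows "1 / (1 + norm x) ^ M \<le> (1 + norm h) ^ M * (1 / (1 + norm (x + h)) ^ M)"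
proof -
  have pos: "(1 + norm y) ^ M > 0" for y :: 'a by (rule one_plus_norm_power_pos)
  have "1 + norm (x + h) \<le> 1 + (norm x + norm h)" by (intro add_left_mono norm_triangle_ineq)
  also have "\<dots> \<le> (1 + norm h) * (1 + norm x)" by (simp add: algebra_simps)
  finally have "(1 + norm (x + h)) ^ M \<le> (1 + norm h) ^ M * (1 + norm x) ^ M"
    unfolding power_mult_distrib[symmetric] by (intro power_mono) auto
  thus ?thesis using pos[of x] pos[of "x + h"] by (simp add: divide_simps mult_ac)
qed

text \<open>Up to a constant, the value of the weight at \<open>x - \<kappa>\<close> is at most its mean over the translate
\<open>x - \<kappa>\<close> + unit cell. These translates tile the space, so the sum over \<open>\<kappa>\<close> is at most a multiple of
the integral of the weight.\<close>

lemma lattice_sum_weight_bound: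
  assumes "M \<ge> 2 * CARD('k::finite)"
  shows "\<exists>C. \<forall>x::real^'k. (\<integral>\<^sup>+\<kappa>. ennreal (1 / (1 + norm (x - \<kappa>)) ^ M) \<partial>count_space int_lattice) \<le> ennreal C"
proof -
  let ?Z = "count_space (int_lattice :: (real^'k) set)" and ?w = "\<lambda>x::real^'k. 1 / (1 + norm x) ^ M"
  interpret Z: sigma_finite_measure ?Z
    by (rule sigma_finite_measure_count_space_countable) simp
  interpret P: pair_sigma_finite ?Z lborel ..
  \<comment> \<open>Points of the unit cell have norm at most \<open>k\<close>.\<close>
  define c where "c = (1 + real CARD('k)) ^ M"
  have c: "c \<ge> 0" by (simp add: c_def)
  have w: "?w y \<le> c * ?w (y + h)" if "h \<in> unit_cell" for y h
  proof -
    have "norm h \<le> (\<Sum>i\<in>UNIV. \<bar>h $ i\<bar>)" by (rule norm_le_l1_cart)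
    also have "\<dots> \<le> (\<Sum>i\<in>(UNIV::'k set). 1)"
      using that by (intro sum_mono) (auto simp: unit_cell_def abs_le_iff less_imp_le intro: order_trans[of _ 0])
    finally have "(1 + norm h) ^ M \<le> c" unfolding c_def by (intro power_mono) auto
    hence "(1 + norm h) ^ M * ?w (y + h) \<le> c * ?w (y + h)" by (intro mult_right_mono) auto
    with inverse_power_norm_shift[of y M h] show ?thesis by linarith
  qed
  have "(\<integral>\<^sup>+\<kappa>. ennreal (?w (x - \<kappa>)) \<partial>?Z) \<le> ennreal c * (\<integral>\<^sup>+y. ennreal (?w y) \<partial>lborel)" for x
  proof -
    have "(\<integral>\<^sup>+\<kappa>. ennreal (?w (x - \<kappa>)) \<partial>?Z) = (\<integral>\<^sup>+\<kappa>. (\<integral>\<^sup>+h. ennreal (?w (x - \<kappa>)) * indicator unit_cell h \<partial>(lborel :: (real^'k) measure)) \<partial>?Z)"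
      by (intro nn_integral_cong, subst nn_integral_cmult_indicator) (simp_all add: emeasure_unit_cell)
    also have "\<dots> \<le> (\<integral>\<^sup>+\<kappa>. (\<integral>\<^sup>+h. ennreal c * (ennreal (?w (x - \<kappa> + h)) * indicator unit_cell h) \<partial>lborel) \<partial>?Z)"
    proof (intro nn_integral_mono)
      fix \<kappa> h :: "real^'k"
      show "ennreal (?w (x - \<kappa>)) * indicator unit_cell h \<le> ennreal c * (ennreal (?w (x - \<kappa> + h)) * indicator unit_cell h)"
      proof (cases "h \<in> unit_cell")
        case True
        have "ennreal (?w (x - \<kappa>)) \<le> ennreal (c * ?w (x - \<kappa> + h))" by (rule ennreal_leI[OF w[OF True]])
        also have "\<dots> = ennreal c * ennreal (?w (x - \<kappa> + h))" by (rule ennreal_mult'[OF c])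
        finally show ?thesis using True by simp
      qed simp
    qed
    also have "\<dots> = (\<integral>\<^sup>+\<kappa>. (\<integral>\<^sup>+y. ennreal c * (ennreal (?w y) * indicator unit_cell (y - x + \<kappa>)) \<partial>lborel) \<partial>?Z)"
    proof (rule nn_integral_cong)
      fix \<kappa> :: "real^'k"
      have "(\<integral>\<^sup>+y. ennreal c * (ennreal (?w y) * indicator unit_cell (y - x + \<kappa>)) \<partial>lborel)
          = (\<integral>\<^sup>+y. ennreal c * (ennreal (?w y) * indicator unit_cell (y - x + \<kappa>)) \<partial>distr lborel borel (\<lambda>h. h + (x - \<kappa>)))"
        unfolding lborel_distr_plus_right ..
      also have "\<dots> = (\<integral>\<^sup>+h. ennreal c * (ennreal (?w (h + (x - \<kappa>))) * indicator unit_cell (h + (x - \<kappa>) - x + \<kappa>)) \<partial>lborel)"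
        by (rule nn_integral_distr) measurable
      finally show "(\<integral>\<^sup>+h. ennreal c * (ennreal (?w (x - \<kappa> + h)) * indicator unit_cell h) \<partial>lborel)
          = (\<integral>\<^sup>+y. ennreal c * (ennreal (?w y) * indicator unit_cell (y - x + \<kappa>)) \<partial>lborel)"
        by (simp add: algebra_simps)
    qed
    also have "\<dots> = (\<integral>\<^sup>+y. (\<integral>\<^sup>+\<kappa>. ennreal c * (ennreal (?w y) * indicator unit_cell (y - x + \<kappa>)) \<partial>?Z) \<partial>lborel)"
      by (rule P.Fubini'[symmetric]) (rule lattice_pair_measurable, measurable)
    also have "\<dots> = (\<integral>\<^sup>+y. ennreal c * (ennreal (?w y) * (\<integral>\<^sup>+\<kappa>. indicator unit_cell (y - x + \<kappa>) \<partial>?Z)) \<partial>lborel)"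
      by (simp add: nn_integral_cmult)
    also have "\<dots> = (\<integral>\<^sup>+y. ennreal c * ennreal (?w y) \<partial>lborel)"
    proof (rule nn_integral_cong)
      fix y :: "real^'k"
      have "bij_betw uminus (int_lattice :: (real^'k) set) int_lattice"
        by (rule bij_betwI[of _ _ _ uminus]) (auto intro: int_lattice_minus)
      from nn_integral_bij_count_space[OF this, of "\<lambda>\<kappa>. indicator unit_cell (y - x + \<kappa>)"]
      show "ennreal c * (ennreal (?w y) * (\<integral>\<^sup>+\<kappa>. indicator unit_cell (y - x + \<kappa>) \<partial>?Z)) = ennreal c * ennreal (?w y)"
        using nn_integral_unit_cell_tiles[of "y - x"] by simp
    qed
    also have "\<dots> = ennreal c * (\<integral>\<^sup>+y. ennreal (?w y) \<partial>lborel)"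
      by (rule nn_integral_cmult) measurable
    finally show ?thesis .
  qed
  moreover have "(\<integral>\<^sup>+y. ennreal (?w y) \<partial>lborel) = ennreal (\<integral>y. ?w y \<partial>lborel)"
    by (rule nn_integral_eq_integral[OF integrable_inverse_power_norm[OF assms]]) auto
  ultimately have "\<forall>x. (\<integral>\<^sup>+\<kappa>. ennreal (?w (x - \<kappa>)) \<partial>?Z) \<le> ennreal (c * (\<integral>y. ?w y \<partial>lborel))"
    by (simp add: ennreal_mult c integral_nonneg_AE)
  thus ?thesis ..
qed

text \<open>Points within distance \<open>1\<close> of \<open>x\<close> share the summable majorant \<open>B 2\<^sup>M (1 + \<parallel>x - \<kappa>\<parallel>)\<^sup>-\<^sup>M\<close>, so dominated
convergence gives continuity of the sum at \<open>x\<close>.\<close>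

lemma lattice_sum_decaying:
  fixes V :: "real^'k::finite \<Rightarrow> complex"
  assumes M: "M \<ge> 2 * CARD('k)" and cont: "continuous_on UNIV V"
    and V: "\<And>x. cmod (V x) \<le> B / (1 + norm x) ^ M"
  shows "\<exists>C. (\<forall>x. (\<integral>\<^sup>+\<kappa>. ennreal (cmod (V (x - \<kappa>))) \<partial>count_space int_lattice) \<le> ennreal C)"
    and "continuous_on UNIV (lattice_sum V)"
proof -
  let ?Z = "count_space (int_lattice :: (real^'k) set)" and ?w = "\<lambda>x::real^'k. 1 / (1 + norm x) ^ M"
  obtain C where C: "\<And>x. (\<integral>\<^sup>+\<kappa>. ennreal (?w (x - \<kappa>)) \<partial>?Z) \<le> ennreal C"
    using lattice_sum_weight_bound[OF M] by blast
  have B: "B \<ge> 0" using order_trans[OF norm_ge_zero V[of 0]] by simp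
  have "(\<integral>\<^sup>+\<kappa>. ennreal (cmod (V (x - \<kappa>))) \<partial>?Z) \<le> ennreal (B * C)" for x
  proof -
    have "(\<integral>\<^sup>+\<kappa>. ennreal (cmod (V (x - \<kappa>))) \<partial>?Z) \<le> (\<integral>\<^sup>+\<kappa>. ennreal B * ennreal (?w (x - \<kappa>)) \<partial>?Z)"
      using V B by (intro nn_integral_mono) (simp flip: ennreal_mult add: ennreal_leI)
    also have "\<dots> = ennreal B * (\<integral>\<^sup>+\<kappa>. ennreal (?w (x - \<kappa>)) \<partial>?Z)"
      by (rule nn_integral_cmult) simp
    also have "\<dots> \<le> ennreal B * ennreal C"
      by (intro mult_left_mono C) simp
    also have "\<dots> = ennreal (B * C)" using B by (simp add: ennreal_mult')
    finally show ?thesis .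
  qed
  thus "\<exists>C. (\<forall>x. (\<integral>\<^sup>+\<kappa>. ennreal (cmod (V (x - \<kappa>))) \<partial>?Z) \<le> ennreal C)" by blast
  have intw: "integrable ?Z (\<lambda>\<kappa>. ?w (x - \<kappa>))" for x
    unfolding integrable_iff_bounded using le_less_trans[OF C[of x]] by simp
  show "continuous_on UNIV (lattice_sum V)"
    unfolding continuous_on_sequentially
  proof (intro ballI allI impI)
    fix X x assume "(\<forall>n. X n \<in> (UNIV :: (real^'k) set)) \<and> X \<longlonglongrightarrow> x"
    hence X: "X \<longlonglongrightarrow> x" by simp
    obtain N where N: "\<And>n. n \<ge> N \<Longrightarrow> dist (X n) x < 1"
      using X[unfolded lim_sequentially, rule_format, of 1] by auto
    have "(\<lambda>n. \<integral>\<kappa>. V (X (n + N) - \<kappa>) \<partial>?Z) \<longlonglongrightarrow> (\<integral>\<kappa>. V (x - \<kappa>) \<partial>?Z)"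
    proof (rule integral_dominated_convergence[where w = "\<lambda>\<kappa>. B * (2 ^ M * ?w (x - \<kappa>))"])
      show "integrable ?Z (\<lambda>\<kappa>. B * (2 ^ M * ?w (x - \<kappa>)))"
        by (intro integrable_mult_right intw)
      show "AE \<kappa> in ?Z. (\<lambda>n. V (X (n + N) - \<kappa>)) \<longlonglongrightarrow> V (x - \<kappa>)"
      proof (rule AE_I2)
        fix \<kappa>
        have "(\<lambda>n. X (n + N) - \<kappa>) \<longlonglongrightarrow> x - \<kappa>"
          by (intro tendsto_diff tendsto_const LIMSEQ_ignore_initial_segment X)
        thus "(\<lambda>n. V (X (n + N) - \<kappa>)) \<longlonglongrightarrow> V (x - \<kappa>)"
          using continuous_on_tendsto_compose[OF cont] by auto
      qed
      show "AE \<kappa> in ?Z. norm (V (X (n + N) - \<kappa>)) \<le> B * (2 ^ M * ?w (x - \<kappa>))" for n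
      proof (rule AE_I2)
        fix \<kappa>
        let ?h = "x - X (n + N)"
        have h: "norm ?h \<le> 1" using N[of "n + N"] by (simp add: dist_norm norm_minus_commute)
        have "?w (X (n + N) - \<kappa>) \<le> (1 + norm ?h) ^ M * ?w (X (n + N) - \<kappa> + ?h)"
          by (rule inverse_power_norm_shift)
        also have "\<dots> \<le> 2 ^ M * ?w (x - \<kappa>)"
          using h by (intro mult_mono power_mono) auto
        finally have "B * ?w (X (n + N) - \<kappa>) \<le> B * (2 ^ M * ?w (x - \<kappa>))"
          by (intro mult_left_mono B)
        with V[of "X (n + N) - \<kappa>"] show "norm (V (X (n + N) - \<kappa>)) \<le> B * (2 ^ M * ?w (x - \<kappa>))" by simp
      qed
    qed simp_all
    hence "(\<lambda>n. lattice_sum V (X (n + N))) \<longlonglongrightarrow> lattice_sum V x"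
      unfolding lattice_sum_altdef .
    from LIMSEQ_offset[OF this] show "(lattice_sum V \<circ> X) \<longlonglongrightarrow> lattice_sum V x"
      unfolding o_def .
  qed
qed

section \<open>Trigonometric polynomials\<close>

definition lattice_char :: "real^'k \<Rightarrow> real^'k::finite \<Rightarrow> complex" where
  "lattice_char m x = cis (2 * pi * (m \<bullet> x))"

lemma lattice_char_measurable [measurable]: "lattice_char m \<in> borel_measurable borel"
  unfolding lattice_char_def by measurable

lemma norm_lattice_char [simp]: "cmod (lattice_char m x) = 1"
  by (simp add: lattice_char_def)

lemma lattice_char_mult: "lattice_char m x * lattice_char n x = lattice_char (m + n) x"
  by (simp add: lattice_char_def cis_mult inner_add_left distrib_left)

lemma lattice_char_add: "lattice_char m (x + y) = lattice_char m x * lattice_char m y"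
  by (simp add: lattice_char_def cis_mult inner_add_right distrib_left)

lemma lattice_char_periodic:
  assumes "m \<in> int_lattice" "\<kappa> \<in> int_lattice"
  shows "lattice_char m (x + \<kappa>) = lattice_char m x"
proof -
  have "lattice_char m \<kappa> = 1"
    using int_lattice_inner[OF assms] by (simp add: lattice_char_def)
  thus ?thesis by (simp add: lattice_char_add)
qed

text \<open>The mean of a periodic function over the unit cell is invariant under translation, and a
suitable translation multiplies a nontrivial character by \<open>-1\<close>.\<close>

lemma integral_unit_cell_char:
  fixes m :: "real^'k::finite"
  assumes m: "m \<in> int_lattice"
  shows "(\<integral>x. indicator unit_cell x * lattice_char m x \<partial>lborel) = (if m = 0 then 1 else 0)"
proof (cases "m = 0")
  case True
  have "(\<integral>x. indicator unit_cell x * lattice_char m x \<partial>lborel) = (\<integral>x. complex_of_real (indicat_real unit_cell x) \<partial>(lborel :: (real^'k) measure))"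
    by (rule Bochner_Integration.integral_cong) (simp_all add: True lattice_char_def indicator_def)
  also have "\<dots> = 1"
    by (simp add: measure_def emeasure_unit_cell)
  finally show ?thesis using True by simp
next
  case False
  then obtain i where i: "m $ i \<noteq> 0" by (auto simp: vec_eq_iff)
  define h :: "real^'k" where "h = axis i (1 / (2 * m $ i))"
  have "2 * pi * (m \<bullet> h) = pi" using i by (simp add: h_def inner_axis)
  hence mh: "lattice_char m h = - 1" by (simp only: lattice_char_def cis_pi)
  let ?I = "\<integral>x. indicator unit_cell x * lattice_char m x \<partial>lborel"
  let ?V = "\<lambda>x. indicator unit_cell (x - h) :: complex"
  have sumV: "(\<integral>\<^sup>+\<kappa>. ennreal (cmod (?V (x - \<kappa>))) \<partial>count_space int_lattice) = 1" for x
  proof -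
    have "(\<integral>\<^sup>+\<kappa>. ennreal (cmod (?V (x - \<kappa>))) \<partial>count_space int_lattice) = (\<integral>\<^sup>+\<kappa>. indicator unit_cell ((x - h) - \<kappa>) \<partial>count_space int_lattice)"
      by (rule nn_integral_cong) (auto simp: indicator_def algebra_simps)
    thus ?thesis by (simp add: nn_integral_unit_cell_tiles)
  qed
  have lsV: "lattice_sum ?V x = 1" for x
  proof -
    have "lattice_sum ?V x = lattice_sum (\<lambda>y. indicator unit_cell y * 1) (x - h)"
      unfolding lattice_sum_def by (simp add: algebra_simps)
    also have "\<dots> = 1" by (rule lattice_sum_unit_cell) simp
    finally show ?thesis .
  qed
  have "(\<integral>x. ?V x * lattice_char m x \<partial>lborel) = (\<integral>x. indicator unit_cell x * lattice_char m x * lattice_sum ?V x \<partial>lborel)"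
  proof (rule integral_periodic_unfold[where B = 1 and C = 1])
    show "lattice_char m (x + \<kappa>) = lattice_char m x" if "\<kappa> \<in> int_lattice" for x \<kappa>
      by (rule lattice_char_periodic[OF m that])
  qed (simp_all add: sumV)
  also have "\<dots> = ?I" by (simp add: lsV)
  finally have "?I = (\<integral>x. ?V x * lattice_char m x \<partial>lborel)" ..
  also have "\<dots> = (\<integral>x. ?V (x + h) * lattice_char m (x + h) \<partial>lborel)"
    by (rule integral_lborel_translate(2)[symmetric]) simp
  also have "\<dots> = - ?I" by (simp add: lattice_char_add mh)
  finally show ?thesis using False by simp
qed

inductive trig_poly :: "(real^'k::finite \<Rightarrow> complex) \<Rightarrow> bool" where
  char: "m \<in> int_lattice \<Longrightarrow> trig_poly (lattice_char m)"
| combination: "\<lbrakk>trig_poly f; trig_poly g\<rbrakk> \<Longrightarrow> trig_poly (\<lambda>x. a * f x + b * g x)"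

lemma trig_poly_char_mult:
  assumes "trig_poly g" "m \<in> int_lattice"
  shows "trig_poly (\<lambda>x. lattice_char m x * g x)"
  using assms(1)
proof induction
  case (char n)
  have "(\<lambda>x. lattice_char m x * lattice_char n x) = lattice_char (m + n)"
    by (rule ext) (rule lattice_char_mult)
  thus ?case using trig_poly.char[OF int_lattice_add[OF assms(2) char]] by (simp only:)
next
  case (combination f g a b)
  have "(\<lambda>x. lattice_char m x * (a * f x + b * g x)) = (\<lambda>x. a * (lattice_char m x * f x) + b * (lattice_char m x * g x))"
    by (simp add: algebra_simps)
  thus ?case using trig_poly.combination[OF combination.IH, of a b] by (simp only:)
qed

lemma trig_poly_mult:
  assumes "trig_poly f" "trig_poly g"
  shows "trig_poly (\<lambda>x. f x * g x)"
  using assms(1)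
proof induction
  case (char m)
  show ?case by (rule trig_poly_char_mult[OF assms(2) char])
next
  case (combination f h a b)
  have "(\<lambda>x. (a * f x + b * h x) * g x) = (\<lambda>x. a * (f x * g x) + b * (h x * g x))"
    by (simp add: algebra_simps)
  thus ?case using trig_poly.combination[OF combination.IH, of a b] by (simp only:)
qed

lemma trig_poly_const: "trig_poly (\<lambda>_ :: real^'k::finite. c)"
proof -
  have "trig_poly (\<lambda>x :: real^'k. c * lattice_char 0 x + 0 * lattice_char 0 x)"
    by (intro trig_poly.intros int_lattice_zero)
  thus ?thesis by (simp add: lattice_char_def)
qed

lemma trig_poly_measurable_bounded:
  assumes "trig_poly f"
  shows "f \<in> borel_measurable borel \<and> (\<exists>B. \<forall>x. cmod (f x) \<le> B)"
  using assms
proof induction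
  case (char m)
  show ?case by (auto intro!: exI[of _ 1])
next
  case (combination f g a b)
  then obtain A B where AB: "\<And>x. cmod (f x) \<le> A" "\<And>x. cmod (g x) \<le> B" by auto
  have "cmod (a * f x + b * g x) \<le> cmod a * A + cmod b * B" for x
    by (rule norm_triangle_le) (simp only: norm_mult, intro add_mono mult_left_mono AB norm_ge_zero)
  thus ?case using combination.IH by (intro conjI borel_measurable_add borel_measurable_times exI allI) auto
qed

lemma cis_2pi_eq_iff: "cis (2 * pi * a) = cis (2 * pi * b) \<longleftrightarrow> a - b \<in> \<int>"
proof
  assume "a - b \<in> \<int>"
  hence "cis (2 * pi * (a - b)) = 1" by simp
  hence "cis (2 * pi * (a - b)) * cis (2 * pi * b) = cis (2 * pi * b)" by simp
  thus "cis (2 * pi * a) = cis (2 * pi * b)" by (simp add: cis_mult algebra_simps)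
next
  assume "cis (2 * pi * a) = cis (2 * pi * b)"
  hence "cis (2 * pi * a) * cis (- (2 * pi * b)) = cis (2 * pi * b) * cis (- (2 * pi * b))" by simp
  hence "cis (2 * pi * a + - (2 * pi * b)) = 1" by (simp add: cis_mult)
  hence "cos (2 * pi * a + - (2 * pi * b)) = 1" by (simp add: complex_eq_iff)
  then obtain n :: int where "2 * pi * a + - (2 * pi * b) = n * 2 * pi"
    by (auto simp: cos_one_2pi_int)
  hence "(2 * pi) * (a - b) = (2 * pi) * n" by (simp add: algebra_simps)
  hence "a - b = n" by simp
  thus "a - b \<in> \<int>" by simp
qed

text \<open>The map \<open>p\<close> wraps \<open>\<real>\<^sup>k\<close> around the torus of vectors with unimodular entries, and \<open>g\<close> descends to a
function \<open>G\<close> on the torus. As \<open>p\<close> maps the compact unit cube onto the torus, closed sets of cube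
points have closed images, which makes \<open>G\<close> continuous. Stone--Weierstrass applies to the real
functions on the torus that pull back to trigonometric polynomials: the real and imaginary parts
of the entries are among them and separate points.\<close>

lemma trig_poly_dense:
  fixes g :: "real^'k::finite \<Rightarrow> complex"
  assumes cont: "continuous_on UNIV g"
    and periodic: "\<And>x \<kappa>. \<kappa> \<in> int_lattice \<Longrightarrow> g (x + \<kappa>) = g x"
    and e: "e > 0"
  shows "\<exists>f. trig_poly f \<and> (\<forall>x. cmod (f x - g x) < e)"
proof -
  define p :: "real^'k \<Rightarrow> complex^'k" where "p = (\<lambda>x. \<chi> i. cis (2 * pi * x $ i))"
  define S where "S = range p"
  have p_eq_iff: "p x = p y \<longleftrightarrow> x - y \<in> int_lattice" for x y
    by (simp add: p_def vec_eq_iff cis_2pi_eq_iff int_lattice_def)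
  have p_cont: "continuous_on A p" for A
    unfolding p_def by (intro continuous_on_vec_lambda continuous_intros)
  have S_eq: "S = p ` cbox 0 1"
  proof -
    have "p x \<in> p ` cbox 0 1" for x
    proof -
      obtain \<kappa> where k: "\<kappa> \<in> int_lattice" "\<And>\<mu>. \<mu> \<in> int_lattice \<Longrightarrow> x - \<mu> \<in> unit_cell \<longleftrightarrow> \<mu> = \<kappa>"
        using unit_cell_tiles[of x] by blast
      have "x - \<kappa> \<in> unit_cell" using k by blast
      hence "x - \<kappa> \<in> cbox 0 1" by (auto simp: unit_cell_def mem_box_cart less_imp_le)
      moreover have "p x = p (x - \<kappa>)" using k(1) by (simp add: p_eq_iff)
      ultimately show ?thesis by (rule image_eqI[rotated])
    qed
    thus ?thesis unfolding S_def by auto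
  qed
  have S_compact: "compact S"
    unfolding S_eq by (intro compact_continuous_image p_cont compact_cbox)
  define G where "G = (\<lambda>w. g (SOME x. p x = w))"
  have G: "G (p x) = g x" for x
  proof -
    have "p (SOME y. p y = p x) = p x" by (rule someI) (rule refl)
    hence "(SOME y. p y = p x) - x \<in> int_lattice" by (simp add: p_eq_iff)
    from periodic[OF this, of x] show ?thesis by (simp add: G_def)
  qed
  have G_cont: "continuous_on S G"
    unfolding continuous_on_closed_vimage[OF compact_imp_closed[OF S_compact]]
  proof (intro allI impI)
    fix B :: "complex set" assume "closed B"
    hence "closed (g -` B)" using continuous_on_closed_vimage[of UNIV g] cont by simp
    hence "compact (cbox 0 1 \<inter> g -` B)" by (intro compact_Int_closed compact_cbox)
    hence "closed (p ` (cbox 0 1 \<inter> g -` B))"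
      by (intro compact_imp_closed compact_continuous_image p_cont)
    moreover have "p ` (cbox 0 1 \<inter> g -` B) = G -` B \<inter> S"
      unfolding S_eq by (auto simp: G)
    ultimately show "closed (G -` B \<inter> S)" by simp
  qed
  define R where "R = (\<lambda>F :: complex^'k \<Rightarrow> real. continuous_on S F \<and> trig_poly (\<lambda>x. complex_of_real (F (p x))))"
  have R_re: "R (\<lambda>w. Re (w $ i))" and R_im: "R (\<lambda>w. Im (w $ i))" for i
  proof -
    have char: "lattice_char (axis i 1) x = p x $ i" "lattice_char (- axis i 1) x = cnj (p x $ i)" for x :: "real^'k"
      by (simp_all add: lattice_char_def p_def inner_axis' cis_cnj)
    have tp: "trig_poly (lattice_char (axis i 1))" "trig_poly (lattice_char (- axis i 1))"
      by (intro trig_poly.char int_lattice_axis int_lattice_minus)+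
    have "complex_of_real (Re (p x $ i)) = 1 / 2 * lattice_char (axis i 1) x + 1 / 2 * lattice_char (- axis i 1) x" for x
      unfolding char by (simp add: complex_eq_iff)
    thus "R (\<lambda>w. Re (w $ i))"
      using trig_poly.combination[OF tp, of "1 / 2" "1 / 2"] unfolding R_def
      by (auto intro!: continuous_intros)
    have "complex_of_real (Im (p x $ i)) = - \<i> / 2 * lattice_char (axis i 1) x + \<i> / 2 * lattice_char (- axis i 1) x" for x
      unfolding char by (simp add: complex_eq_iff)
    thus "R (\<lambda>w. Im (w $ i))"
      using trig_poly.combination[OF tp, of "- \<i> / 2" "\<i> / 2"] unfolding R_def
      by (auto intro!: continuous_intros)
  qed
  have approx: "\<exists>F. R F \<and> (\<forall>w\<in>S. \<bar>H w - F w\<bar> < e / 2)" if H: "continuous_on S H" for H :: "complex^'k \<Rightarrow> real"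
  proof (rule Stone_Weierstrass_HOL[OF S_compact _ _ _ _ _ H])
    show "R (\<lambda>x. c)" for c unfolding R_def by (auto intro: trig_poly_const)
    show "continuous_on S F" if "R F" for F using that by (simp add: R_def)
    show "R (\<lambda>x. F1 x + F2 x)" if "R F1 \<and> R F2" for F1 F2
      using that trig_poly.combination[of "\<lambda>x. complex_of_real (F1 (p x))" "\<lambda>x. complex_of_real (F2 (p x))" 1 1]
      by (simp add: R_def continuous_on_add)
    show "R (\<lambda>x. F1 x * F2 x)" if "R F1 \<and> R F2" for F1 F2
      using that trig_poly_mult[of "\<lambda>x. complex_of_real (F1 (p x))" "\<lambda>x. complex_of_real (F2 (p x))"]
      by (simp add: R_def continuous_on_mult)
    show "\<exists>f. R f \<and> f w \<noteq> f w'" if w: "w \<in> S \<and> w' \<in> S \<and> w \<noteq> w'" for w w'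
    proof -
      obtain i where "w $ i \<noteq> w' $ i" using w by (metis vec_eq_iff)
      hence "Re (w $ i) \<noteq> Re (w' $ i) \<or> Im (w $ i) \<noteq> Im (w' $ i)" by (simp add: complex_eq_iff)
      thus ?thesis
      proof
        assume "Re (w $ i) \<noteq> Re (w' $ i)"
        thus ?thesis by (intro exI[of _ "\<lambda>w. Re (w $ i)"] conjI R_re)
      next
        assume "Im (w $ i) \<noteq> Im (w' $ i)"
        thus ?thesis by (intro exI[of _ "\<lambda>w. Im (w $ i)"] conjI R_im)
      qed
    qed
  qed (use e in simp)
  obtain F1 where F1: "R F1" "\<And>w. w \<in> S \<Longrightarrow> \<bar>Re (G w) - F1 w\<bar> < e / 2"
    using approx[of "\<lambda>w. Re (G w)"] G_cont by (auto intro: continuous_intros)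
  obtain F2 where F2: "R F2" "\<And>w. w \<in> S \<Longrightarrow> \<bar>Im (G w) - F2 w\<bar> < e / 2"
    using approx[of "\<lambda>w. Im (G w)"] G_cont by (auto intro: continuous_intros)
  define f where "f = (\<lambda>x. 1 * complex_of_real (F1 (p x)) + \<i> * complex_of_real (F2 (p x)))"
  have "trig_poly f"
    unfolding f_def by (rule trig_poly.combination) (use F1(1) F2(1) in \<open>simp_all add: R_def\<close>)
  moreover have "cmod (f x - g x) < e" for x
  proof -
    have "cmod (f x - g x) \<le> \<bar>Re (f x - g x)\<bar> + \<bar>Im (f x - g x)\<bar>" by (rule cmod_le)
    also have "\<dots> < e / 2 + e / 2"
      using F1(2)[of "p x"] F2(2)[of "p x"]
      by (intro add_strict_mono) (simp_all add: f_def S_def G abs_minus_commute)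
    finally show ?thesis by simp
  qed
  ultimately show ?thesis by blast
qed

section \<open>Pairing a periodization with a test function\<close>

definition cell_coeff :: "(real^'k::finite \<Rightarrow> complex) \<Rightarrow> real^'k \<Rightarrow> complex" where
  "cell_coeff g \<kappa> = (\<integral>x. indicator unit_cell x * (lattice_char \<kappa> x * g x) \<partial>lborel)"

lemma cell_integrable:
  fixes g :: "real^'k::finite \<Rightarrow> complex"
  assumes [measurable]: "g \<in> borel_measurable borel" and "\<And>x. cmod (g x) \<le> C"
  shows "integrable lborel (\<lambda>x. indicator unit_cell x * (lattice_char \<kappa> x * g x))"
    and "cmod (cell_coeff g \<kappa>) \<le> C"
proof -
  have *: "integrable lborel (\<lambda>x::real^'k. C * indicator unit_cell x)"
    by (intro integrable_mult_right integrable_real_indicator) (simp_all add: emeasure_unit_cell)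
  have le: "cmod (indicator unit_cell x * (lattice_char \<kappa> x * g x)) \<le> C * indicator unit_cell x" for x
    using assms(2)[of x] by (simp add: norm_mult indicator_def)
  show int: "integrable lborel (\<lambda>x. indicator unit_cell x * (lattice_char \<kappa> x * g x))"
    using * by (rule Bochner_Integration.integrable_bound) (auto intro!: AE_I2 order_trans[OF le])
  have "cmod (cell_coeff g \<kappa>) \<le> (\<integral>x. C * indicator unit_cell x \<partial>(lborel :: (real^'k) measure))"
    unfolding cell_coeff_def by (rule Bochner_Integration.integral_norm_bound_integral[OF int * le])
  also have "\<dots> = C" by (simp add: measure_def emeasure_unit_cell)
  finally show "cmod (cell_coeff g \<kappa>) \<le> C" .
qed

text \<open>The difference \<open>E\<close> of the two sides is linear in \<open>g\<close> and bounded by a constant \<open>K\<close> times the supremum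
of \<open>|g|\<close>. It vanishes on characters by orthogonality, hence on trigonometric polynomials, and
therefore on their uniform limits.\<close>

lemma periodic_parseval:
  fixes Q g :: "real^'k::finite \<Rightarrow> complex"
  assumes Q: "integrable lborel Q"
    and sum: "q \<equiv> (\<lambda>\<kappa>. \<integral>x. Q x * lattice_char (- \<kappa>) x \<partial>lborel)" "(\<lambda>\<kappa>. cmod (q \<kappa>)) summable_on int_lattice"
    and cont: "continuous_on UNIV g"
    and periodic: "\<And>x \<kappa>. \<kappa> \<in> int_lattice \<Longrightarrow> g (x + \<kappa>) = g x"
    and bounded: "\<And>x. cmod (g x) \<le> C"
  shows "(\<integral>x. Q x * g x \<partial>lborel) = (\<Sum>\<^sub>\<infinity>\<kappa>\<in>int_lattice. q \<kappa> * cell_coeff g \<kappa>)"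
proof -
  have [measurable]: "Q \<in> borel_measurable borel" using Q by (auto dest: borel_measurable_integrable)
  have [measurable]: "g \<in> borel_measurable borel" using cont by (rule borel_measurable_continuous_onI)
  define BM where "BM = (\<lambda>(f :: real^'k \<Rightarrow> complex) c. f \<in> borel_measurable borel \<and> (\<forall>x. cmod (f x) \<le> c))"
  define E where "E = (\<lambda>f. (\<integral>x. Q x * f x \<partial>lborel) - (\<Sum>\<^sub>\<infinity>\<kappa>\<in>int_lattice. q \<kappa> * cell_coeff f \<kappa>))"
  define K where "K = (\<integral>x. cmod (Q x) \<partial>lborel) + (\<Sum>\<^sub>\<infinity>\<kappa>\<in>int_lattice. cmod (q \<kappa>))"
  have K0: "K \<ge> 0" unfolding K_def by (intro add_nonneg_nonneg integral_nonneg_AE infsum_nonneg) auto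
  have intQ: "integrable lborel (\<lambda>x. Q x * f x)" if "BM f c" for f c
  proof (rule Bochner_Integration.integrable_bound)
    have [measurable]: "f \<in> borel_measurable borel" using that by (simp add: BM_def)
    show "integrable lborel (\<lambda>x. cmod (Q x) * c)" using Q by simp
    show "AE x in lborel. cmod (Q x * f x) \<le> norm (cmod (Q x) * c)"
    proof (rule AE_I2)
      fix x
      have "cmod (f x) \<le> \<bar>c\<bar>" using that abs_ge_self[of c] order_trans by (auto simp: BM_def)
      thus "cmod (Q x * f x) \<le> norm (cmod (Q x) * c)"
        by (simp add: norm_mult abs_mult mult_left_mono)
    qed
    show "(\<lambda>x. Q x * f x) \<in> borel_measurable lborel" by simp
  qed
  have coeff_le: "cmod (q \<kappa> * cell_coeff f \<kappa>) \<le> cmod (q \<kappa>) * c" if "BM f c" for f c \<kappa>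
    unfolding norm_mult using that cell_integrable(2)[of f c \<kappa>] by (intro mult_left_mono) (auto simp: BM_def)
  have sumf: "(\<lambda>\<kappa>. norm (q \<kappa> * cell_coeff f \<kappa>)) summable_on int_lattice" if "BM f c" for f c
    by (rule summable_on_comparison_test[OF summable_on_cmult_left[OF sum(2), of c]]) (use coeff_le[OF that] in auto)
  have E_comb: "E (\<lambda>x. a * f x + b * h x) = a * E f + b * E h" if "BM f c" "BM h d" for f h a b c d
  proof -
    have "(\<integral>x. Q x * (a * f x + b * h x) \<partial>lborel) = (\<integral>x. a * (Q x * f x) + b * (Q x * h x) \<partial>lborel)"
      by (simp add: algebra_simps)
    also have "\<dots> = a * (\<integral>x. Q x * f x \<partial>lborel) + b * (\<integral>x. Q x * h x \<partial>lborel)"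
      using intQ[OF that(1)] intQ[OF that(2)] by simp
    finally have 1: "(\<integral>x. Q x * (a * f x + b * h x) \<partial>lborel) = a * (\<integral>x. Q x * f x \<partial>lborel) + b * (\<integral>x. Q x * h x \<partial>lborel)" .
    have cc: "cell_coeff (\<lambda>x. a * f x + b * h x) \<kappa> = a * cell_coeff f \<kappa> + b * cell_coeff h \<kappa>" for \<kappa>
    proof -
      have "cell_coeff (\<lambda>x. a * f x + b * h x) \<kappa>
          = (\<integral>x. a * (indicator unit_cell x * (lattice_char \<kappa> x * f x)) + b * (indicator unit_cell x * (lattice_char \<kappa> x * h x)) \<partial>lborel)"
        unfolding cell_coeff_def by (simp add: algebra_simps)
      also have "\<dots> = a * cell_coeff f \<kappa> + b * cell_coeff h \<kappa>"
        unfolding cell_coeff_def using that cell_integrable(1)[of f c \<kappa>] cell_integrable(1)[of h d \<kappa>] by (simp add: BM_def)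
      finally show ?thesis .
    qed
    have s: "(\<lambda>\<kappa>. a * (q \<kappa> * cell_coeff f \<kappa>)) summable_on int_lattice" "(\<lambda>\<kappa>. b * (q \<kappa> * cell_coeff h \<kappa>)) summable_on int_lattice"
      using abs_summable_summable[OF sumf[OF that(1)]] abs_summable_summable[OF sumf[OF that(2)]]
      by (auto intro: summable_on_cmult_right)
    have "(\<Sum>\<^sub>\<infinity>\<kappa>\<in>int_lattice. q \<kappa> * cell_coeff (\<lambda>x. a * f x + b * h x) \<kappa>)
        = (\<Sum>\<^sub>\<infinity>\<kappa>\<in>int_lattice. a * (q \<kappa> * cell_coeff f \<kappa>) + b * (q \<kappa> * cell_coeff h \<kappa>))"
      unfolding cc by (simp add: algebra_simps)
    also have "\<dots> = a * (\<Sum>\<^sub>\<infinity>\<kappa>\<in>int_lattice. q \<kappa> * cell_coeff f \<kappa>) + b * (\<Sum>\<^sub>\<infinity>\<kappa>\<in>int_lattice. q \<kappa> * cell_coeff h \<kappa>)"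
      by (subst infsum_add[OF s]) (simp add: infsum_cmult_right')
    finally show ?thesis unfolding E_def 1 by (simp add: algebra_simps)
  qed
  have E_le: "cmod (E f) \<le> c * K" if "BM f c" for f c
  proof -
    have "cmod (\<integral>x. Q x * f x \<partial>lborel) \<le> (\<integral>x. cmod (Q x) * c \<partial>lborel)"
      using that Q by (intro Bochner_Integration.integral_norm_bound_integral intQ[OF that])
        (auto simp: BM_def norm_mult intro!: mult_left_mono)
    moreover have "cmod (\<Sum>\<^sub>\<infinity>\<kappa>\<in>int_lattice. q \<kappa> * cell_coeff f \<kappa>) \<le> (\<Sum>\<^sub>\<infinity>\<kappa>\<in>int_lattice. cmod (q \<kappa>) * c)"
      by (rule order_trans[OF norm_infsum_bound[OF sumf[OF that]]])
         (intro infsum_mono sumf[OF that] summable_on_cmult_left sum(2) coeff_le[OF that])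
    ultimately have "cmod (E f) \<le> (\<integral>x. cmod (Q x) * c \<partial>lborel) + (\<Sum>\<^sub>\<infinity>\<kappa>\<in>int_lattice. cmod (q \<kappa>) * c)"
      unfolding E_def by (intro norm_triangle_le_diff add_mono)
    thus ?thesis
      by (simp only: K_def integral_mult_left_zero infsum_cmult_left' distrib_left mult.commute[of c])
  qed
  have E_char: "E (lattice_char m) = 0" if m: "m \<in> int_lattice" for m
  proof -
    have cc: "cell_coeff (lattice_char m) \<kappa> = (if \<kappa> = - m then 1 else 0)" if "\<kappa> \<in> int_lattice" for \<kappa>
    proof -
      have "cell_coeff (lattice_char m) \<kappa> = (\<integral>x. indicator unit_cell x * lattice_char (\<kappa> + m) x \<partial>lborel)"
        unfolding cell_coeff_def lattice_char_mult ..
      also have "\<dots> = (if \<kappa> + m = 0 then 1 else 0)"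
        by (rule integral_unit_cell_char[OF int_lattice_add[OF that m]])
      finally show ?thesis by (simp add: eq_neg_iff_add_eq_0)
    qed
    have "(\<Sum>\<^sub>\<infinity>\<kappa>\<in>int_lattice. q \<kappa> * cell_coeff (lattice_char m) \<kappa>) = (\<Sum>\<^sub>\<infinity>\<kappa>\<in>{- m}. q \<kappa> * cell_coeff (lattice_char m) \<kappa>)"
      by (rule infsum_cong_neutral) (use cc int_lattice_minus[OF m] in auto)
    also have "\<dots> = q (- m)" using cc[OF int_lattice_minus[OF m]] by simp
    finally show ?thesis by (simp add: E_def sum(1))
  qed
  have E_trig: "E f = 0" if "trig_poly f" for f
    using that
  proof induction
    case (char m)
    thus ?case by (rule E_char)
  next
    case (combination f h a b)
    obtain c d where "BM f c" "BM h d"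
      using trig_poly_measurable_bounded[OF combination.hyps(1)] trig_poly_measurable_bounded[OF combination.hyps(2)]
      by (auto simp: BM_def)
    from E_comb[OF this] show ?case by (simp add: combination.IH)
  qed
  have E_small: "cmod (E g) \<le> e * K" if e: "e > 0" for e
  proof -
    obtain f where f: "trig_poly f" "\<And>x. cmod (f x - g x) < e"
      using trig_poly_dense[OF cont periodic e] by blast
    obtain c where c: "BM f c"
      using trig_poly_measurable_bounded[OF f(1)] by (auto simp: BM_def)
    have g: "BM g C" using bounded by (simp add: BM_def)
    have "BM (\<lambda>x. 1 * f x + (- 1) * g x) e"
      using f(2) c by (auto simp: BM_def less_imp_le)
    hence "cmod (E (\<lambda>x. 1 * f x + (- 1) * g x)) \<le> e * K" by (rule E_le)
    thus ?thesis unfolding E_comb[OF c g] using E_trig[OF f(1)] by simp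
  qed
  have "cmod (E g) \<le> 0 + e" if "e > 0" for e
  proof -
    have "cmod (E g) \<le> e / (K + 1) * K" by (rule E_small) (use that K0 in simp)
    also have "\<dots> \<le> e" using that K0 by (simp add: field_simps)
    finally show ?thesis by simp
  qed
  hence "cmod (E g) \<le> 0" by (rule field_le_epsilon)
  thus ?thesis by (simp add: E_def)
qed

text \<open>A Poisson summation formula: the series converges absolutely because the Fourier coefficients of
\<open>Q\<close> are summable and those of \<open>V\<close> are bounded. The mean over the unit cell unfolds to an integral of
\<open>V\<close> over the whole space.\<close>

lemma integral_lattice_sum:
  fixes Q V :: "real^'k::finite \<Rightarrow> complex"
  assumes Q: "integrable lborel Q"
    and sum: "q \<equiv> (\<lambda>\<kappa>. \<integral>x. Q x * lattice_char (- \<kappa>) x \<partial>lborel)" "(\<lambda>\<kappa>. cmod (q \<kappa>)) summable_on int_lattice"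
    and M: "M \<ge> 2 * CARD('k)" and cont: "continuous_on UNIV V"
    and V: "\<And>x. cmod (V x) \<le> B / (1 + norm x) ^ M"
  shows "(\<integral>x. V x * lattice_sum Q x \<partial>lborel) = (\<Sum>\<^sub>\<infinity>\<kappa>\<in>int_lattice. q \<kappa> * (\<integral>x. V x * lattice_char \<kappa> x \<partial>lborel))"
proof -
  obtain C' where C': "\<And>x. (\<integral>\<^sup>+\<kappa>. ennreal (cmod (V (x - \<kappa>))) \<partial>count_space int_lattice) \<le> ennreal C'"
    using lattice_sum_decaying(1)[OF M cont V] by blast
  define C where "C = max C' 0"
  have C: "(\<integral>\<^sup>+\<kappa>. ennreal (cmod (V (x - \<kappa>))) \<partial>count_space int_lattice) \<le> ennreal C" for x
    by (rule order_trans[OF C' ennreal_leI]) (simp add: C_def)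
  have [measurable]: "V \<in> borel_measurable borel" using cont by (rule borel_measurable_continuous_onI)
  have bounded: "cmod (lattice_sum V x) \<le> C" for x
  proof -
    have "ennreal (cmod (lattice_sum V x)) \<le> (\<integral>\<^sup>+\<kappa>. ennreal (cmod (V (x - \<kappa>))) \<partial>count_space int_lattice)"
      unfolding lattice_sum_altdef
    proof (rule integral_norm_bound_ennreal)
      show "integrable (count_space int_lattice) (\<lambda>\<kappa>. V (x - \<kappa>))"
        unfolding integrable_iff_bounded using le_less_trans[OF C[of x]] by simp
    qed
    also note C[of x]
    finally show ?thesis by (simp add: ennreal_le_iff C_def)
  qed
  have "(\<integral>x. V x * lattice_sum Q x \<partial>lborel) = (\<integral>x. Q x * lattice_sum V x \<partial>lborel)"
    by (rule integral_lattice_sum_swap[OF Q _ C]) simp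
  also have "\<dots> = (\<Sum>\<^sub>\<infinity>\<kappa>\<in>int_lattice. q \<kappa> * cell_coeff (lattice_sum V) \<kappa>)"
    by (rule periodic_parseval[OF Q sum lattice_sum_decaying(2)[OF M cont V] lattice_sum_periodic bounded])
  also have "\<dots> = (\<Sum>\<^sub>\<infinity>\<kappa>\<in>int_lattice. q \<kappa> * (\<integral>x. V x * lattice_char \<kappa> x \<partial>lborel))"
  proof (rule infsum_cong)
    fix \<kappa> :: "real^'k" assume k: "\<kappa> \<in> int_lattice"
    have "(\<integral>x. V x * lattice_char \<kappa> x \<partial>lborel) = (\<integral>x. indicator unit_cell x * lattice_char \<kappa> x * lattice_sum V x \<partial>lborel)"
      by (rule integral_periodic_unfold[where C = 1 and B = C]) (simp_all add: C lattice_char_periodic[OF k])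
    thus "q \<kappa> * cell_coeff (lattice_sum V) \<kappa> = q \<kappa> * (\<integral>x. V x * lattice_char \<kappa> x \<partial>lborel)"
      by (simp add: cell_coeff_def mult.assoc)
  qed
  finally show ?thesis .
qed

text \<open>Replacing \<open>q\<close> by an almost everywhere equal Borel function changes its lattice translates on a
countable union of null sets only, so the periodization may be computed from the Borel version.\<close>

lemma lebesgue_integrable_borel_version:
  fixes q :: "'a::euclidean_space \<Rightarrow> complex"
  assumes q: "integrable lebesgue q"
  obtains q0 where "q0 \<in> borel_measurable borel" "AE x in lborel. q x = q0 x" "integrable lborel q0"
proof -
  have [measurable]: "q \<in> borel_measurable lebesgue" using q by (auto dest: borel_measurable_integrable)
  obtain a where a: "a \<in> borel_measurable lborel" "AE x in lborel. Re (q x) = a x"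
    using completion_ex_borel_measurable_real[of "\<lambda>x. Re (q x)" lborel] by auto
  obtain b where b: "b \<in> borel_measurable lborel" "AE x in lborel. Im (q x) = b x"
    using completion_ex_borel_measurable_real[of "\<lambda>x. Im (q x)" lborel] by auto
  define q0 where "q0 = (\<lambda>x. Complex (a x) (b x))"
  have [measurable]: "a \<in> borel_measurable borel" "b \<in> borel_measurable borel" using a b by simp_all
  have q0: "q0 \<in> borel_measurable borel" unfolding q0_def Complex_eq by measurable
  have ae: "AE x in lborel. q x = q0 x"
    using a(2) b(2) by eventually_elim (simp add: q0_def complex_eq_iff)
  have "integrable lebesgue q0"
    using q AE_completion[OF ae] q0 by (subst integrable_cong_AE[of q0 lebesgue q]) (auto intro: measurable_completion elim: eventually_mono)
  hence "integrable lborel q0" using q0 integrable_completion[of q0 lborel] by simp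
  with that q0 ae show ?thesis by blast
qed

lemma integral_lebesgue_cong_borel:
  fixes f g :: "'a::euclidean_space \<Rightarrow> complex"
  assumes [measurable]: "g \<in> borel_measurable borel" and ae: "AE x in lborel. f x = g x"
  shows "(\<integral>x. f x \<partial>lebesgue) = (\<integral>x. g x \<partial>lborel)"
proof -
  have g: "g \<in> borel_measurable lebesgue" using assms(1) by (simp add: measurable_completion)
  have f: "f \<in> borel_measurable lebesgue"
  proof (rule measurableI)
    fix A :: "complex set" assume A: "A \<in> sets borel"
    have "AE x in lebesgue. x \<in> g -` A \<inter> space lebesgue \<longleftrightarrow> x \<in> f -` A \<inter> space lebesgue"
      using AE_completion[OF ae] by eventually_elim simp
    thus "f -` A \<inter> space lebesgue \<in> sets lebesgue"
      by (rule completion.in_sets_AE) (use measurable_sets[OF g A] in auto)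
  qed simp
  have "(\<integral>x. f x \<partial>lebesgue) = (\<integral>x. g x \<partial>lebesgue)"
    by (rule integral_cong_AE[OF f g AE_completion[OF ae]])
  also have "\<dots> = (\<integral>x. g x \<partial>lborel)" by (rule integral_completion) simp
  finally show ?thesis .
qed

lemma matrix_inv_inverse:
  assumes "invertible A"
  shows "A ** matrix_inv A = mat 1" "matrix_inv A ** A = mat 1"
  using someI_ex[OF assms[unfolded invertible_def]] by (auto simp: matrix_inv_def)

lemma inner_matrix_inv:
  assumes "invertible L"
  shows "(inv_transpose L *v \<kappa>) \<bullet> (L *v x) = \<kappa> \<bullet> x"
proof -
  have "(inv_transpose L *v \<kappa>) \<bullet> (L *v x) = \<kappa> \<bullet> (matrix_inv L *v (L *v x))"
    by (simp add: inv_transpose_def dot_lmul_matrix)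
  thus ?thesis using assms by (simp add: matrix_vector_mul_assoc matrix_inv_inverse)
qed

text \<open>The substitution \<open>z = L x\<close> turns the lattice \<open>L\<int>\<^sup>k\<close> into \<open>\<int>\<^sup>k\<close> and the character with frequency
\<open>L\<^sup>-\<^sup>T\<kappa>\<close> into that with frequency \<open>\<kappa>\<close>. Three factors \<open>|det L|\<close> appear, one from the pairing and an
inverse one from each of the two Fourier integrals, leaving the division by \<open>|det L|\<close>.\<close>

lemma integral_periodization:
  fixes L :: "real^'k^'k::finite" and q W :: "real^'k \<Rightarrow> complex"
  assumes L: "invertible L" and q: "integrable lebesgue q"
    and sum: "(\<lambda>\<kappa>. cmod (fourier q (inv_transpose L *v \<kappa>))) summable_on int_lattice"
    and W: "W \<in> schwartz"
  shows "(\<integral>z. periodization L q z * W z \<partial>lebesgue)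
    = (\<Sum>\<^sub>\<infinity>\<kappa>\<in>int_lattice. fourier q (inv_transpose L *v \<kappa>) / complex_of_real \<bar>det L\<bar>
          * (\<integral>z. cis (2 * pi * ((inv_transpose L *v \<kappa>) \<bullet> z)) * W z \<partial>lborel))"
proof -
  define \<zeta> where "\<zeta> = (\<lambda>\<kappa>. inv_transpose L *v \<kappa>)"
  have det: "det L \<noteq> 0" using L by (simp add: invertible_det_nz)
  obtain q0 where [measurable]: "q0 \<in> borel_measurable borel" and q0: "AE x in lborel. q x = q0 x" "integrable lborel q0"
    by (rule lebesgue_integrable_borel_version[OF q])
  note [measurable] = schwartz_measurable[OF W]
  define Q where "Q = (\<lambda>x. q0 (L *v x))"
  define V where "V = (\<lambda>x. W (L *v x))"
  have Q_int: "integrable lborel Q"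
    unfolding Q_def using integral_lborel_linear(1)[OF det, of q0] q0(2) by simp
  have fourier_q: "fourier q \<theta> = (\<integral>z. q0 z * cis (2 * pi * (- \<theta> \<bullet> z)) \<partial>lborel)" for \<theta>
    unfolding fourier_def by (rule integral_lebesgue_cong_borel) (use q0(1) in \<open>auto elim: eventually_mono\<close>)
  have Q_coeff: "(\<integral>x. Q x * lattice_char (- \<kappa>) x \<partial>lborel) = fourier q (\<zeta> \<kappa>) / complex_of_real \<bar>det L\<bar>" for \<kappa>
  proof -
    have "fourier q (\<zeta> \<kappa>) = complex_of_real \<bar>det L\<bar> * (\<integral>x. q0 (L *v x) * cis (2 * pi * (- \<zeta> \<kappa> \<bullet> (L *v x))) \<partial>lborel)"
      unfolding fourier_q by (rule integral_lborel_linear(2)[OF det]) simp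
    also have "(\<lambda>x. q0 (L *v x) * cis (2 * pi * (- \<zeta> \<kappa> \<bullet> (L *v x)))) = (\<lambda>x. Q x * lattice_char (- \<kappa>) x)"
      by (simp add: Q_def lattice_char_def \<zeta>_def inner_matrix_inv[OF L])
    finally show ?thesis using det by simp
  qed
  have sum': "(\<lambda>\<kappa>. cmod (\<integral>x. Q x * lattice_char (- \<kappa>) x \<partial>lborel)) summable_on int_lattice"
    unfolding Q_coeff norm_divide using summable_on_cmult_left[OF sum, of "1 / \<bar>det L\<bar>"] by (simp add: \<zeta>_def)
  have V_char: "(\<integral>x. V x * lattice_char \<kappa> x \<partial>lborel) = (\<integral>z. cis (2 * pi * (\<zeta> \<kappa> \<bullet> z)) * W z \<partial>lborel) / complex_of_real \<bar>det L\<bar>" for \<kappa>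
  proof -
    have "(\<integral>z. cis (2 * pi * (\<zeta> \<kappa> \<bullet> z)) * W z \<partial>lborel) = complex_of_real \<bar>det L\<bar> * (\<integral>x. cis (2 * pi * (\<zeta> \<kappa> \<bullet> (L *v x))) * W (L *v x) \<partial>lborel)"
      by (rule integral_lborel_linear(2)[OF det]) simp
    also have "(\<lambda>x. cis (2 * pi * (\<zeta> \<kappa> \<bullet> (L *v x))) * W (L *v x)) = (\<lambda>x. V x * lattice_char \<kappa> x)"
      by (simp add: V_def lattice_char_def \<zeta>_def inner_matrix_inv[OF L] mult.commute)
    finally show ?thesis using det by simp
  qed
  have V_cont: "continuous_on UNIV V"
    unfolding V_def
    by (rule continuous_on_compose2[OF schwartz_continuous_on[OF W, of UNIV]])
       (auto intro: linear_continuous_on matrix_vector_mul_bounded_linear)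
  have "\<exists>B. \<forall>x. cmod (V x) \<le> B / (1 + norm x) ^ (2 * CARD('k))"
  proof -
    let ?M = "2 * CARD('k)"
    obtain B where B: "B \<ge> 0" "\<And>x. cmod (W x) \<le> B / (1 + norm x) ^ ?M"
      using schwartz_decay_divide[OF W] by blast
    obtain K where K: "K > 0" "\<And>y. norm (matrix_inv L *v y) \<le> norm y * K"
      using bounded_linear.pos_bounded[OF matrix_vector_mul_bounded_linear[of "matrix_inv L"]] by blast
    have "cmod (V x) \<le> B * (1 + K) ^ ?M / (1 + norm x) ^ ?M" for x
    proof -
      have pos: "(1 + norm y) ^ ?M > 0" for y :: "real^'k" by (rule one_plus_norm_power_pos)
      have "norm x \<le> norm (L *v x) * K"
        using K(2)[of "L *v x"] L by (simp add: matrix_vector_mul_assoc matrix_inv_inverse)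
      also have "\<dots> \<le> norm (L *v x) * K + norm (L *v x) + K" using K(1) by simp
      finally have "1 + norm x \<le> (1 + K) * (1 + norm (L *v x))" by (simp add: algebra_simps)
      hence "(1 + norm x) ^ ?M \<le> (1 + K) ^ ?M * (1 + norm (L *v x)) ^ ?M"
        unfolding power_mult_distrib[symmetric] by (intro power_mono) auto
      hence "B * (1 + norm x) ^ ?M \<le> B * ((1 + K) ^ ?M * (1 + norm (L *v x)) ^ ?M)"
        using B(1) by (rule mult_left_mono)
      hence "B / (1 + norm (L *v x)) ^ ?M \<le> B * (1 + K) ^ ?M / (1 + norm x) ^ ?M"
        using pos[of x] pos[of "L *v x"] by (simp add: divide_simps mult_ac)
      with B(2)[of "L *v x"] show ?thesis unfolding V_def by linarith
    qed
    thus ?thesis by blast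
  qed
  then obtain B where V_bound: "\<And>x. cmod (V x) \<le> B / (1 + norm x) ^ (2 * CARD('k))" by blast
  have meas_ls: "lattice_sum Q \<in> borel_measurable borel"
  proof -
    interpret Z: sigma_finite_measure "count_space (int_lattice :: (real^'k) set)"
      by (rule sigma_finite_measure_count_space_countable) simp
    have "(\<lambda>(\<kappa>, x). Q (x + \<kappa>)) \<in> borel_measurable (count_space int_lattice \<Otimes>\<^sub>M lborel)"
      by (rule lattice_pair_measurable) (simp add: Q_def)
    from measurable_compose[OF measurable_pair_swap' this]
    have "(\<lambda>(x, \<kappa>). Q (x + \<kappa>)) \<in> borel_measurable (lborel \<Otimes>\<^sub>M count_space int_lattice)"
      by (simp add: case_prod_beta')
    from Z.borel_measurable_lebesgue_integral[OF this]
    show ?thesis unfolding lattice_sum_def infsum_eq_count_space(1) by simp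
  qed
  define P where "P = (\<lambda>z. lattice_sum Q (matrix_inv L *v z))"
  have P_L: "P (L *v x) = lattice_sum Q x" for x
    using L by (simp add: P_def matrix_vector_mul_assoc matrix_inv_inverse)
  have [measurable]: "P \<in> borel_measurable borel" unfolding P_def using meas_ls by measurable
  have per_P: "AE z in lborel. periodization L q z = P z"
  proof -
    have "AE z in lborel. q (z + L *v \<kappa>) = q0 (z + L *v \<kappa>)" for \<kappa>
      by (rule AE_lborel_translate[OF q0(1)])
    hence "AE z in lborel. \<forall>\<kappa>\<in>int_lattice. q (z + L *v \<kappa>) = q0 (z + L *v \<kappa>)"
      by (simp add: AE_ball_countable)
    thus ?thesis
    proof eventually_elim
      case (elim z)
      have "L *v (matrix_inv L *v z) = z"
        using L by (simp add: matrix_vector_mul_assoc matrix_inv_inverse)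
      thus ?case using elim
        by (auto simp: periodization_def P_def lattice_sum_def Q_def matrix_vector_right_distrib intro!: infsum_cong)
    qed
  qed
  have "(\<integral>z. periodization L q z * W z \<partial>lebesgue) = (\<integral>z. P z * W z \<partial>lborel)"
    by (rule integral_lebesgue_cong_borel) (use per_P in \<open>auto elim: eventually_mono\<close>)
  also have "\<dots> = complex_of_real \<bar>det L\<bar> * (\<integral>x. P (L *v x) * W (L *v x) \<partial>lborel)"
    by (rule integral_lborel_linear(2)[OF det]) simp
  also have "(\<integral>x. P (L *v x) * W (L *v x) \<partial>lborel) = (\<integral>x. V x * lattice_sum Q x \<partial>lborel)"
    by (simp add: P_L V_def mult.commute)
  also have "\<dots> = (\<Sum>\<^sub>\<infinity>\<kappa>\<in>int_lattice. (\<integral>x. Q x * lattice_char (- \<kappa>) x \<partial>lborel) * (\<integral>x. V x * lattice_char \<kappa> x \<partial>lborel))"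
    by (rule integral_lattice_sum[OF Q_int _ sum' order_refl V_cont V_bound]) simp
  also have "complex_of_real \<bar>det L\<bar> * \<dots> = (\<Sum>\<^sub>\<infinity>\<kappa>\<in>int_lattice. fourier q (\<zeta> \<kappa>) / complex_of_real \<bar>det L\<bar>
          * (\<integral>z. cis (2 * pi * (\<zeta> \<kappa> \<bullet> z)) * W z \<partial>lborel))"
    unfolding infsum_cmult_right'[symmetric] Q_coeff V_char using det by (intro infsum_cong) simp
  finally show ?thesis unfolding \<zeta>_def .
qed

section \<open>Absolutely convergent series of time-frequency shifts\<close>

context complex_banach_space_on
begin

lemma sum_mem:
  assumes "\<And>k. k \<in> F \<Longrightarrow> t k \<in> X"
  shows "(\<lambda>a. \<Sum>k\<in>F. t k a) \<in> X \<and> N (\<lambda>a. \<Sum>k\<in>F. t k a) \<le> (\<Sum>k\<in>F. N (t k))"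
  using assms
proof (induction F rule: infinite_finite_induct)
  case (insert k F)
  have k: "t k \<in> X" using insert.prems by simp
  have IH: "(\<lambda>a. \<Sum>k\<in>F. t k a) \<in> X" "N (\<lambda>a. \<Sum>k\<in>F. t k a) \<le> (\<Sum>k\<in>F. N (t k))"
    using insert by auto
  show ?case
    using add[OF k IH(1)] norm_add[OF k IH(1)] IH(2) insert.hyps by simp
qed (use zero norm_eq_0[OF zero] in auto)

lemma diff_mem: "u \<in> X \<Longrightarrow> w \<in> X \<Longrightarrow> (\<lambda>a. u a - w a) \<in> X"
  using add[of u "\<lambda>a. (- 1) * w a"] scale[of w "- 1"] by simp

lemma norm_diff_commute:
  assumes "u \<in> X" "w \<in> X"
  shows "N (\<lambda>a. u a - w a) = N (\<lambda>a. w a - u a)"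
  using norm_scale[OF diff_mem[OF assms(2,1)], of "- 1"] by simp

lemma norm_diff_le:
  assumes "u \<in> X" "w \<in> X"
  shows "N (\<lambda>a. u a - w a) \<le> N u + N w"
  using norm_add[OF assms(1) scale[OF assms(2), of "- 1"]] norm_scale[OF assms(2), of "- 1"] by simp

lemma absolutely_convergent_sequence:
  assumes t: "\<And>k::nat. t k \<in> X" and sum: "summable (\<lambda>k. N (t k))"
  shows "\<exists>u\<in>X. (\<lambda>n. N (\<lambda>a. (\<Sum>k<n. t k a) - u a)) \<longlonglongrightarrow> 0 \<and> N u \<le> (\<Sum>k. N (t k))"
proof -
  define U where "U = (\<lambda>n a. \<Sum>k<n. t k a)"
  have U: "U n \<in> X" and U_le: "N (U n) \<le> (\<Sum>k<n. N (t k))" for n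
    using sum_mem[of "{..<n}" t] t by (auto simp: U_def)
  have U_diff: "N (\<lambda>a. U n a - U m a) \<le> (\<Sum>k=m..<n. N (t k))" if "m \<le> n" for m n
  proof -
    have "U n a - U m a = (\<Sum>k=m..<n. t k a)" for a
      using sum_diff_nat_ivl[of 0 m n "\<lambda>k. t k a"] that by (simp add: U_def lessThan_atLeast0)
    thus ?thesis using sum_mem[of "{m..<n}" t] t by simp
  qed
  have cauchy: "\<forall>e>0. \<exists>M. \<forall>m\<ge>M. \<forall>n\<ge>M. N (\<lambda>a. U m a - U n a) < e"
  proof (intro allI impI)
    fix e :: real assume e: "e > 0"
    obtain M where M: "\<And>m n. m \<ge> M \<Longrightarrow> \<bar>\<Sum>k=m..<n. N (t k)\<bar> < e"
      using sum[unfolded summable_Cauchy, rule_format, OF e] by auto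
    have "N (\<lambda>a. U n a - U m a) < e" if "m \<ge> M" "m \<le> n" for m n
      using le_less_trans[OF order_trans[OF U_diff[OF that(2)] abs_ge_self] M[OF that(1)]] .
    thus "\<exists>M. \<forall>m\<ge>M. \<forall>n\<ge>M. N (\<lambda>a. U m a - U n a) < e"
      using norm_diff_commute[OF U U] by (intro exI[of _ M] allI impI) (metis linear)
  qed
  obtain u where u: "u \<in> X" "(\<lambda>n. N (\<lambda>a. U n a - u a)) \<longlonglongrightarrow> 0"
    using complete[OF U cauchy] by blast
  have "N u \<le> (\<Sum>k. N (t k)) + N (\<lambda>a. U n a - u a)" for n
  proof -
    have "N (\<lambda>a. U n a - (U n a - u a)) \<le> N (U n) + N (\<lambda>a. U n a - u a)"
      by (rule norm_diff_le[OF U diff_mem[OF U u(1)]])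
    also have "N (U n) \<le> (\<Sum>k. N (t k))"
      by (rule order_trans[OF U_le sum_le_suminf[OF sum]]) (auto intro: norm_ge_0 t)
    finally show ?thesis by simp
  qed
  hence "N u \<le> (\<Sum>k. N (t k)) + 0"
    by (intro LIMSEQ_le_const[OF tendsto_add[OF tendsto_const u(2)]]) auto
  with u show ?thesis unfolding U_def by auto
qed

end

context tempered_banach_space
begin

lemma vanishes_off_schwartz:
  assumes "u \<in> X" "\<phi> \<notin> schwartz"
  shows "u \<phi> = 0"
proof -
  have "u \<in> tempered" by (rule subsetD[OF subset_tempered assms(1)])
  hence "\<forall>f. f \<notin> schwartz \<longrightarrow> u f = 0" unfolding tempered_def by simp
  thus ?thesis using assms(2) by simp
qed

text \<open>Off the Schwartz space the elements of \<open>X\<close> vanish, so functionals can be compared at every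
function \<open>\<phi>\<close>.\<close>

lemma evaluation_bound:
  shows "\<exists>B\<ge>0. \<forall>u\<in>X. cmod (u \<phi>) \<le> B * N u"
proof (cases "\<phi> \<in> schwartz")
  case True
  then obtain B where B: "\<forall>u\<in>X. cmod (u \<phi>) \<le> B * N u"
    using tempered_continuous by blast
  have "\<forall>u\<in>X. cmod (u \<phi>) \<le> max B 0 * N u"
  proof
    fix u assume u: "u \<in> X"
    have "B * N u \<le> max B 0 * N u" using norm_ge_0[OF u] by (intro mult_right_mono) auto
    with bspec[OF B u] show "cmod (u \<phi>) \<le> max B 0 * N u" by (rule order_trans)
  qed
  thus ?thesis by (intro exI[of _ "max B 0"]) auto
next
  case False
  thus ?thesis by (intro exI[of _ 0]) (auto simp: vanishes_off_schwartz)
qed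

text \<open>Completeness provides the sum in norm. Evaluation at each function is continuous, so that sum is
the pointwise one.\<close>

lemma absolutely_convergent_series:
  assumes I: "countable I" "infinite I" and T: "\<And>i. i \<in> I \<Longrightarrow> T i \<in> X"
    and sum: "(\<lambda>i. N (T i)) summable_on I"
  shows "(\<lambda>\<phi>. \<Sum>\<^sub>\<infinity>i\<in>I. T i \<phi>) \<in> X"
    and "N (\<lambda>\<phi>. \<Sum>\<^sub>\<infinity>i\<in>I. T i \<phi>) \<le> (\<Sum>\<^sub>\<infinity>i\<in>I. N (T i))"
    and "(\<lambda>i. T i \<phi>) summable_on I"
proof -
  have abs: "(\<lambda>i. norm (T i \<phi>)) summable_on I" for \<phi>
  proof -
    obtain B where B: "\<forall>u\<in>X. cmod (u \<phi>) \<le> B * N u" using evaluation_bound by blast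
    show ?thesis
    proof (rule summable_on_comparison_test[OF summable_on_cmult_right[OF sum, of B]])
      show "norm (T i \<phi>) \<le> B * N (T i)" if "i \<in> I" for i
        by (rule bspec[OF B T[OF that]])
    qed simp
  qed
  show "(\<lambda>i. T i \<phi>) summable_on I" for \<phi>
    by (rule abs_summable_summable[OF abs])
  define e where "e = from_nat_into I"
  have e: "bij_betw e UNIV I" unfolding e_def using bij_betw_from_nat_into[OF I] .
  have eI: "e k \<in> I" for k using e by (auto simp: bij_betw_def)
  have sum_e: "(\<lambda>k. N (T (e k))) summable_on UNIV"
    using sum summable_on_reindex_bij_betw[OF e, of "\<lambda>i. N (T i)"] by simp
  have sums_N: "(\<lambda>k. N (T (e k))) sums (\<Sum>\<^sub>\<infinity>i\<in>I. N (T i))"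
    using has_sum_imp_sums[OF has_sum_infsum[OF sum_e]] infsum_reindex_bij_betw[OF e, of "\<lambda>i. N (T i)"] by simp
  have sums_T: "(\<lambda>k. T (e k) \<phi>) sums (\<Sum>\<^sub>\<infinity>i\<in>I. T i \<phi>)" for \<phi>
  proof -
    have "(\<lambda>k. T (e k) \<phi>) summable_on UNIV"
      by (rule iffD2[OF summable_on_reindex_bij_betw[OF e, of "\<lambda>i. T i \<phi>"] abs_summable_summable[OF abs]])
    from has_sum_imp_sums[OF has_sum_infsum[OF this]]
    show ?thesis unfolding infsum_reindex_bij_betw[OF e, of "\<lambda>i. T i \<phi>"] .
  qed
  obtain u where u: "u \<in> X" "(\<lambda>n. N (\<lambda>\<phi>. (\<Sum>k<n. T (e k) \<phi>) - u \<phi>)) \<longlonglongrightarrow> 0" "N u \<le> (\<Sum>k. N (T (e k)))"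
    using absolutely_convergent_sequence[of "\<lambda>k. T (e k)", OF T[OF eI] sums_summable[OF sums_N]]
    by (elim bexE conjE) (rule that)
  have "u \<phi> = (\<Sum>\<^sub>\<infinity>i\<in>I. T i \<phi>)" for \<phi>
  proof -
    obtain B where B: "\<forall>u\<in>X. cmod (u \<phi>) \<le> B * N u" using evaluation_bound by blast
    have "(\<lambda>\<phi>. (\<Sum>k<n. T (e k) \<phi>) - u \<phi>) \<in> X" for n
      by (rule diff_mem[OF sum_mem[THEN conjunct1] u(1)]) (rule T[OF eI])
    from bspec[OF B this]
    have "cmod ((\<Sum>k<n. T (e k) \<phi>) - u \<phi>) \<le> B * N (\<lambda>\<phi>. (\<Sum>k<n. T (e k) \<phi>) - u \<phi>)" for n .
    moreover have "(\<lambda>n. B * N (\<lambda>\<phi>. (\<Sum>k<n. T (e k) \<phi>) - u \<phi>)) \<longlonglongrightarrow> 0"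
      using tendsto_mult_left[OF u(2), of B] by simp
    ultimately have "(\<lambda>n. (\<Sum>k<n. T (e k) \<phi>) - u \<phi>) \<longlonglongrightarrow> 0"
      by (rule Lim_null_comparison[OF always_eventually[OF allI]])
    hence "(\<lambda>k. T (e k) \<phi>) sums u \<phi>"
      unfolding sums_def by (rule LIM_zero_cancel)
    thus ?thesis using sums_T by (rule sums_unique2)
  qed
  hence eq: "u = (\<lambda>\<phi>. \<Sum>\<^sub>\<infinity>i\<in>I. T i \<phi>)" by (rule ext)
  show "(\<lambda>\<phi>. \<Sum>\<^sub>\<infinity>i\<in>I. T i \<phi>) \<in> X" using u(1) unfolding eq .
  show "N (\<lambda>\<phi>. \<Sum>\<^sub>\<infinity>i\<in>I. T i \<phi>) \<le> (\<Sum>\<^sub>\<infinity>i\<in>I. N (T i))"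
    using u(3) unfolding eq sums_unique[OF sums_N, symmetric] .
qed

lemma bounded_linear_operator_diff:
  assumes A: "bounded_linear_operator X N A" and u: "u \<in> X" and w: "w \<in> X"
  shows "A (\<lambda>a. u a - w a) = (\<lambda>a. A u a - A w a)"
proof -
  note A = A[unfolded bounded_linear_operator_def]
  have "A (\<lambda>a. u a + (- 1) * w a) = (\<lambda>a. A u a + A (\<lambda>a. (- 1) * w a) a)"
    by (rule A[THEN conjunct2, THEN conjunct1, rule_format, OF u scale[OF w]])
  also have "A (\<lambda>a. (- 1) * w a) = (\<lambda>a. (- 1) * A w a)"
    by (rule A[THEN conjunct2, THEN conjunct2, THEN conjunct1, rule_format, OF w])
  finally show ?thesis by simp
qed

lemma bounded_extension_unique:
  assumes A: "bounded_extension X N T A" and A': "bounded_extension X N T A'" and u: "u \<in> X"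
  shows "A u = A' u"
proof -
  have lin: "bounded_linear_operator X N A" "bounded_linear_operator X N A'"
    using A A' by (auto simp: bounded_extension_def)
  note lin' = lin[unfolded bounded_linear_operator_def]
  obtain B where B: "\<And>u. u \<in> X \<Longrightarrow> N (A u) \<le> B * N u"
    using lin'(1)[THEN conjunct2, THEN conjunct2, THEN conjunct2] by auto
  obtain B' where B': "\<And>u. u \<in> X \<Longrightarrow> N (A' u) \<le> B' * N u"
    using lin'(2)[THEN conjunct2, THEN conjunct2, THEN conjunct2] by auto
  have mem: "A w \<in> X" "A' w \<in> X" if "w \<in> X" for w
    by (rule lin'(1)[THEN conjunct1, rule_format, OF that], rule lin'(2)[THEN conjunct1, rule_format, OF that])
  let ?D = "\<lambda>a. A u a - A' u a"
  have D: "?D \<in> X" by (intro diff_mem mem u)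
  have "N ?D \<le> 0 + e" if e: "e > 0" for e
  proof -
    define K where "K = \<bar>B\<bar> + \<bar>B'\<bar> + 1"
    have K: "K > 0" unfolding K_def by linarith
    obtain \<phi> where \<phi>: "\<phi> \<in> schwartz" "N (\<lambda>\<psi>. u \<psi> - distr_of \<phi> \<psi>) < e / K"
      using schwartz_dense[OF u, of "e / K"] e K by auto
    let ?r = "\<lambda>\<psi>. u \<psi> - distr_of \<phi> \<psi>"
    have d: "distr_of \<phi> \<in> X" by (rule schwartz_subset[OF \<phi>(1)])
    have r: "?r \<in> X" by (rule diff_mem[OF u d])
    have "A (distr_of \<phi>) = A' (distr_of \<phi>)"
      using A A' \<phi>(1) by (auto simp: bounded_extension_def)
    hence "?D = (\<lambda>a. A ?r a - A' ?r a)"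
      unfolding bounded_linear_operator_diff[OF lin(1) u d] bounded_linear_operator_diff[OF lin(2) u d] by auto
    hence "N ?D \<le> N (A ?r) + N (A' ?r)"
      using norm_diff_le[OF mem[OF r]] by simp
    also have "\<dots> \<le> B * N ?r + B' * N ?r" by (intro add_mono B B' r)
    also have "\<dots> = (B + B') * N ?r" by (simp add: distrib_right)
    also have "\<dots> \<le> K * N ?r"
      using norm_ge_0[OF r] by (intro mult_right_mono) (auto simp: K_def)
    also have "\<dots> \<le> K * (e / K)" using \<phi>(2) K by (intro mult_left_mono) auto
    also have "\<dots> = e" using K by simp
    finally show ?thesis by simp
  qed
  hence "N ?D \<le> 0" by (rule field_le_epsilon)
  with norm_ge_0[OF D] have "N ?D = 0" by simp
  hence D0: "?D = (\<lambda>_. 0)" using norm_eq_0[OF D] by simp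
  show ?thesis
  proof
    show "A u a = A' u a" for a using fun_cong[OF D0, of a] by simp
  qed
qed

end

context tf_invariant_space
begin

text \<open>Defined pointwise and not as a limit in the norm, so that linearity and the values on test
functions can be read off.\<close>

definition shift_series :: "'i set \<Rightarrow> ('i \<Rightarrow> complex) \<Rightarrow> ('i \<Rightarrow> real^('n + 'n)) \<Rightarrow> 'n functional \<Rightarrow> 'n functional" where
  "shift_series I c z u = (\<lambda>\<phi>. \<Sum>\<^sub>\<infinity>i\<in>I. c i * tf_shift (z i) u \<phi>)"

lemma shift_series_bounded:
  assumes I: "countable I" "infinite I"
    and sum: "(\<lambda>i. cmod (c i) * poly_weight s (z i)) summable_on I"
    and u: "u \<in> X"
  shows "shift_series I c z u \<in> X"
    and "N (shift_series I c z u) \<le> C * (\<Sum>\<^sub>\<infinity>i\<in>I. cmod (c i) * poly_weight s (z i)) * N u"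
    and "(\<lambda>i. c i * tf_shift (z i) u \<phi>) summable_on I"
proof -
  let ?T = "\<lambda>i \<phi>. c i * tf_shift (z i) u \<phi>"
  have T: "?T i \<in> X" for i by (intro scale shift_mem u)
  have T_le: "N (?T i) \<le> cmod (c i) * poly_weight s (z i) * (C * N u)" for i
  proof -
    have "N (?T i) = cmod (c i) * N (tf_shift (z i) u)" by (intro norm_scale shift_mem u)
    also have "\<dots> \<le> cmod (c i) * (C * poly_weight s (z i) * N u)"
      by (intro mult_left_mono shift_bound u) simp
    finally show ?thesis by (simp add: mult_ac)
  qed
  have sum': "(\<lambda>i. cmod (c i) * poly_weight s (z i) * (C * N u)) summable_on I"
    by (rule summable_on_cmult_left[OF sum])
  have sumN: "(\<lambda>i. N (?T i)) summable_on I"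
    by (rule summable_on_comparison_test[OF sum']) (auto intro: T_le norm_ge_0 T)
  note * = absolutely_convergent_series[OF I T sumN]
  show "shift_series I c z u \<in> X" unfolding shift_series_def by (rule *(1))
  show "(\<lambda>i. c i * tf_shift (z i) u \<phi>) summable_on I" by (rule *(3))
  have "N (shift_series I c z u) \<le> (\<Sum>\<^sub>\<infinity>i\<in>I. N (?T i))" unfolding shift_series_def by (rule *(2))
  also have "\<dots> \<le> (\<Sum>\<^sub>\<infinity>i\<in>I. cmod (c i) * poly_weight s (z i) * (C * N u))"
    by (intro infsum_mono sumN sum' T_le)
  also have "\<dots> = C * (\<Sum>\<^sub>\<infinity>i\<in>I. cmod (c i) * poly_weight s (z i)) * N u"
    unfolding infsum_cmult_left' by (simp only: mult_ac)
  finally show "N (shift_series I c z u) \<le> C * (\<Sum>\<^sub>\<infinity>i\<in>I. cmod (c i) * poly_weight s (z i)) * N u" .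
qed

lemma shift_series_bounded_linear_operator:
  assumes I: "countable I" "infinite I"
    and sum: "(\<lambda>i. cmod (c i) * poly_weight s (z i)) summable_on I"
  shows "bounded_linear_operator X N (shift_series I c z)"
proof -
  note * = shift_series_bounded[OF I sum]
  have add: "shift_series I c z (\<lambda>a. u a + w a) = (\<lambda>a. shift_series I c z u a + shift_series I c z w a)" if "u \<in> X" "w \<in> X" for u w
  proof
    fix \<phi>
    show "shift_series I c z (\<lambda>a. u a + w a) \<phi> = shift_series I c z u \<phi> + shift_series I c z w \<phi>"
      using infsum_add[OF *(3)[OF that(1)] *(3)[OF that(2)]]
      by (simp add: shift_series_def tf_shift_eq_shift_test distrib_left)
  qed
  have scale: "shift_series I c z (\<lambda>a. k * u a) = (\<lambda>a. k * shift_series I c z u a)" for k u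
  proof
    fix \<phi>
    have "shift_series I c z (\<lambda>a. k * u a) \<phi> = (\<Sum>\<^sub>\<infinity>i\<in>I. k * (c i * tf_shift (z i) u \<phi>))"
      by (simp add: shift_series_def tf_shift_eq_shift_test mult_ac)
    thus "shift_series I c z (\<lambda>a. k * u a) \<phi> = k * shift_series I c z u \<phi>"
      unfolding shift_series_def by (simp only: infsum_cmult_right')
  qed
  have "\<exists>B. \<forall>u\<in>X. N (shift_series I c z u) \<le> B * N u"
    using *(2) by blast
  with *(1) add scale show ?thesis unfolding bounded_linear_operator_def by simp
qed

end

lemma infinite_int_lattice: "infinite (int_lattice :: (real^'k::finite) set)"
proof -
  fix i :: 'k
  have "inj (\<lambda>n::nat. axis i (real n))" by (auto simp: inj_def axis_eq_axis)
  moreover have "range (\<lambda>n::nat. axis i (real n)) \<subseteq> int_lattice"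
    by (auto simp: int_lattice_def axis_def)
  ultimately show ?thesis
    using infinite_super range_inj_infinite by blast
qed

section \<open>Pseudodifferential operators with periodic symbols\<close>

theorem proposition3p1:
  fixes X :: "'n::finite functional set"
    and N :: "'n functional \<Rightarrow> real"
    and s C \<tau> :: real
    and L :: "real^('n + 'n)^('n + 'n)"
    and q :: "real^('n + 'n) \<Rightarrow> complex"
  defines "\<sigma> \<equiv> (\<lambda>\<kappa>. poly_weight s (J_mat *v (inv_transpose L *v \<kappa>))
                    * cmod (fourier q (inv_transpose L *v \<kappa>)))"
  assumes X: "tf_invariant_space X N s C"
    and L: "invertible L"
    and q: "integrable lebesgue q"
    and sigma: "\<sigma> summable_on int_lattice"
    and tau: "\<tau> \<in> {0..1}"
  shows "(\<exists>A. bounded_extension X N (Op \<tau> (distr_of (periodization L q))) A) \<and>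
         (\<forall>A. bounded_extension X N (Op \<tau> (distr_of (periodization L q))) A \<longrightarrow>
              operator_norm X N A \<le> C / \<bar>det L\<bar> * (\<Sum>\<^sub>\<infinity>\<kappa>\<in>int_lattice. \<sigma> \<kappa>))"
proof -
  interpret tf_invariant_space X N s C by (rule X)
  define \<zeta> where "\<zeta> = (\<lambda>\<kappa>. inv_transpose L *v \<kappa>)"
  \<comment> \<open>The phase is that of the operator with symbol \<open>exp (2\<pi>i \<zeta> \<cdot> z)\<close>.\<close>
  define c where "c = (\<lambda>\<kappa>. fourier q (\<zeta> \<kappa>) / complex_of_real \<bar>det L\<bar> * cis (2 * pi * (\<tau> * (pos (\<zeta> \<kappa>) \<bullet> freq (\<zeta> \<kappa>)))))"
  define A where "A = shift_series int_lattice c (\<lambda>\<kappa>. J_mat *v \<zeta> \<kappa>)"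
  define K where "K = C / \<bar>det L\<bar> * (\<Sum>\<^sub>\<infinity>\<kappa>\<in>int_lattice. \<sigma> \<kappa>)"
  note lattice = countable_int_lattice infinite_int_lattice
  have c_norm: "cmod (c \<kappa>) * poly_weight s (J_mat *v \<zeta> \<kappa>) = 1 / \<bar>det L\<bar> * \<sigma> \<kappa>" for \<kappa>
    by (simp add: c_def \<sigma>_def \<zeta>_def norm_mult norm_divide)
  have sum_c: "(\<lambda>\<kappa>. cmod (c \<kappa>) * poly_weight s (J_mat *v \<zeta> \<kappa>)) summable_on int_lattice"
    unfolding c_norm by (rule summable_on_cmult_right[OF sigma])
  \<comment> \<open>The weight is at least \<open>1\<close>, so the Fourier coefficients are themselves summable.\<close>
  have sum_fourier: "(\<lambda>\<kappa>. cmod (fourier q (inv_transpose L *v \<kappa>))) summable_on int_lattice"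
  proof (rule summable_on_comparison_test[OF sigma])
    show "cmod (fourier q (inv_transpose L *v \<kappa>)) \<le> \<sigma> \<kappa>" for \<kappa>
    proof -
      have "1 \<le> poly_weight s (J_mat *v (inv_transpose L *v \<kappa>))"
        unfolding poly_weight_def by (intro ge_one_powr_ge_zero s_ge_0) simp
      from mult_right_mono[OF this norm_ge_zero] show ?thesis by (simp add: \<sigma>_def)
    qed
  qed simp
  have A_le: "N (A u) \<le> K * N u" if "u \<in> X" for u
  proof -
    have "N (A u) \<le> C * (\<Sum>\<^sub>\<infinity>\<kappa>\<in>int_lattice. 1 / \<bar>det L\<bar> * \<sigma> \<kappa>) * N u"
      using shift_series_bounded(2)[OF lattice sum_c that] unfolding A_def c_norm .
    thus ?thesis unfolding infsum_cmult_right' by (simp add: K_def)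
  qed
  have A_Op: "A (distr_of u) = Op \<tau> (distr_of (periodization L q)) u" if u: "u \<in> schwartz" for u
  proof
    fix \<phi>
    show "A (distr_of u) \<phi> = Op \<tau> (distr_of (periodization L q)) u \<phi>"
    proof (cases "\<phi> \<in> schwartz")
      case True
      note W = wigner_schwartz[OF u True, of \<tau>]
      have "Op \<tau> (distr_of (periodization L q)) u \<phi> = (\<integral>z. periodization L q z * wigner \<tau> u \<phi> z \<partial>lebesgue)"
        using True W by (simp add: Op_def distr_of_def)
      also have "\<dots> = (\<Sum>\<^sub>\<infinity>\<kappa>\<in>int_lattice. fourier q (\<zeta> \<kappa>) / complex_of_real \<bar>det L\<bar>
          * (\<integral>z. cis (2 * pi * (\<zeta> \<kappa> \<bullet> z)) * wigner \<tau> u \<phi> z \<partial>lborel))"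
        unfolding \<zeta>_def by (rule integral_periodization[OF L q sum_fourier W])
      also have "\<dots> = A (distr_of u) \<phi>"
        unfolding integral_character_wigner[OF u True] A_def shift_series_def c_def by (simp only: mult.assoc)
      finally show ?thesis ..
    next
      case False
      have "A (distr_of u) \<in> X"
        unfolding A_def by (rule shift_series_bounded(1)[OF lattice sum_c schwartz_subset[OF u]])
      thus ?thesis using False by (simp add: vanishes_off_schwartz Op_def)
    qed
  qed
  have A: "bounded_extension X N (Op \<tau> (distr_of (periodization L q))) A"
    unfolding bounded_extension_def
    using shift_series_bounded_linear_operator[OF lattice sum_c] A_Op by (simp add: A_def)
  have K: "K \<ge> 0"
    unfolding K_def using C_pos
    by (intro mult_nonneg_nonneg divide_nonneg_nonneg infsum_nonneg) (auto simp: \<sigma>_def poly_weight_def)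
  have "operator_norm X N A' \<le> K" if A': "bounded_extension X N (Op \<tau> (distr_of (periodization L q))) A'" for A'
    unfolding operator_norm_def
  proof (rule cSUP_least)
    show "X \<noteq> {}" using zero by blast
    fix u assume u: "u \<in> X"
    have "N (A' u) \<le> K * N u"
      using A_le[OF u] unfolding bounded_extension_unique[OF A A' u] .
    thus "N (A' u) / N u \<le> K"
      using norm_ge_0[OF u] K by (cases "N u = 0") (auto simp: pos_divide_le_eq)
  qed
  with A show ?thesis unfolding K_def by blast
qed

end
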